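(* Let $n,k\in\mathbb{N}$, let $V,\widetilde V,W$ be finite dimensional real inner product spaces, let $\mathscr{A}\colon V\to\widetilde V$ be a linear map and let $\mathbb{B}=\sum_{|\alpha|=k}\mathbb{B}_\alpha\partial^\alpha$ be a $k$-th order, linear, homogeneous, constant coefficient differential operator on $\mathbb{R}^n$ from $V$ to $W$. Let $0<p_2<p_1<\infty$ and $-\infty<s_1<s_2<\infty$ be such that $$s_1-s_2\le k\qquad\text{and}\qquad s_1-\frac{n}{p_1}=s_2+k-\frac{n}{p_2}.$$ Moreover, let $\mathscr{A}$ and $\mathbb{B}$ satisfy $$\bigcup_{\xi\in\mathbb{R}^n\setminus\{0\}}\ker\mathscr{A}\cap\ker(\mathbb{B}[\xi])=\{0\}.$$ Then for any $0<q<\infty$ there exists a constant $c=c(s_2,p_1,q,\mathscr{A},\mathbb{B})>0$ such that $$\|P\|_{\dot{\mathrm F}^{s_1}_{p_1,q}(\mathbb{R}^n)}\le c\,\Big(\|\mathscr{A}[P]\|_{\dot{\mathrm F}^{s_1}_{p_1,q}(\mathbb{R}^n)}+\|\mathbb{B}P\|_{\dot{\mathrm F}^{s_2}_{p_2,q}(\mathbb{R}^n)}\Big)$$ holds for all $P\in\mathrm C_c^\infty(\mathbb{R}^n;V)$.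
   Context: Differential operator: $\mathbb{B}P=\sum_{|\alpha|=k}\mathbb{B}_\alpha\partial^\alpha P$ with fixed linear maps $\mathbb{B}_\alpha\colon V\to W$; its symbol is $\mathbb{B}[\xi]=\sum_{|\alpha|=k}\xi^\alpha\mathbb{B}_\alpha\colon V\to W$ for $\xi\in\mathbb{R}^n$. $\mathscr{A}[P]$ denotes pointwise application of $\mathscr{A}$. $\dot{\mathrm F}^{s}_{p,q}(\mathbb{R}^n)$ denotes the homogeneous Triebel-Lizorkin (quasi-normed) space in the sense of Triebel's Theory of Function Spaces (Chapter 5), i.e. with respect to a homogeneous dyadic Littlewood-Paley decomposition $(\varphi_j)_{j\in\mathbb{Z}}$, $\|u\|_{\dot{\mathrm F}^s_{p,q}}=\big\|\big(\sum_{j\in\mathbb{Z}}2^{jsq}|\mathscr{F}^{-1}(\varphi_j\widehat u)|^q\big)^{1/q}\big\|_{\mathrm L^p(\mathbb{R}^n)}$, extended to vector-valued maps in the usual way. $\mathrm C_c^\infty(\mathbb{R}^n;V)$ denotes the smooth compactly supported $V$-valued maps. *)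

theory Defs
  imports "HOL-Analysis.Analysis"
begin

section \<open>Multi-indices and partial derivatives\<close>

type_synonym 'n multi_index = "'n \<Rightarrow> nat"

definition mi_order :: "('n::finite) multi_index \<Rightarrow> nat" where
  "mi_order \<alpha> = (\<Sum>i\<in>UNIV. \<alpha> i)"

definition monomial :: "real ^ 'n \<Rightarrow> ('n::finite) multi_index \<Rightarrow> real" where
  "monomial \<xi> \<alpha> = (\<Prod>i\<in>UNIV. (\<xi> $ i) ^ \<alpha> i)"

text \<open>Sums over the multi-indices of a fixed order are genuine finite sums.\<close>

lemma finite_multi_index_order: "finite {\<alpha> :: ('n::finite) multi_index. mi_order \<alpha> = k}"
proof (rule finite_subset)
  show "{\<alpha> :: 'n multi_index. mi_order \<alpha> = k} \<subseteq> PiE UNIV (\<lambda>_. {..k})"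
    by (auto simp: mi_order_def intro: member_le_sum)
qed (simp add: finite_PiE)

definition partial_deriv ::
  "'n \<Rightarrow> (real ^ 'n \<Rightarrow> 'a) \<Rightarrow> real ^ 'n::finite \<Rightarrow> 'a::real_normed_vector" where
  "partial_deriv i f x = frechet_derivative f (at x) (axis i 1)"

primrec iterated_partial ::
  "'n list \<Rightarrow> (real ^ 'n \<Rightarrow> 'a) \<Rightarrow> real ^ 'n::finite \<Rightarrow> 'a::real_normed_vector" where
  "iterated_partial [] f = f"
| "iterated_partial (i # is) f = partial_deriv i (iterated_partial is f)"

text \<open>
  A function is of class \<open>C\<^sup>\<infinity>\<close> iff all its iterated partial derivatives exist and are
  continuous, equivalently iff all of them are Frechet differentiable everywhere.
\<close>

definition smooth :: "(real ^ 'n::finite \<Rightarrow> 'a::real_normed_vector) \<Rightarrow> bool" where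
  "smooth f \<longleftrightarrow> (\<forall>is. iterated_partial is f differentiable_on UNIV)"

text \<open>
  The index type carries no order, so \<open>\<partial>\<^sup>\<alpha>\<close> differentiates along an arbitrary but fixed list
  in which every \<open>i\<close> occurs exactly \<open>\<alpha> i\<close> times. It is only applied to smooth functions,
  for which the order of differentiation does not matter.
\<close>

definition mi_deriv ::
  "('n::finite) multi_index \<Rightarrow> (real ^ 'n \<Rightarrow> 'a) \<Rightarrow> real ^ 'n \<Rightarrow> 'a::real_normed_vector" where
  "mi_deriv \<alpha> f = iterated_partial (SOME is. \<forall>i. count_list is i = \<alpha> i) f"

definition test_functions :: "(real ^ 'n::finite \<Rightarrow> 'a::real_normed_vector) set" where
  "test_functions = {f. smooth f \<and> compact (closure {x. f x \<noteq> 0})}"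


section \<open>Homogeneous differential operators with constant coefficients\<close>

definition diff_op ::
  "nat \<Rightarrow> (('n::finite) multi_index \<Rightarrow> 'v::real_normed_vector \<Rightarrow> 'w::real_normed_vector) \<Rightarrow>
    (real ^ 'n \<Rightarrow> 'v) \<Rightarrow> real ^ 'n \<Rightarrow> 'w" where
  "diff_op k B P x = (\<Sum>\<alpha> | mi_order \<alpha> = k. B \<alpha> (mi_deriv \<alpha> P x))"

definition symbol ::
  "nat \<Rightarrow> (('n::finite) multi_index \<Rightarrow> 'v \<Rightarrow> 'w) \<Rightarrow> real ^ 'n \<Rightarrow> 'v \<Rightarrow> 'w::real_vector" where
  "symbol k B \<xi> v = (\<Sum>\<alpha> | mi_order \<alpha> = k. monomial \<xi> \<alpha> *\<^sub>R B \<alpha> v)"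

definition ker :: "('v \<Rightarrow> 'w::zero) \<Rightarrow> 'v set" where
  "ker f = {v. f v = 0}"


section \<open>Fourier transform of vector-valued functions\<close>

text \<open>
  The complexification of a real inner product space \<open>'a\<close> is represented by \<open>'a \<times> 'a\<close>, the pair
  \<open>(v, w)\<close> standing for \<open>v + \<i> w\<close>; the product norm is the Hermitian norm of the
  complexification.
\<close>

definition cscale :: "complex \<Rightarrow> 'a \<times> 'a \<Rightarrow> 'a \<times> 'a::real_vector" where
  "cscale z u = (Re z *\<^sub>R fst u - Im z *\<^sub>R snd u, Re z *\<^sub>R snd u + Im z *\<^sub>R fst u)"

definition fourier ::
  "(real ^ 'n::finite \<Rightarrow> 'a \<times> 'a) \<Rightarrow> real ^ 'n \<Rightarrow> 'a \<times> 'a::euclidean_space" where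
  "fourier f \<xi> =
    ((2 * pi) powr (- real CARD('n) / 2)) *\<^sub>R (LINT x|lborel. cscale (cis (- (x \<bullet> \<xi>))) (f x))"

definition inverse_fourier ::
  "(real ^ 'n::finite \<Rightarrow> 'a \<times> 'a) \<Rightarrow> real ^ 'n \<Rightarrow> 'a \<times> 'a::euclidean_space" where
  "inverse_fourier f x =
    ((2 * pi) powr (- real CARD('n) / 2)) *\<^sub>R (LINT \<xi>|lborel. cscale (cis (x \<bullet> \<xi>)) (f \<xi>))"


section \<open>Homogeneous Triebel-Lizorkin quasi-norms\<close>

text \<open>
  Homogeneous smooth dyadic resolutions of unity, as in Triebel, Theory of Function Spaces,
  Chapter 5. The sum over \<open>j\<close> is locally finite away from the origin.
\<close>

definition dyadic_decomposition :: "(int \<Rightarrow> real ^ 'n::finite \<Rightarrow> complex) \<Rightarrow> bool" where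
  "dyadic_decomposition \<phi> \<longleftrightarrow>
    (\<forall>j. smooth (\<phi> j)) \<and>
    (\<forall>j. {\<xi>. \<phi> j \<xi> \<noteq> 0} \<subseteq> {\<xi>. 2 powi (j - 1) \<le> norm \<xi> \<and> norm \<xi> \<le> 2 powi (j + 1)}) \<and>
    (\<forall>\<alpha>. \<exists>C. \<forall>j \<xi>. 2 powi (j * int (mi_order \<alpha>)) * norm (mi_deriv \<alpha> (\<phi> j) \<xi>) \<le> C) \<and>
    (\<forall>\<xi>. \<xi> \<noteq> 0 \<longrightarrow> ((\<lambda>j. \<phi> j \<xi>) has_sum 1) UNIV)"

definition lp_piece ::
  "(int \<Rightarrow> real ^ 'n::finite \<Rightarrow> complex) \<Rightarrow> int \<Rightarrow> (real ^ 'n \<Rightarrow> 'a) \<Rightarrow>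
    real ^ 'n \<Rightarrow> 'a \<times> 'a::euclidean_space" where
  "lp_piece \<phi> j u = inverse_fourier (\<lambda>\<xi>. cscale (\<phi> j \<xi>) (fourier (\<lambda>x. (u x, 0)) \<xi>))"

text \<open>Real powers of extended nonnegative numbers, for exponents \<open>a > 0\<close> only.\<close>

definition ennreal_rpow :: "ennreal \<Rightarrow> real \<Rightarrow> ennreal" where
  "ennreal_rpow x a = (if x = top then top else ennreal (enn2real x powr a))"

text \<open>
  For \<open>0 < p, q < \<infinity>\<close>. The value may be \<open>\<infinity>\<close>, even for test functions (because of the low
  frequencies). The Fourier transform being defined by an integral, the definition is
  meaningful for integrable \<open>u\<close>, and it is only used for test functions.
\<close>

definition TL_norm ::
  "(int \<Rightarrow> real ^ 'n::finite \<Rightarrow> complex) \<Rightarrow> real \<Rightarrow> real \<Rightarrow> real \<Rightarrow>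
    (real ^ 'n \<Rightarrow> 'a::euclidean_space) \<Rightarrow> ennreal" where
  "TL_norm \<phi> s p q u =
    ennreal_rpow
      (\<integral>\<^sup>+ x. ennreal_rpow
          (ennreal_rpow
            (\<Sum>\<^sub>\<infinity>j\<in>UNIV. ennreal (2 powr (real_of_int j * s * q) * norm (lp_piece \<phi> j u x) powr q))
            (1 / q)) p
        \<partial>lborel)
      (1 / p)"

end

theory Submission
  imports Defs "HOL-Probability.Probability"
begin

text \<open>
  On the Fourier side $\hat P = R_1 \mathscr{A} \hat P + R_2\, \widehat{\mathbb{B} P}$, where the left
  inverse $(R_1, R_2)$ of $(\mathscr{A}, \mathbb{B}[\xi])$ is smooth away from the origin. After localisation to
  a dyadic annulus and rescaling, $R_1$ and $R_2$ are convolutions with fixed rapidly decreasing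
  kernels, so that every Littlewood--Paley piece of $P$ is bounded by the Peetre maximal functions
  of the pieces of $\mathscr{A}[P]$ and, with a factor $2^{-jk}$, of $\mathbb{B} P$. A vector-valued
  maximal inequality removes the maximal functions in the $\mathrm{L}^{p_1}(\ell^q)$ norm, which gives
  $\|P\|_{\dot{\mathrm F}^{s_1}_{p_1,q}} \lesssim \|\mathscr{A}[P]\|_{\dot{\mathrm F}^{s_1}_{p_1,q}} +
  \|\mathbb{B} P\|_{\dot{\mathrm F}^{s_1-k}_{p_1,q}}$, and the Jawerth embedding
  $\dot{\mathrm F}^{s_2}_{p_2,q} \subset \dot{\mathrm F}^{s_1-k}_{p_1,q}$ finishes the argument.

  The constant has to be independent of $s_1$ and $p_2$. The dependence on $s_1$ disappears because
  the weights $2^{js}$ never enter the maximal inequality. For $p_2 \to 0$ one needs Nikolskii's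
  inequality for functions with frequencies in the ball of radius $2^{j+1}$ with constant $1$; it follows from
  Plancherel's theorem because the frequency cube of side $4 \cdot 2^j$ is smaller than
  $(2\pi 2^j)^n$.
\<close>


section \<open>Powers of extended nonnegative numbers\<close>

text \<open>The maximal inequality has to cover all positive \<open>p\<close>, \<open>q\<close>, in
  particular p/q < 1. What drives it is that a band-limited piece whose Peetre function is large at
  x is itself large on an entire ball, of radius comparable to its wavelength and at a controlled
  distance from x. A quantity dominated on an entire ball can be averaged over any half of that
  ball. After a sum over dyadic distances, only the scalar maximal function enters: through a dual
  weight if the exponent p/q exceeds 1, through level sets if it is below 1. The quasi-norms may be
  infinite, so estimates are made in \<open>ennreal\<close>, and finiteness is secured by truncation
  before a term is absorbed. The constant must survive not only \<open>p\<^sub>2\<close> tending to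
  0 but also \<open>p\<^sub>2\<close> tending to \<open>p\<^sub>1\<close>, where the gap in
  smoothness of the embedding closes and a geometric series in that gap would blow up.\<close>

lemma ennreal_rpow_ennreal: "0 \<le> x \<Longrightarrow> ennreal_rpow (ennreal x) a = ennreal (x powr a)"
  by (simp add: ennreal_rpow_def)

lemma ennreal_rpow_top [simp]: "ennreal_rpow top a = top"
  by (simp add: ennreal_rpow_def)

lemma ennreal_rpow_0 [simp]: "ennreal_rpow 0 a = 0"
  by (simp add: ennreal_rpow_def)

lemma ennreal_rpow_1 [simp]: "ennreal_rpow x 1 = x"
  by (cases x) (auto simp: ennreal_rpow_def)

lemma ennreal_rpow_mono: "x \<le> y \<Longrightarrow> 0 < a \<Longrightarrow> ennreal_rpow x a \<le> ennreal_rpow y a"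
  by (cases x; cases y) (auto simp: ennreal_rpow_def top_unique intro!: ennreal_leI powr_mono2)

lemma ennreal_rpow_mult: "0 < a \<Longrightarrow> ennreal_rpow (x * y) a = ennreal_rpow x a * ennreal_rpow y a"
  by (cases x; cases y)
    (auto simp: ennreal_rpow_def powr_mult ennreal_mult ennreal_mult_top ennreal_top_mult simp flip: ennreal_mult
      split: if_splits)

lemma ennreal_rpow_rpow: "ennreal_rpow (ennreal_rpow x a) b = ennreal_rpow x (a * b)"
  by (cases x) (auto simp: ennreal_rpow_def powr_powr)

lemma ennreal_rpow_add:
  "0 < a \<Longrightarrow> 0 < b \<Longrightarrow> ennreal_rpow x (a + b) = ennreal_rpow x a * ennreal_rpow x b"
  by (cases x) (auto simp: ennreal_rpow_def powr_add ennreal_mult)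

lemma ennreal_rpow_eq_0 [simp]: "ennreal_rpow x a = 0 \<longleftrightarrow> x = 0"
  by (cases x) (auto simp: ennreal_rpow_def)

lemma ennreal_rpow_eq_top [simp]: "ennreal_rpow x a = top \<longleftrightarrow> x = top"
  by (cases x) (auto simp: ennreal_rpow_def)

lemma borel_measurable_ennreal_rpow: "(\<lambda>x. ennreal_rpow x a) \<in> borel_measurable borel"
proof -
  have "{x::ennreal. x = top} \<in> sets borel" by simp
  then show ?thesis unfolding ennreal_rpow_def by (intro measurable_If) auto
qed

lemma ennreal_rpow_measurable [measurable]:
  "f \<in> borel_measurable M \<Longrightarrow> (\<lambda>x. ennreal_rpow (f x) a) \<in> borel_measurable M"
  by (rule measurable_compose[OF _ borel_measurable_ennreal_rpow])

text \<open>Divided by \<open>x + y\<close>, both summands lie in [0, 1], where a power with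
  exponent at most 1 can only increase them; the normalised summands add up to 1.\<close>

lemma powr_add_le:
  fixes x y t :: real
  assumes "0 \<le> x" "0 \<le> y" "0 < t" "t \<le> 1"
  shows "(x + y) powr t \<le> x powr t + y powr t"
proof (cases "x + y = 0")
  case False
  then have s: "0 < x + y" using assms by auto
  have "z / (x+y) \<le> (z / (x+y)) powr t" if "0 \<le> z" "z \<le> x + y" for z
    using powr_mono'[of t 1 "z / (x+y)"] that s assms by (auto simp: divide_simps split: if_splits)
  then have "x/(x+y) + y/(x+y) \<le> (x/(x+y)) powr t + (y/(x+y)) powr t"
    using assms by (intro add_mono) auto
  moreover have "x/(x+y) + y/(x+y) = 1" using s by (simp flip: add_divide_distrib)
  ultimately have "1 \<le> x powr t / (x+y) powr t + y powr t / (x+y) powr t"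
    using assms by (simp add: powr_divide)
  then show ?thesis
    using s by (simp flip: add_divide_distrib add: le_divide_eq)
qed (use assms in auto)

lemma ennreal_rpow_add_le:
  assumes "0 < t" "t \<le> 1"
  shows "ennreal_rpow (x + y) t \<le> ennreal_rpow x t + ennreal_rpow y t"
  using assms by (cases x; cases y)
    (auto simp: ennreal_rpow_def powr_add_le simp flip: ennreal_plus intro!: ennreal_leI)

lemma ennreal_rpow_sum_le:
  assumes "0 < t" "t \<le> 1" "finite I"
  shows "ennreal_rpow (\<Sum>i\<in>I. f i) t \<le> (\<Sum>i\<in>I. ennreal_rpow (f i) t)"
  using assms(3)
proof (induction I)
  case (insert i I)
  then show ?case
    using ennreal_rpow_add_le[OF assms(1,2), of "f i" "sum f I"] by (auto intro: order_trans add_left_mono)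
qed auto

text \<open>The power 1/t inverts the power \<open>t\<close> and is monotone too, so an upper bound
  for all \<open>ennreal_rpow (f i) t\<close> is pulled back to one for all
  \<open>f i\<close>.\<close>

lemma ennreal_rpow_cont_mono:
  assumes "0 < t" "incseq f"
  shows "ennreal_rpow (SUP i. f i) t = (SUP i::nat. ennreal_rpow (f i) t)"
proof (rule antisym)
  let ?S = "SUP i. ennreal_rpow (f i) t"
  have "f i \<le> ennreal_rpow ?S (1/t)" for i
  proof -
    have "ennreal_rpow (ennreal_rpow (f i) t) (1/t) \<le> ennreal_rpow ?S (1/t)"
      using assms by (intro ennreal_rpow_mono SUP_upper) auto
    then show ?thesis using assms by (simp add: ennreal_rpow_rpow)
  qed
  then have "(SUP i. f i) \<le> ennreal_rpow ?S (1/t)" by (rule SUP_least)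
  then have "ennreal_rpow (SUP i. f i) t \<le> ennreal_rpow (ennreal_rpow ?S (1/t)) t"
    using assms by (intro ennreal_rpow_mono)
  then show "ennreal_rpow (SUP i. f i) t \<le> ?S" using assms by (simp add: ennreal_rpow_rpow)
qed (use assms in \<open>auto intro!: SUP_least ennreal_rpow_mono SUP_upper\<close>)

lemma ennreal_rpow_suminf_le:
  assumes "0 < t" "t \<le> 1"
  shows "ennreal_rpow (\<Sum>i. f i) t \<le> (\<Sum>i. ennreal_rpow (f i) t)"
proof -
  have "ennreal_rpow (\<Sum>i. f i) t = (SUP n. ennreal_rpow (\<Sum>i<n. f i) t)"
    unfolding suminf_eq_SUP using assms by (intro ennreal_rpow_cont_mono) (auto simp: incseq_def intro!: sum_mono2)
  also have "\<dots> \<le> (SUP n. (\<Sum>i<n. ennreal_rpow (f i) t))"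
    using assms by (intro SUP_mono') (auto intro!: ennreal_rpow_sum_le)
  finally show ?thesis by (simp add: suminf_eq_SUP)
qed

section \<open>Layer cake formulas\<close>

lemma nn_integral_powr_Icc:
  assumes "0 < t" "0 \<le> r"
  shows "(\<integral>\<^sup>+l. ennreal (t * l powr (t - 1)) * indicator {0..r} l \<partial>lborel) = ennreal (r powr t)"
proof -
  have "((\<lambda>l. t * l powr (t - 1)) has_integral t * (r powr (t - 1 + 1) / (t - 1 + 1))) {0..r}"
    using assms by (intro has_integral_mult_right has_integral_powr_from_0) auto
  from nn_integral_has_integral_lebesgue'[OF _ this] show ?thesis using assms by simp
qed

lemma nn_integral_powr_atLeast:
  assumes "t < -1" "0 < r"
  shows "(\<integral>\<^sup>+l. ennreal (l powr t) * indicator {r..} l \<partial>lborel) = ennreal (r powr (t + 1) / - (t + 1))"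
proof -
  have "((\<lambda>l. l powr t) has_integral - (r powr (t + 1)) / (t + 1)) {r..}"
    using assms by (intro has_integral_powr_to_inf) auto
  from nn_integral_has_integral_lebesgue'[OF _ this] show ?thesis
    by (simp only: divide_minus_right minus_divide_left powr_ge_zero)
qed

text \<open>A power is the integral of its derivative over all levels below \<open>x\<close>.
  Combined with Tonelli it reduces integrals of powers to measures of superlevel sets. For
  \<open>x = top\<close> the integral exceeds every finite bound.\<close>

lemma ennreal_rpow_layer_cake:
  assumes "0 < t"
  shows "ennreal_rpow x t = (\<integral>\<^sup>+l. ennreal (t * l powr (t - 1)) * indicator {l. 0 < l \<and> ennreal l < x} l \<partial>lborel)"
proof (cases x)
  case (real r)
  have "(\<integral>\<^sup>+l. ennreal (t * l powr (t - 1)) * indicator {l. 0 < l \<and> ennreal l < x} l \<partial>lborel)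
     = (\<integral>\<^sup>+l. ennreal (t * l powr (t - 1)) * indicator {0..r} l \<partial>lborel)"
    using AE_lborel_singleton[of r] AE_lborel_singleton[of 0]
    by (intro nn_integral_cong_AE, eventually_elim)
      (use real in \<open>auto split: split_indicator simp: ennreal_less_iff\<close>)
  then show ?thesis using nn_integral_powr_Icc assms real by (simp add: ennreal_rpow_ennreal)
next
  case top
  let ?I = "\<integral>\<^sup>+l. ennreal (t * l powr (t - 1)) * indicator {l. 0 < l \<and> ennreal l < x} l \<partial>lborel"
  have *: "ennreal c \<le> ?I" if "0 \<le> c" for c
  proof -
    have "ennreal c = ennreal ((c powr (1/t)) powr t)" using that assms by (simp add: powr_powr)
    also have "\<dots> = (\<integral>\<^sup>+l. ennreal (t * l powr (t - 1)) * indicator {0..c powr (1/t)} l \<partial>lborel)"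
      using assms by (subst nn_integral_powr_Icc) auto
    also have "\<dots> \<le> ?I"
      by (intro nn_integral_mono) (auto split: split_indicator simp: top order.strict_iff_order)
    finally show ?thesis .
  qed
  have "?I = top"
  proof (cases "?I")
    case (real r)
    then show ?thesis using *[of "r + 1"] by (simp del: ennreal_plus)
  qed
  then show ?thesis by (simp add: top)
qed

text \<open>The counterpart above the level \<open>x\<close>: the tail integral of l^(t-2) converges
  because \<open>t < 1\<close>, with value x^(t-1)/(1-t) for positive finite \<open>x\<close>. It
  evaluates the part of a level-set estimate that integrates a function over the set where it is at
  most \<open>l\<close>.\<close>

lemma ennreal_rpow_layer_cake_tail:
  assumes "0 < t" "t < 1"
  shows "(\<integral>\<^sup>+l. ennreal (t * l powr (t - 2)) * (x * indicator {l. 0 < l \<and> x \<le> ennreal l} l) \<partial>lborel)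
     \<le> ennreal (t / (1 - t)) * ennreal_rpow x t"
proof (cases x)
  case (real r)
  show ?thesis
  proof (cases "r = 0")
    case False
    then have r: "0 < r" using real by auto
    have "(\<integral>\<^sup>+l. ennreal (t * l powr (t - 2)) * (x * indicator {l. 0 < l \<and> x \<le> ennreal l} l) \<partial>lborel)
      = (\<integral>\<^sup>+l. ennreal (t * r) * (ennreal (l powr (t - 2)) * indicator {r..} l) \<partial>lborel)"
      using r assms
      by (intro nn_integral_cong) (auto split: split_indicator simp: real ennreal_le_iff2 ac_simps simp flip: ennreal_mult)
    also have "\<dots> = ennreal (t * r) * ennreal (r powr (t - 1) / (1 - t))"
      using r assms nn_integral_powr_atLeast[of "t - 2" r] by (subst nn_integral_cmult) auto
    also have "\<dots> = ennreal (t / (1 - t)) * ennreal_rpow x t"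
      using r assms real by (simp add: ennreal_rpow_ennreal powr_diff flip: ennreal_mult)
    finally show ?thesis by simp
  qed (simp add: real)
qed (simp add: assms top_unique)


section \<open>The Hardy--Littlewood maximal function\<close>

lemma emeasure_ball_scale:
  fixes z y :: "'a::euclidean_space"
  assumes "0 < c" "0 < r"
  shows "emeasure lborel (ball z (c * r)) = ennreal (c ^ DIM('a)) * emeasure lborel (ball y r)"
  using assms by (simp add: emeasure_ball power_mult_distrib ac_simps flip: ennreal_mult)

lemma emeasure_ball_pos: "0 < r \<Longrightarrow> 0 < emeasure lborel (ball (z::'a::euclidean_space) r)"
  by (simp add: emeasure_ball)

lemma emeasure_ball_neq_top: "emeasure lborel (ball (z::'a::euclidean_space) r) \<noteq> top"
  using emeasure_lborel_ball_finite[of z r] by simp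

lemma divide_le_ennreal_iff: "b \<noteq> 0 \<Longrightarrow> b < top \<Longrightarrow> a / b \<le> c \<longleftrightarrow> a \<le> (c * b :: ennreal)"
  by (cases a; cases b; cases c)
    (auto simp: divide_ennreal ennreal_mult[symmetric] ennreal_le_iff field_simps ennreal_top_mult ennreal_top_divide top_unique)

lemma ball_in_sets_borel [measurable]: "ball z r \<in> sets borel"
  by simp

text \<open>Uncentred balls: every superlevel set is then a union of open balls, so the function is
  Borel without any assumption on \<open>w\<close>.\<close>

definition maximal_fn :: "('a::euclidean_space \<Rightarrow> ennreal) \<Rightarrow> 'a \<Rightarrow> ennreal" where
  "maximal_fn w x = (SUP (z, r)\<in>{(z, r). 0 < r \<and> dist z x < r}.
     (\<integral>\<^sup>+y. w y * indicator (ball z r) y \<partial>lborel) / emeasure lborel (ball z r))"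

lemma maximal_fn_upper:
  fixes w :: "'a::euclidean_space \<Rightarrow> ennreal"
  assumes "dist z x < r"
  shows "(\<integral>\<^sup>+y. w y * indicator (ball z r) y \<partial>lborel) \<le> maximal_fn w x * emeasure lborel (ball z r)"
proof -
  have r: "0 < r" using assms zero_le_dist[of z x] by linarith
  have "(\<integral>\<^sup>+y. w y * indicator (ball z r) y \<partial>lborel) / emeasure lborel (ball z r) \<le> maximal_fn w x"
    unfolding maximal_fn_def using assms r by (intro SUP_upper2[of "(z, r)"]) auto
  then show ?thesis
    using r emeasure_ball_pos[of r z] emeasure_ball_neq_top[of z r]
    by (subst (asm) divide_le_ennreal_iff) (auto simp: less_top)
qed

lemma less_maximal_fn_iff:
  fixes w :: "'a::euclidean_space \<Rightarrow> ennreal"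
  shows "l < maximal_fn w x \<longleftrightarrow> (\<exists>z r. 0 < r \<and> dist z x < r \<and>
    l * emeasure lborel (ball z r) < (\<integral>\<^sup>+y. w y * indicator (ball z r) y \<partial>lborel))"
proof -
  have "l < u / emeasure lborel (ball z r) \<longleftrightarrow> l * emeasure lborel (ball z r) < u" if "0 < r"
    for z :: 'a and r u
    using emeasure_ball_pos[OF that, of z] emeasure_ball_neq_top[of z r] divide_le_ennreal_iff
    by (subst (1 2) not_le[symmetric]) (auto simp: less_top)
  then show ?thesis
    unfolding maximal_fn_def less_SUP_iff Bex_def split_paired_Ex by (simp cong: conj_cong)
qed

lemma open_less_maximal_fn: "open {x. l < maximal_fn (w :: 'a::euclidean_space \<Rightarrow> ennreal) x}"
proof -
  have "{x. l < maximal_fn w x} = (\<Union>(z, r)\<in>{(z, r). 0 < r \<and>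
    l * emeasure lborel (ball z r) < (\<integral>\<^sup>+y. w y * indicator (ball z r) y \<partial>lborel)}. ball z r)"
    unfolding set_eq_iff mem_Collect_eq less_maximal_fn_iff UN_iff Bex_def split_paired_Ex
    by (simp add: conj_commute cong: conj_cong) metis
  then show ?thesis by auto
qed

lemma borel_measurable_maximal_fn [measurable]:
  "maximal_fn (w :: 'a::euclidean_space \<Rightarrow> ennreal) \<in> borel_measurable borel"
  by (rule borel_measurableI_greater) (simp add: open_less_maximal_fn borel_open)

text \<open>The superlevel set is covered by fivefold enlargements of countably many disjoint balls
  on which the average of \<open>w\<close> exceeds \<open>l\<close>; 5^n is the price of the
  enlargement.\<close>

lemma maximal_fn_weak_type:
  fixes w :: "'a::euclidean_space \<Rightarrow> ennreal"
  assumes [measurable]: "w \<in> borel_measurable borel"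
  shows "l * emeasure lborel {x. l < maximal_fn w x} \<le> 5 ^ DIM('a) * (\<integral>\<^sup>+y. w y \<partial>lborel)"
proof (cases "(\<integral>\<^sup>+y. w y \<partial>lborel) = top \<or> l = 0 \<or> l = top")
  case True
  then show ?thesis by (auto simp: ennreal_mult_top)
next
  case False
  then obtain W m where W: "(\<integral>\<^sup>+y. w y \<partial>lborel) = ennreal W" "0 \<le> W" and m: "l = ennreal m" "0 < m"
    by (cases "\<integral>\<^sup>+y. w y \<partial>lborel"; cases l) auto
  let ?I = "\<lambda>i. \<integral>\<^sup>+y. w y * indicator (ball (fst i) (snd i)) y \<partial>lborel"
  define K where "K = {i :: 'a \<times> real. 0 < snd i \<and> l * emeasure lborel (ball (fst i) (snd i)) < ?I i}"
  define V where "V = unit_ball_vol DIM('a)"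
  have V: "0 < V" by (simp add: V_def)
  have S: "{x. l < maximal_fn w x} \<subseteq> (\<Union>i\<in>K. ball (fst i) (snd i))"
  proof
    fix x assume "x \<in> {x. l < maximal_fn w x}"
    then obtain z r where "(z, r) \<in> K" "x \<in> ball z r"
      unfolding K_def less_maximal_fn_iff mem_Collect_eq by fastforce
    then show "x \<in> (\<Union>i\<in>K. ball (fst i) (snd i))" by force
  qed
  \<comment> \<open>Vitali's lemma requires bounded radii. An admissible ball has volume at most
    W/m, and a radius above 1 is at most its own n-th power.\<close>
  have "snd i \<le> max 1 (W / (m * V))" if "i \<in> K" for i
  proof -
    have "l * emeasure lborel (ball (fst i) (snd i)) \<le> (\<integral>\<^sup>+y. w y \<partial>lborel)"
      using that by (intro order.trans[OF order.strict_implies_order nn_integral_mono])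
        (auto simp: K_def split: split_indicator)
    then have "ennreal (m * (V * snd i ^ DIM('a))) \<le> ennreal W"
      using that V m W by (auto simp: K_def emeasure_ball V_def simp flip: ennreal_mult)
    then have *: "m * (V * snd i ^ DIM('a)) \<le> W" using W by simp
    show ?thesis
    proof (cases "snd i \<le> 1")
      case False
      then have "snd i \<le> snd i ^ DIM('a)" by (intro self_le_power) auto
      also have "\<dots> \<le> W / (m * V)" using * m V by (simp add: field_simps)
      finally show ?thesis by simp
    qed simp
  qed
  then have rb: "\<And>i. i \<in> K \<Longrightarrow> 0 < snd i \<and> snd i \<le> max 1 (W / (m * V))" by (auto simp: K_def)
  obtain C where C: "countable C" "C \<subseteq> K"
    and disj: "pairwise (\<lambda>i j. disjnt (ball (fst i) (snd i)) (ball (fst j) (snd j))) C"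
    and cover: "{x. l < maximal_fn w x} \<subseteq> (\<Union>i\<in>C. ball (fst i) (5 * snd i))"
    by (rule Vitali_covering_lemma_balls[OF S rb])
  have "l * emeasure lborel {x. l < maximal_fn w x} =
      l * (\<integral>\<^sup>+x. indicator {x. l < maximal_fn w x} x \<partial>lborel)"
    by (subst nn_integral_indicator) (auto intro: borel_open open_less_maximal_fn)
  \<comment> \<open>The selected balls are summed as an integral over counting measure, so that both
    exchanges of sum and integral are instances of Tonelli.\<close>
  also have "\<dots> \<le> l * (\<integral>\<^sup>+x. \<integral>\<^sup>+i. indicator (ball (fst i) (5 * snd i)) x \<partial>count_space C \<partial>lborel)"
  proof (intro mult_left_mono nn_integral_mono)
    fix x
    show "indicator {x. l < maximal_fn w x} x
      \<le> (\<integral>\<^sup>+i. indicator (ball (fst i) (5 * snd i)) x \<partial>count_space C)"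
    proof (cases "l < maximal_fn w x")
      case True
      then obtain i where "i \<in> C" "x \<in> ball (fst i) (5 * snd i)" using cover by blast
      then show ?thesis
        using nn_integral_ge_point[of i C "\<lambda>i. indicator (ball (fst i) (5 * snd i)) x"] True by simp
    qed simp
  qed simp
  also have "\<dots> = l * (\<integral>\<^sup>+i. emeasure lborel (ball (fst i) (5 * snd i)) \<partial>count_space C)"
    using C by (subst nn_integral_count_space_nn_integral) auto
  also have "\<dots> = (\<integral>\<^sup>+i. 5 ^ DIM('a) * (l * emeasure lborel (ball (fst i) (snd i))) \<partial>count_space C)"
  proof (subst nn_integral_cmult[symmetric], simp, intro nn_integral_cong)
    fix i assume "i \<in> space (count_space C)"
    then have "0 < snd i" using C by (auto simp: K_def)
    then show "l * emeasure lborel (ball (fst i) (5 * snd i)) = 5 ^ DIM('a) * (l * emeasure lborel (ball (fst i) (snd i)))"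
      using emeasure_ball_scale[of 5 "snd i" "fst i" "fst i"]
      by (simp only: ennreal_numeral ennreal_power[symmetric] ac_simps)
  qed
  also have "\<dots> \<le> (\<integral>\<^sup>+i. 5 ^ DIM('a) * ?I i \<partial>count_space C)"
    using C by (intro nn_integral_mono mult_left_mono) (auto simp: K_def subset_eq order.strict_implies_order)
  also have "\<dots> = 5 ^ DIM('a) * (\<integral>\<^sup>+i. ?I i \<partial>count_space C)"
    by (rule nn_integral_cmult) simp
  also have "(\<integral>\<^sup>+i. ?I i \<partial>count_space C)
      = (\<integral>\<^sup>+y. \<integral>\<^sup>+i. w y * indicator (ball (fst i) (snd i)) y \<partial>count_space C \<partial>lborel)"
    using C by (subst nn_integral_count_space_nn_integral) auto
  also have "\<dots> \<le> (\<integral>\<^sup>+y. w y \<partial>lborel)"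
  proof (intro nn_integral_mono)
    fix y
    show "(\<integral>\<^sup>+i. w y * indicator (ball (fst i) (snd i)) y \<partial>count_space C) \<le> w y"
    proof (cases "\<exists>i\<in>C. y \<in> ball (fst i) (snd i)")
      case True
      then obtain i where i: "i \<in> C" "y \<in> ball (fst i) (snd i)" by blast
      \<comment> \<open>By disjointness at most one selected ball contains \<open>y\<close>, so the
        sum over the balls does not exceed \<open>w y\<close>.\<close>
      have "j = i" if "j \<in> C" "y \<in> ball (fst j) (snd j)" for j
      proof (rule ccontr)
        assume "j \<noteq> i"
        with disj i(1) that(1) have "disjnt (ball (fst j) (snd j)) (ball (fst i) (snd i))"
          by (simp add: pairwise_def)
        with i(2) that(2) show False by (auto simp: disjnt_iff)
      qed
      then have "w y * indicator (ball (fst j) (snd j)) y = w y * indicator {i} j" if "j \<in> C" for j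
        using i that by (metis indicator_simps singleton_iff)
      then have "(\<integral>\<^sup>+j. w y * indicator (ball (fst j) (snd j)) y \<partial>count_space C)
          = (\<integral>\<^sup>+j. w y * indicator {i} j \<partial>count_space C)"
        by (intro nn_integral_cong) simp
      also have "\<dots> \<le> w y" using i by (simp add: nn_integral_cmult_indicator)
      finally show ?thesis .
    next
      case False
      then have "(\<integral>\<^sup>+j. w y * indicator (ball (fst j) (snd j)) y \<partial>count_space C)
          = (\<integral>\<^sup>+j. 0 \<partial>count_space C)"
        by (intro nn_integral_cong) (auto split: split_indicator)
      then show ?thesis by simp
    qed
  qed
  finally show ?thesis by (simp add: mult_left_mono)
qed

lemma nn_integral_rpow_layer_cake:
  fixes f :: "'a::euclidean_space \<Rightarrow> ennreal"
  assumes [measurable]: "f \<in> borel_measurable borel" and "0 < t"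
  shows "(\<integral>\<^sup>+x. ennreal_rpow (f x) t \<partial>lborel)
    = (\<integral>\<^sup>+l. ennreal (t * l powr (t - 1)) * indicator {0<..} l * emeasure lborel {x. ennreal l < f x} \<partial>lborel)"
proof -
  have "(\<integral>\<^sup>+x. ennreal_rpow (f x) t \<partial>lborel)
     = (\<integral>\<^sup>+x. \<integral>\<^sup>+l. ennreal (t * l powr (t - 1)) * indicator {l. 0 < l \<and> ennreal l < f x} l \<partial>lborel \<partial>lborel)"
    using assms by (simp add: ennreal_rpow_layer_cake)
  also have "\<dots> = (\<integral>\<^sup>+x. \<integral>\<^sup>+l. ennreal (t * l powr (t - 1)) * indicator {0<..} l *
      indicator {p. ennreal (snd p) < f (fst p)} (x, l) \<partial>lborel \<partial>lborel)"
    by (intro nn_integral_cong) (auto split: split_indicator)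
  also have "\<dots> = (\<integral>\<^sup>+l. \<integral>\<^sup>+x. ennreal (t * l powr (t - 1)) * indicator {0<..} l *
      indicator {p. ennreal (snd p) < f (fst p)} (x, l) \<partial>lborel \<partial>lborel)"
    by (rule lborel_pair.Fubini'[symmetric]) (unfold case_prod_beta', measurable)
  also have "\<dots> = (\<integral>\<^sup>+l. ennreal (t * l powr (t - 1)) * indicator {0<..} l *
      emeasure lborel {x. ennreal l < f x} \<partial>lborel)"
  proof (intro nn_integral_cong)
    fix l :: real
    have "(\<integral>\<^sup>+x. ennreal (t * l powr (t - 1)) * indicator {0<..} l *
        indicator {p. ennreal (snd p) < f (fst p)} (x, l) \<partial>lborel)
      = (\<integral>\<^sup>+x. ennreal (t * l powr (t - 1)) * indicator {0<..} l * indicator {x. ennreal l < f x} x \<partial>lborel)"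
      by (intro nn_integral_cong) (auto split: split_indicator)
    also have "\<dots> = ennreal (t * l powr (t - 1)) * indicator {0<..} l * emeasure lborel {x. ennreal l < f x}"
      by (subst nn_integral_cmult_indicator) auto
    finally show "(\<integral>\<^sup>+x. ennreal (t * l powr (t - 1)) * indicator {0<..} l *
        indicator {p. ennreal (snd p) < f (fst p)} (x, l) \<partial>lborel)
      = ennreal (t * l powr (t - 1)) * indicator {0<..} l * emeasure lborel {x. ennreal l < f x}" .
  qed
  finally show ?thesis .
qed

text \<open>Marcinkiewicz interpolation by hand: at level \<open>l\<close> only the values of
  \<open>w\<close> above l/2 matter, because the others contribute at most l/2 to any average. The
  weak type bound for the truncated function is then integrated over all levels.\<close>

lemma maximal_fn_strong_type:
  fixes w :: "'a::euclidean_space \<Rightarrow> ennreal"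
  assumes [measurable]: "w \<in> borel_measurable borel" and "1 < t"
  shows "(\<integral>\<^sup>+x. ennreal_rpow (maximal_fn w x) t \<partial>lborel)
    \<le> ennreal (5 ^ DIM('a) * (t / (t - 1)) * 2 powr t) * (\<integral>\<^sup>+x. ennreal_rpow (w x) t \<partial>lborel)"
proof -
  let ?n = "DIM('a)"
  have level: "emeasure lborel {x. ennreal l < maximal_fn w x} \<le>
      ennreal (5 ^ ?n * 2 / l) * (\<integral>\<^sup>+x. w x * indicator {x. ennreal (l/2) < w x} x \<partial>lborel)" if "0 < l" for l
  proof -
    define u where "u x = w x * indicator {x. ennreal (l/2) < w x} x" for x
    have [measurable]: "u \<in> borel_measurable borel" unfolding u_def by measurable
    have "ennreal (l/2) < maximal_fn u x" if x: "ennreal l < maximal_fn w x" for x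
    proof -
      obtain z r where r: "0 < r" "dist z x < r"
        and zr: "ennreal l * emeasure lborel (ball z r) < (\<integral>\<^sup>+y. w y * indicator (ball z r) y \<partial>lborel)"
        using x unfolding less_maximal_fn_iff by blast
      have "(\<integral>\<^sup>+y. w y * indicator (ball z r) y \<partial>lborel)
          \<le> (\<integral>\<^sup>+y. u y * indicator (ball z r) y + ennreal (l/2) * indicator (ball z r) y \<partial>lborel)"
        by (intro nn_integral_mono) (auto split: split_indicator simp: u_def)
      also have "\<dots> = (\<integral>\<^sup>+y. u y * indicator (ball z r) y \<partial>lborel) + ennreal (l/2) * emeasure lborel (ball z r)"
        by (subst nn_integral_add) (auto simp: nn_integral_cmult_indicator)
      finally have "ennreal l * emeasure lborel (ball z r) <
         (\<integral>\<^sup>+y. u y * indicator (ball z r) y \<partial>lborel) + ennreal (l/2) * emeasure lborel (ball z r)"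
        using zr by simp
      moreover have "ennreal l * emeasure lborel (ball z r)
          = ennreal (l/2) * emeasure lborel (ball z r) + ennreal (l/2) * emeasure lborel (ball z r)"
        using that \<open>0 < l\<close> by (simp flip: distrib_right ennreal_plus)
      \<comment> \<open>Instead of subtracting in \<open>ennreal\<close>: the reverse inequality,
        with the half added on both sides, would contradict the strict inequality above.\<close>
      ultimately have "ennreal (l/2) * emeasure lborel (ball z r) < (\<integral>\<^sup>+y. u y * indicator (ball z r) y \<partial>lborel)"
        using add_right_mono[of "\<integral>\<^sup>+y. u y * indicator (ball z r) y \<partial>lborel"
            "ennreal (l/2) * emeasure lborel (ball z r)" "ennreal (l/2) * emeasure lborel (ball z r)"]
        by (simp only: not_le[symmetric]) blast
      then show ?thesis unfolding less_maximal_fn_iff using r by blast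
    qed
    then have "emeasure lborel {x. ennreal l < maximal_fn w x} \<le> emeasure lborel {x. ennreal (l/2) < maximal_fn u x}"
      by (intro emeasure_mono) (auto intro: borel_open open_less_maximal_fn)
    also have "\<dots> = ennreal (2/l) * (ennreal (l/2) * emeasure lborel {x. ennreal (l/2) < maximal_fn u x})"
      using that by (simp add: ennreal_mult''[symmetric] flip: mult.assoc)
    also have "\<dots> \<le> ennreal (2/l) * (5 ^ ?n * (\<integral>\<^sup>+y. u y \<partial>lborel))"
      by (intro mult_left_mono maximal_fn_weak_type) auto
    also have "\<dots> = ennreal (5 ^ ?n * 2 / l) * (\<integral>\<^sup>+y. u y \<partial>lborel)"
    proof -
      have "ennreal (5 ^ ?n * 2 / l) = ennreal (2/l) * ennreal (5 ^ ?n)"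
        using that by (subst ennreal_mult[symmetric]) (auto simp: field_simps)
      then show ?thesis by (simp add: mult.assoc flip: ennreal_power)
    qed
    finally show ?thesis unfolding u_def .
  qed
  have "(\<integral>\<^sup>+x. ennreal_rpow (maximal_fn w x) t \<partial>lborel) = (\<integral>\<^sup>+l. ennreal (t * l powr (t - 1)) * indicator {0<..} l *
       emeasure lborel {x. ennreal l < maximal_fn w x} \<partial>lborel)"
    using assms by (intro nn_integral_rpow_layer_cake) auto
  also have "\<dots> \<le> (\<integral>\<^sup>+l. ennreal (t * l powr (t - 1)) * indicator {0<..} l *
      (ennreal (5 ^ ?n * 2 / l) * (\<integral>\<^sup>+x. w x * indicator {x. ennreal (l/2) < w x} x \<partial>lborel)) \<partial>lborel)"
    using level by (intro nn_integral_mono) (auto split: split_indicator intro!: mult_left_mono)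
  also have "\<dots> = (\<integral>\<^sup>+l. \<integral>\<^sup>+x. ennreal (t * l powr (t - 1)) * indicator {0<..} l *
      (ennreal (5 ^ ?n * 2 / l) * (w x * indicator {p. ennreal (snd p/2) < w (fst p)} (x, l))) \<partial>lborel \<partial>lborel)"
    by (intro nn_integral_cong) (simp add: nn_integral_cmult[symmetric] indicator_def)
  also have "\<dots> = (\<integral>\<^sup>+x. \<integral>\<^sup>+l. ennreal (t * l powr (t - 1)) * indicator {0<..} l *
      (ennreal (5 ^ ?n * 2 / l) * (w x * indicator {p. ennreal (snd p/2) < w (fst p)} (x, l))) \<partial>lborel \<partial>lborel)"
    by (rule lborel_pair.Fubini') (unfold case_prod_beta', measurable)
  \<comment> \<open>Arranged so that the inner integral is the layer cake formula for the exponent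
    \<open>t - 1\<close> at the value \<open>2 * w x\<close>. The factor 2^t originates
    here.\<close>
  also have "\<dots> = (\<integral>\<^sup>+x. \<integral>\<^sup>+l. ennreal (5 ^ ?n * 2 * (t/(t-1))) * w x *
      (ennreal ((t - 1) * l powr (t - 1 - 1)) * indicator {l. 0 < l \<and> ennreal l < 2 * w x} l) \<partial>lborel \<partial>lborel)"
  proof (intro nn_integral_cong)
    fix x l
    have *: "ennreal (l/2) < w x \<longleftrightarrow> ennreal l < 2 * w x" if "0 < l"
      using that by (cases "w x") (auto simp: ennreal_less_iff ennreal_mult_top simp flip: ennreal_numeral ennreal_mult)
    have **: "ennreal (t * l powr (t - 1)) * ennreal (5 ^ ?n * 2 / l) =
        ennreal (5 ^ ?n * 2 * (t/(t-1))) * ennreal ((t - 1) * l powr (t - 1 - 1))" if "0 < l"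
    proof -
      have "l powr (t - 1 - 1) = l powr (t - 1) / l" using that by (subst powr_diff) simp
      then have "5 ^ ?n * 2 * (t/(t-1)) * ((t - 1) * l powr (t - 1 - 1))
          = ((t - 1) / (t - 1)) * (t * l powr (t - 1) * (5 ^ ?n * 2 / l))" by (simp add: ac_simps)
      then have "t * l powr (t - 1) * (5 ^ ?n * 2 / l) = 5 ^ ?n * 2 * (t/(t-1)) * ((t - 1) * l powr (t - 1 - 1))"
        using assms by simp
      then show ?thesis using assms that by (simp flip: ennreal_mult)
    qed
    show "ennreal (t * l powr (t - 1)) * indicator {0<..} l *
      (ennreal (5 ^ ?n * 2 / l) * (w x * indicator {p. ennreal (snd p/2) < w (fst p)} (x, l)))
      = ennreal (5 ^ ?n * 2 * (t/(t-1))) * w x *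
      (ennreal ((t - 1) * l powr (t - 1 - 1)) * indicator {l. 0 < l \<and> ennreal l < 2 * w x} l)"
    proof (cases "0 < l")
      case True
      then show ?thesis
        using * ** by (auto simp: indicator_def ac_simps)
    qed simp
  qed
  also have "\<dots> = (\<integral>\<^sup>+x. ennreal (5 ^ ?n * 2 * (t/(t-1))) * w x * ennreal_rpow (2 * w x) (t - 1) \<partial>lborel)"
    using assms by (simp add: nn_integral_cmult ennreal_rpow_layer_cake[of "t - 1"])
  also have "\<dots> = (\<integral>\<^sup>+x. ennreal (5 ^ ?n * (t / (t - 1)) * 2 powr t) * ennreal_rpow (w x) t \<partial>lborel)"
  proof (intro nn_integral_cong)
    fix x
    have "ennreal_rpow (2 * w x) (t - 1) = ennreal (2 powr (t - 1)) * ennreal_rpow (w x) (t - 1)"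
      using assms by (subst ennreal_rpow_mult) (auto simp: ennreal_rpow_ennreal simp flip: ennreal_numeral)
    moreover have "ennreal_rpow (w x) t = w x * ennreal_rpow (w x) (t - 1)"
      using ennreal_rpow_add[of 1 "t - 1" "w x"] assms by simp
    moreover have "ennreal (5 ^ ?n * (t / (t - 1)) * 2 powr t) = ennreal (5 ^ ?n * 2 * (t/(t-1))) * ennreal (2 powr (t - 1))"
    proof -
      have "2 powr t = 2 * 2 powr (t - 1)" by (simp add: powr_diff)
      then show ?thesis using assms by (simp del: powr_diff flip: ennreal_mult)
    qed
    ultimately show "ennreal (5 ^ ?n * 2 * (t/(t-1))) * w x * ennreal_rpow (2 * w x) (t - 1)
      = ennreal (5 ^ ?n * (t / (t - 1)) * 2 powr t) * ennreal_rpow (w x) t"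
      by (simp only: ac_simps)
  qed
  also have "\<dots> = ennreal (5 ^ ?n * (t / (t - 1)) * 2 powr t) * (\<integral>\<^sup>+x. ennreal_rpow (w x) t \<partial>lborel)"
    by (rule nn_integral_cmult) simp
  finally show ?thesis .
qed


section \<open>A vector-valued maximal inequality\<close>

lemma le_divide_ennreal_iff: "c \<noteq> 0 \<Longrightarrow> c < top \<Longrightarrow> a \<le> b / c \<longleftrightarrow> a * c \<le> (b :: ennreal)"
  by (cases a; cases b; cases c)
    (auto simp: divide_ennreal ennreal_mult[symmetric] ennreal_le_iff field_simps ennreal_top_mult ennreal_top_divide top_unique)

text \<open>How large \<open>a\<close> is on some entire ball of radius \<open>d\<close> with centre
  within \<open>R\<close> of \<open>x\<close>. An infimum over a ball is controlled by averages over
  any portion of it, which makes this quantity tractable where a plain supremum is not. Its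
  superlevel sets are open, so it is Borel for arbitrary \<open>a\<close>.\<close>

definition sup_inf :: "real \<Rightarrow> real \<Rightarrow> ('a::euclidean_space \<Rightarrow> ennreal) \<Rightarrow> 'a \<Rightarrow> ennreal" where
  "sup_inf R d a x = (SUP z\<in>ball x R. INF w\<in>ball z d. a w)"

lemma sup_inf_measurable [measurable]: "sup_inf R d a \<in> borel_measurable borel"
proof (rule borel_measurableI_greater)
  fix y
  have "{x. y < sup_inf R d a x} = (\<Union>z\<in>{z. y < (INF w\<in>ball z d. a w)}. ball z R)"
    by (auto simp: sup_inf_def less_SUP_iff dist_commute)
  then have "open {x. y < sup_inf R d a x}" by auto
  then show "{x \<in> space borel. y < sup_inf R d a x} \<in> sets borel" by (simp add: borel_open)
qed

text \<open>The infimum over \<open>ball z d\<close> is at most the mean of \<open>a\<close> over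
  the part of that ball off \<open>E\<close>, which carries at least half of the volume; hence the
  factor 2. All these balls lie in \<open>ball x (R + d)\<close>.\<close>

lemma sup_inf_bound:
  fixes a :: "'a::euclidean_space \<Rightarrow> ennreal"
  assumes [measurable]: "a \<in> borel_measurable borel" "E \<in> sets borel" and "0 < d"
    and E: "\<And>z. z \<in> ball x R \<Longrightarrow> 2 * emeasure lborel (ball z d \<inter> E) \<le> emeasure lborel (ball z d)"
  shows "sup_inf R d a x * emeasure lborel (ball x d) \<le>
    2 * (\<integral>\<^sup>+y. a y * indicator (- E) y * indicator (ball x (R + d)) y \<partial>lborel)" (is "_ \<le> 2 * ?I")
proof -
  have v: "emeasure lborel (ball z d) = emeasure lborel (ball x d)" for z :: 'a
    using \<open>0 < d\<close> by (simp add: emeasure_ball)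
  have "(INF w\<in>ball z d. a w) \<le> 2 * ?I / emeasure lborel (ball x d)" if z: "z \<in> ball x R" for z
  proof -
    let ?m = "INF w\<in>ball z d. a w"
    have split: "emeasure lborel (ball z d) = emeasure lborel (ball z d \<inter> E) + emeasure lborel (ball z d \<inter> - E)"
      by (subst plus_emeasure) (auto intro!: arg_cong[where f="emeasure lborel"])
    have "emeasure lborel (ball z d) + emeasure lborel (ball z d)
        = 2 * emeasure lborel (ball z d \<inter> E) + 2 * emeasure lborel (ball z d \<inter> - E)"
      by (subst (1 2) split) (simp add: mult_2 ac_simps)
    also have "\<dots> \<le> emeasure lborel (ball z d) + 2 * emeasure lborel (ball z d \<inter> - E)"
      using E[OF z] by (intro add_right_mono)
    finally have *: "emeasure lborel (ball z d) \<le> 2 * emeasure lborel (ball z d \<inter> - E)"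
      using emeasure_ball_neq_top[of z d] by (subst (asm) ennreal_add_left_cancel_le) auto
    have "?m * emeasure lborel (ball z d) \<le> ?m * (2 * emeasure lborel (ball z d \<inter> - E))"
      by (intro mult_left_mono *) simp
    also have "\<dots> = 2 * (\<integral>\<^sup>+y. ?m * indicator (ball z d \<inter> - E) y \<partial>lborel)"
      by (subst nn_integral_cmult_indicator) (auto simp: ac_simps)
    also have "\<dots> \<le> 2 * ?I"
    proof (intro mult_left_mono nn_integral_mono)
      fix y
      have "y \<in> ball x (R + d)" if "y \<in> ball z d"
        using that z dist_triangle[of x y z] by (auto simp: dist_commute)
      then show "?m * indicator (ball z d \<inter> - E) y \<le> a y * indicator (- E) y * indicator (ball x (R + d)) y"
        by (auto split: split_indicator intro!: INF_lower)
    qed simp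
    finally show ?thesis
      unfolding v[of z] using \<open>0 < d\<close> emeasure_ball_pos[of d x] emeasure_ball_neq_top[of x d]
      by (simp add: le_divide_ennreal_iff less_top)
  qed
  then have "sup_inf R d a x \<le> 2 * ?I / emeasure lborel (ball x d)"
    unfolding sup_inf_def by (rule SUP_least)
  then show ?thesis
    using \<open>0 < d\<close> emeasure_ball_pos[of d x] emeasure_ball_neq_top[of x d]
    by (simp add: le_divide_ennreal_iff less_top)
qed

text \<open>Tonelli moves the averaging from \<open>a\<close> to the weight \<open>w\<close>. For
  exponents below 1 it is used with \<open>w = W = 1\<close> and a genuine exceptional set
  \<open>E\<close>, otherwise with \<open>E = {}\<close>, where \<open>W\<close> is the maximal
  function of \<open>w\<close> if the exponent exceeds 1. The constant contains the volume ratio of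
  balls of radii \<open>R + d\<close> and \<open>d\<close>.\<close>

lemma nn_integral_sup_inf:
  fixes a w W :: "'a::euclidean_space \<Rightarrow> ennreal"
  assumes [measurable]: "a \<in> borel_measurable borel" "w \<in> borel_measurable borel" "W \<in> borel_measurable borel"
      "E \<in> sets borel" "G \<in> sets borel"
    and "0 < d" "0 < R"
    and E: "\<And>x z. x \<in> G \<Longrightarrow> z \<in> ball x R \<Longrightarrow> 2 * emeasure lborel (ball z d \<inter> E) \<le> emeasure lborel (ball z d)"
    and W: "\<And>y. (\<integral>\<^sup>+x. w x * indicator (ball y (R + d)) x \<partial>lborel) \<le> W y * emeasure lborel (ball y (R + d))"
  shows "(\<integral>\<^sup>+x. sup_inf R d a x * w x * indicator G x \<partial>lborel)
    \<le> ennreal (2 * ((R + d) / d) ^ DIM('a)) * (\<integral>\<^sup>+y. a y * indicator (- E) y * W y \<partial>lborel)"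
proof -
  let ?v = "emeasure lborel (ball (0::'a) d)"
  have v: "emeasure lborel (ball z d) = ?v" for z :: 'a
    using \<open>0 < d\<close> by (simp add: emeasure_ball)
  have vpos: "0 < ?v" "?v < top" using \<open>0 < d\<close> emeasure_ball_pos[of d "0::'a"] emeasure_ball_neq_top[of "0::'a" d]
    by (auto simp: less_top)
  let ?J = "\<lambda>x y. a y * indicator (- E) y * (if dist x y < R + d then 1 else 0)"
  have J: "a y * indicator (- E) y * indicator (ball x (R + d)) y = ?J x y" for x y
    by (simp add: indicator_def)
  have "(\<integral>\<^sup>+x. sup_inf R d a x * w x * indicator G x \<partial>lborel) * ?v
      = (\<integral>\<^sup>+x. sup_inf R d a x * ?v * w x * indicator G x \<partial>lborel)"
    by (subst nn_integral_multc[symmetric]) (auto simp: ac_simps)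
  also have "\<dots> \<le> (\<integral>\<^sup>+x. 2 * (\<integral>\<^sup>+y. ?J x y \<partial>lborel) * w x \<partial>lborel)"
  proof (intro nn_integral_mono)
    fix x
    show "sup_inf R d a x * ?v * w x * indicator G x \<le> 2 * (\<integral>\<^sup>+y. ?J x y \<partial>lborel) * w x"
    proof (cases "x \<in> G")
      case True
      have "sup_inf R d a x * emeasure lborel (ball x d) \<le>
          2 * (\<integral>\<^sup>+y. a y * indicator (- E) y * indicator (ball x (R + d)) y \<partial>lborel)"
        using E[OF True] \<open>0 < d\<close> by (intro sup_inf_bound) auto
      then have "sup_inf R d a x * ?v * w x \<le> 2 * (\<integral>\<^sup>+y. ?J x y \<partial>lborel) * w x"
        unfolding J v[of x] by (rule mult_right_mono) simp
      then show ?thesis using True by simp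
    qed simp
  qed
  also have "\<dots> = 2 * (\<integral>\<^sup>+x. \<integral>\<^sup>+y. ?J x y * w x \<partial>lborel \<partial>lborel)"
  proof -
    have "2 * (\<integral>\<^sup>+y. ?J x y \<partial>lborel) * w x = 2 * (\<integral>\<^sup>+y. ?J x y * w x \<partial>lborel)" for x
      by (subst nn_integral_multc) (auto simp: mult.assoc)
    then show ?thesis by (simp only:) (rule nn_integral_cmult, measurable)
  qed
  also have "(\<integral>\<^sup>+x. \<integral>\<^sup>+y. ?J x y * w x \<partial>lborel \<partial>lborel) = (\<integral>\<^sup>+y. \<integral>\<^sup>+x. ?J x y * w x \<partial>lborel \<partial>lborel)"
    by (rule lborel_pair.Fubini') (unfold case_prod_beta', measurable)
  also have "\<dots> = (\<integral>\<^sup>+y. a y * indicator (- E) y * (\<integral>\<^sup>+x. w x * indicator (ball y (R + d)) x \<partial>lborel) \<partial>lborel)"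
    by (subst nn_integral_cmult[symmetric])
      (auto intro!: nn_integral_cong split: split_indicator simp: dist_commute)
  also have "\<dots> \<le> (\<integral>\<^sup>+y. a y * indicator (- E) y * (W y * (ennreal (((R + d) / d) ^ DIM('a)) * ?v)) \<partial>lborel)"
  proof (intro nn_integral_mono mult_left_mono)
    fix y
    show "(\<integral>\<^sup>+x. w x * indicator (ball y (R + d)) x \<partial>lborel) \<le> W y * (ennreal (((R + d) / d) ^ DIM('a)) * ?v)"
      using W[of y] emeasure_ball_scale[of "(R + d)/d" d y 0] \<open>0 < d\<close> \<open>0 < R\<close> by simp
  qed simp
  also have "\<dots> = (\<integral>\<^sup>+y. (a y * indicator (- E) y * W y) * (ennreal (((R + d) / d) ^ DIM('a)) * ?v) \<partial>lborel)"
    by (simp add: mult.assoc)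
  also have "\<dots> = (\<integral>\<^sup>+y. (a y * indicator (- E) y * W y) \<partial>lborel) * (ennreal (((R + d) / d) ^ DIM('a)) * ?v)"
    by (rule nn_integral_multc) simp
  finally have "(\<integral>\<^sup>+x. sup_inf R d a x * w x * indicator G x \<partial>lborel) * ?v
      \<le> 2 * ((\<integral>\<^sup>+y. (a y * indicator (- E) y * W y) \<partial>lborel) * (ennreal (((R + d) / d) ^ DIM('a)) * ?v))"
    by (simp add: mult_left_mono)
  also have "\<dots> = (ennreal (2 * ((R + d) / d) ^ DIM('a)) * (\<integral>\<^sup>+y. a y * indicator (- E) y * W y \<partial>lborel)) * ?v"
    using \<open>0 < d\<close> \<open>0 < R\<close> by (subst ennreal_mult) (auto simp: ac_simps)
  finally show ?thesis
    using vpos by (simp add: ennreal_mult_le_mult_iff mult.commute[of _ ?v])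
qed

text \<open>Every index has its own scale \<open>r j\<close>, but \<open>E\<close>,
  \<open>G\<close>, \<open>w\<close>, \<open>W\<close> are shared and the constant depends on R/d
  only, so the sum over \<open>j\<close> costs nothing.\<close>

lemma nn_integral_sum_sup_inf:
  fixes a :: "'i::countable \<Rightarrow> 'a::euclidean_space \<Rightarrow> ennreal" and w W :: "'a \<Rightarrow> ennreal"
  assumes [measurable]: "\<And>j. a j \<in> borel_measurable borel" "w \<in> borel_measurable borel" "W \<in> borel_measurable borel"
      "E \<in> sets borel" "G \<in> sets borel"
    and "0 < d" "0 < R" and r: "\<And>j. 0 < r j"
    and E: "\<And>x z j. x \<in> G \<Longrightarrow> z \<in> ball x (R * r j) \<Longrightarrow>
      2 * emeasure lborel (ball z (d * r j) \<inter> E) \<le> emeasure lborel (ball z (d * r j))"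
    and W: "\<And>y s. 0 < s \<Longrightarrow> (\<integral>\<^sup>+x. w x * indicator (ball y s) x \<partial>lborel) \<le> W y * emeasure lborel (ball y s)"
  shows "(\<integral>\<^sup>+x. (\<integral>\<^sup>+j. sup_inf (R * r j) (d * r j) (a j) x \<partial>count_space UNIV) * w x * indicator G x \<partial>lborel)
    \<le> ennreal (2 * ((R + d) / d) ^ DIM('a)) *
      (\<integral>\<^sup>+y. (\<integral>\<^sup>+j. a j y \<partial>count_space UNIV) * indicator (- E) y * W y \<partial>lborel)"
proof -
  have "(\<integral>\<^sup>+x. (\<integral>\<^sup>+j. sup_inf (R * r j) (d * r j) (a j) x \<partial>count_space UNIV) * w x * indicator G x \<partial>lborel)
    = (\<integral>\<^sup>+x. \<integral>\<^sup>+j. sup_inf (R * r j) (d * r j) (a j) x * w x * indicator G x \<partial>count_space UNIV \<partial>lborel)"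
    by (simp add: nn_integral_multc mult.assoc)
  also have "\<dots> = (\<integral>\<^sup>+j. \<integral>\<^sup>+x. sup_inf (R * r j) (d * r j) (a j) x * w x * indicator G x \<partial>lborel \<partial>count_space UNIV)"
    by (intro nn_integral_count_space_nn_integral) auto
  also have "\<dots> \<le> (\<integral>\<^sup>+j. ennreal (2 * ((R + d) / d) ^ DIM('a)) * (\<integral>\<^sup>+y. a j y * indicator (- E) y * W y \<partial>lborel) \<partial>count_space UNIV)"
  proof (intro nn_integral_mono)
    fix j
    have "(R * r j + d * r j) / (d * r j) = (R + d) / d" using r[of j] by (simp flip: distrib_right)
    then show "(\<integral>\<^sup>+x. sup_inf (R * r j) (d * r j) (a j) x * w x * indicator G x \<partial>lborel)
       \<le> ennreal (2 * ((R + d) / d) ^ DIM('a)) * (\<integral>\<^sup>+y. a j y * indicator (- E) y * W y \<partial>lborel)"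
      using nn_integral_sup_inf[of "a j" w W E G "d * r j" "R * r j"] assms E W by (simp add: add_pos_pos)
  qed
  also have "\<dots> = ennreal (2 * ((R + d) / d) ^ DIM('a)) * (\<integral>\<^sup>+j. (\<integral>\<^sup>+y. a j y * indicator (- E) y * W y \<partial>lborel) \<partial>count_space UNIV)"
    by (rule nn_integral_cmult) simp
  also have "(\<integral>\<^sup>+j. (\<integral>\<^sup>+y. a j y * indicator (- E) y * W y \<partial>lborel) \<partial>count_space UNIV)
      = (\<integral>\<^sup>+y. \<integral>\<^sup>+j. a j y * indicator (- E) y * W y \<partial>count_space UNIV \<partial>lborel)"
    by (intro nn_integral_count_space_nn_integral[symmetric]) auto
  also have "\<dots> = (\<integral>\<^sup>+y. (\<integral>\<^sup>+j. a j y \<partial>count_space UNIV) * indicator (- E) y * W y \<partial>lborel)"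
    by (simp add: nn_integral_multc mult.assoc)
  finally show ?thesis .
qed

lemma borel_measurable_nn_integral_count_space [measurable (raw)]:
  fixes a :: "'i::countable \<Rightarrow> 'b \<Rightarrow> ennreal"
  assumes "\<And>j. a j \<in> borel_measurable M"
  shows "(\<lambda>x. \<integral>\<^sup>+j. a j x \<partial>count_space UNIV) \<in> borel_measurable M"
proof -
  interpret sigma_finite_measure "count_space (UNIV :: 'i set)"
    by (rule sigma_finite_measure_count_space)
  have "(\<lambda>p. a (snd p) (fst p)) \<in> borel_measurable (M \<Otimes>\<^sub>M count_space UNIV)"
    using assms by (intro measurable_compose_countable'[where f="\<lambda>j p. a j (fst p)" and g=snd and I=UNIV]) auto
  then show ?thesis by (intro borel_measurable_nn_integral) (simp add: case_prod_beta')
qed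

text \<open>
  For \<open>\<theta> < 1\<close> duality is not available. Where the maximal function of the indicator of the level set
  \<open>{S > l}\<close> is small, every ball entering \<open>sup_inf\<close> has half of its mass off the level set, so the
  infima are controlled by integrals over \<open>{S \<le> l}\<close>.
\<close>

lemma nn_integral_rpow_sup_inf_lt_1:
  fixes a :: "'i::countable \<Rightarrow> 'a::euclidean_space \<Rightarrow> ennreal"
  defines "S \<equiv> \<lambda>x. \<integral>\<^sup>+j. a j x \<partial>count_space UNIV"
  assumes [measurable]: "\<And>j. a j \<in> borel_measurable borel"
    and "0 < d" "0 < R" and r: "\<And>j. 0 < r j" and \<theta>: "0 < \<theta>" "\<theta> < 1"
  shows "(\<integral>\<^sup>+x. ennreal_rpow (\<integral>\<^sup>+j. sup_inf (R * r j) (d * r j) (a j) x \<partial>count_space UNIV) \<theta> \<partial>lborel)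
    \<le> ennreal (2 * 5 ^ DIM('a) * ((R + d) / d) ^ DIM('a) / (1 - \<theta>)) * (\<integral>\<^sup>+x. ennreal_rpow (S x) \<theta> \<partial>lborel)"
proof -
  let ?n = "DIM('a)"
  define T where "T x = (\<integral>\<^sup>+j. sup_inf (R * r j) (d * r j) (a j) x \<partial>count_space UNIV)" for x
  define \<rho> where "\<rho> = ((R + d) / d) ^ ?n"
  define K where "K = 2 * 5 ^ ?n * \<rho>"
  have \<rho>: "1 \<le> \<rho>" unfolding \<rho>_def using \<open>0 < d\<close> \<open>0 < R\<close> by (intro one_le_power) simp
  then have K: "0 < K" "2 * \<rho> \<le> K" by (auto simp: K_def)
  have [measurable]: "S \<in> borel_measurable borel" "T \<in> borel_measurable borel"
    unfolding S_def T_def by measurable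
  have level: "emeasure lborel {x. ennreal l < T x} \<le> ennreal K *
      (emeasure lborel {x. ennreal l < S x} + ennreal (1 / l) * (\<integral>\<^sup>+x. S x * indicator {x. S x \<le> ennreal l} x \<partial>lborel))"
    if l: "0 < l" for l
  proof -
    define E where "E = {x. ennreal l < S x}"
    define M where "M = maximal_fn (indicator E :: 'a \<Rightarrow> ennreal)"
    \<comment> \<open>Origin of the threshold: \<open>\<rho>\<close> is the volume ratio of the
      balls of radii (R + d) r and d r. Around a point of \<open>G\<close> the large ball has at
      most the fraction 1/(2 \<rho>) of its volume in \<open>E\<close>, hence every small ball
      inside it at most one half.\<close>
    define G where "G = {x. M x \<le> ennreal (1 / (2 * \<rho>))}"
    have [measurable]: "E \<in> sets borel" "M \<in> borel_measurable borel"
      unfolding E_def M_def by measurable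
    then have [measurable]: "G \<in> sets borel" unfolding G_def by measurable
    have EG: "2 * emeasure lborel (ball z (d * r j) \<inter> E) \<le> emeasure lborel (ball z (d * r j))"
      if "x \<in> G" "z \<in> ball x (R * r j)" for x z j
    proof -
      let ?s = "(R + d) * r j"
      have s: "0 < ?s" using \<open>0 < d\<close> \<open>0 < R\<close> r[of j] by simp
      have "emeasure lborel (ball z (d * r j) \<inter> E) \<le> emeasure lborel (E \<inter> ball x ?s)"
      proof (rule emeasure_mono)
        show "ball z (d * r j) \<inter> E \<subseteq> E \<inter> ball x ?s"
        proof
          fix y assume y: "y \<in> ball z (d * r j) \<inter> E"
          then show "y \<in> E \<inter> ball x ?s"
            using that dist_triangle[of x y z] by (auto simp: distrib_right)
        qed
      qed measurable
      also have "\<dots> = (\<integral>\<^sup>+y. indicator E y * indicator (ball x ?s) y \<partial>lborel)"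
        by (simp flip: indicator_inter_arith)
      also have "\<dots> \<le> M x * emeasure lborel (ball x ?s)"
        unfolding M_def using s by (intro maximal_fn_upper) auto
      also have "\<dots> \<le> ennreal (1 / (2 * \<rho>)) * emeasure lborel (ball x ?s)"
        using that by (intro mult_right_mono) (auto simp: G_def)
      also have "emeasure lborel (ball x ?s) = ennreal \<rho> * emeasure lborel (ball z (d * r j))"
        using emeasure_ball_scale[of "(R + d)/d" "d * r j" x z] \<open>0 < d\<close> \<open>0 < R\<close> r[of j] by (simp add: \<rho>_def)
      finally have "2 * emeasure lborel (ball z (d * r j) \<inter> E)
         \<le> 2 * (ennreal (1 / (2 * \<rho>)) * (ennreal \<rho> * emeasure lborel (ball z (d * r j))))"
        by (rule mult_left_mono) simp
      also have "\<dots> = (ennreal 2 * ennreal (1 / (2 * \<rho>)) * ennreal \<rho>) * emeasure lborel (ball z (d * r j))"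
        by (simp add: mult.assoc)
      also have "ennreal 2 * ennreal (1 / (2 * \<rho>)) * ennreal \<rho> = 1"
        using \<rho> by (simp flip: ennreal_mult del: ennreal_numeral)
      finally show ?thesis by simp
    qed
    have TG: "(\<integral>\<^sup>+x. T x * indicator G x \<partial>lborel) \<le> ennreal (2 * \<rho>) * (\<integral>\<^sup>+x. S x * indicator (- E) x \<partial>lborel)"
      using nn_integral_sum_sup_inf[of a "\<lambda>_. 1" "\<lambda>_. 1" E G d R r] EG \<open>0 < d\<close> \<open>0 < R\<close> r
      by (simp add: S_def T_def \<rho>_def)
    \<comment> \<open>Off \<open>G\<close> the weak type bound for the indicator of \<open>E\<close>
      is used, on \<open>G\<close> Chebyshev's inequality together with the integral bound
      \<open>TG\<close>.\<close>
    have "emeasure lborel {x. ennreal l < T x}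
        \<le> emeasure lborel ({x. ennreal (1 / (2 * \<rho>)) < M x} \<union> {x. ennreal l < T x \<and> x \<in> G})"
      by (intro emeasure_mono) (auto simp: G_def)
    also have "\<dots> \<le> emeasure lborel {x. ennreal (1 / (2 * \<rho>)) < M x} + emeasure lborel {x. ennreal l < T x \<and> x \<in> G}"
      by (intro emeasure_subadditive) auto
    also have "\<dots> \<le> ennreal K * emeasure lborel E + ennreal (1 / l) * (\<integral>\<^sup>+x. T x * indicator G x \<partial>lborel)"
    proof (rule add_mono)
      have "emeasure lborel {x. ennreal (1 / (2 * \<rho>)) < M x}
          = ennreal (2 * \<rho>) * (ennreal (1 / (2 * \<rho>)) * emeasure lborel {x. ennreal (1 / (2 * \<rho>)) < M x})"
        using \<rho> by (simp flip: ennreal_mult mult.assoc)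
      also have "\<dots> \<le> ennreal (2 * \<rho>) * (5 ^ ?n * (\<integral>\<^sup>+x. indicator E x \<partial>lborel))"
        unfolding M_def by (intro mult_left_mono maximal_fn_weak_type) auto
      also have "\<dots> = ennreal K * emeasure lborel E"
      proof -
        have "ennreal K = ennreal (2 * \<rho>) * ennreal (5 ^ ?n)"
          using \<rho> by (subst ennreal_mult[symmetric]) (auto simp: K_def ac_simps)
        then show ?thesis by (simp add: mult.assoc flip: ennreal_power)
      qed
      finally show "emeasure lborel {x. ennreal (1 / (2 * \<rho>)) < M x} \<le> ennreal K * emeasure lborel E" .
      have "emeasure lborel {x. ennreal l < T x \<and> x \<in> G}
         = (\<integral>\<^sup>+x. indicator {x. ennreal l < T x \<and> x \<in> G} x \<partial>lborel)"
        by simp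
      also have "\<dots> \<le> (\<integral>\<^sup>+x. ennreal (1 / l) * (T x * indicator G x) \<partial>lborel)"
      proof (intro nn_integral_mono)
        fix x
        have "1 \<le> ennreal (1 / l) * T x" if "ennreal l < T x"
        proof -
          have "1 = ennreal (1 / l) * ennreal l" using l by (simp flip: ennreal_mult)
          also have "\<dots> \<le> ennreal (1 / l) * T x" using that by (intro mult_left_mono) auto
          finally show ?thesis .
        qed
        then show "indicator {x. ennreal l < T x \<and> x \<in> G} x \<le> ennreal (1 / l) * (T x * indicator G x)"
          by (simp add: indicator_def)
      qed
      also have "\<dots> = ennreal (1 / l) * (\<integral>\<^sup>+x. T x * indicator G x \<partial>lborel)"
        by (rule nn_integral_cmult) simp
      finally show "emeasure lborel {x. ennreal l < T x \<and> x \<in> G} \<le> ennreal (1 / l) * (\<integral>\<^sup>+x. T x * indicator G x \<partial>lborel)" .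
    qed
    also have "\<dots> \<le> ennreal K * emeasure lborel E + ennreal (1 / l) * (ennreal K * (\<integral>\<^sup>+x. S x * indicator (- E) x \<partial>lborel))"
      using TG K by (intro add_left_mono mult_left_mono order.trans[OF TG] mult_right_mono ennreal_leI) auto
    also have "- E = {x. S x \<le> ennreal l}" by (auto simp: E_def)
    finally show ?thesis unfolding E_def by (simp add: distrib_left ac_simps)
  qed
  let ?I = "\<integral>\<^sup>+x. ennreal_rpow (S x) \<theta> \<partial>lborel"
  let ?p = "\<lambda>l. ennreal (\<theta> * l powr (\<theta> - 1)) * indicator {0<..} l"
  let ?c = "\<lambda>l. ennreal (\<theta> * l powr (\<theta> - 2)) * indicator {0<..} l"
  have "(\<integral>\<^sup>+x. ennreal_rpow (T x) \<theta> \<partial>lborel) = (\<integral>\<^sup>+l. ?p l * emeasure lborel {x. ennreal l < T x} \<partial>lborel)"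
    using \<theta> by (intro nn_integral_rpow_layer_cake) auto
  also have "\<dots> \<le> (\<integral>\<^sup>+l. ennreal K * (?p l * emeasure lborel {x. ennreal l < S x}) +
     ennreal K * (\<integral>\<^sup>+x. ?c l * (S x * (if S x \<le> ennreal l then 1 else 0)) \<partial>lborel) \<partial>lborel)"
  proof (intro nn_integral_mono)
    fix l :: real
    show "?p l * emeasure lborel {x. ennreal l < T x} \<le> ennreal K * (?p l * emeasure lborel {x. ennreal l < S x}) +
     ennreal K * (\<integral>\<^sup>+x. ?c l * (S x * (if S x \<le> ennreal l then 1 else 0)) \<partial>lborel)"
    proof (cases "0 < l")
      case True
      let ?J = "\<integral>\<^sup>+x. S x * (if S x \<le> ennreal l then 1 else 0) \<partial>lborel"
      have J: "(\<integral>\<^sup>+x. S x * indicator {x. S x \<le> ennreal l} x \<partial>lborel) = ?J"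
        by (simp add: indicator_def of_bool_def)
      have c: "?c l = ?p l * ennreal (1 / l)"
        using True \<theta> by (simp add: powr_diff power2_eq_square flip: ennreal_mult)
      have "?p l * emeasure lborel {x. ennreal l < T x} \<le>
          ?p l * (ennreal K * (emeasure lborel {x. ennreal l < S x} + ennreal (1 / l) * ?J))"
        using level[OF True] unfolding J by (rule mult_left_mono) simp
      also have "\<dots> = ennreal K * (?p l * emeasure lborel {x. ennreal l < S x}) + ennreal K * (?c l * ?J)"
        unfolding c by (simp only: distrib_left mult.assoc mult.left_commute)
      also have "?c l * ?J = (\<integral>\<^sup>+x. ?c l * (S x * (if S x \<le> ennreal l then 1 else 0)) \<partial>lborel)"
        by (rule nn_integral_cmult[symmetric]) simp
      finally show ?thesis .
    qed simp
  qed
  also have "\<dots> = ennreal K * (\<integral>\<^sup>+l. ?p l * emeasure lborel {x. ennreal l < S x} \<partial>lborel) +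
     ennreal K * (\<integral>\<^sup>+l. \<integral>\<^sup>+x. ?c l * (S x * (if S x \<le> ennreal l then 1 else 0)) \<partial>lborel \<partial>lborel)"
    by (subst nn_integral_add) (auto simp: nn_integral_cmult)
  also have "(\<integral>\<^sup>+l. ?p l * emeasure lborel {x. ennreal l < S x} \<partial>lborel) = ?I"
    using \<theta> by (intro nn_integral_rpow_layer_cake[symmetric]) auto
  also have "(\<integral>\<^sup>+l. \<integral>\<^sup>+x. ?c l * (S x * (if S x \<le> ennreal l then 1 else 0)) \<partial>lborel \<partial>lborel)
     = (\<integral>\<^sup>+x. \<integral>\<^sup>+l. ?c l * (S x * (if S x \<le> ennreal l then 1 else 0)) \<partial>lborel \<partial>lborel)"
    by (rule lborel_pair.Fubini') (unfold case_prod_beta', measurable)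
  also have "\<dots> = (\<integral>\<^sup>+x. \<integral>\<^sup>+l. ennreal (\<theta> * l powr (\<theta> - 2)) * (S x * indicator {l. 0 < l \<and> S x \<le> ennreal l} l) \<partial>lborel \<partial>lborel)"
    by (intro nn_integral_cong) (auto simp: indicator_def)
  also have "\<dots> \<le> (\<integral>\<^sup>+x. ennreal (\<theta> / (1 - \<theta>)) * ennreal_rpow (S x) \<theta> \<partial>lborel)"
    using \<theta> by (intro nn_integral_mono ennreal_rpow_layer_cake_tail)
  also have "\<dots> = ennreal (\<theta> / (1 - \<theta>)) * ?I"
    by (rule nn_integral_cmult) simp
  finally have "(\<integral>\<^sup>+x. ennreal_rpow (T x) \<theta> \<partial>lborel) \<le> ennreal K * ?I + ennreal K * (ennreal (\<theta> / (1 - \<theta>)) * ?I)"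
    by (simp add: add_left_mono mult_left_mono)
  also have "\<dots> = ennreal (K + K * (\<theta> / (1 - \<theta>))) * ?I"
  proof -
    have "ennreal K * (ennreal (\<theta> / (1 - \<theta>)) * ?I) = ennreal (K * (\<theta> / (1 - \<theta>))) * ?I"
      using \<theta> K by (simp only: ennreal_mult' mult.assoc less_imp_le)
    then show ?thesis using \<theta> K by (simp add: distrib_right)
  qed
  also have "K + K * (\<theta> / (1 - \<theta>)) = K / (1 - \<theta>)"
    using \<theta> by (simp add: field_simps)
  finally show ?thesis unfolding T_def K_def \<rho>_def .
qed

text \<open>The point \<open>z\<close> is sorted by its dyadic distance from \<open>x\<close>: with
  \<open>l\<close> minimal such that dist x z < 2^l r, the decay factor is at most 2^D 2^(-D l), and
  the single term with that \<open>l\<close> already dominates \<open>b\<close>.\<close>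

lemma le_suminf_sup_inf:
  fixes a :: "'a::euclidean_space \<Rightarrow> ennreal"
  assumes "0 < d" "0 < r" "0 \<le> c" "0 < D"
    and b: "\<And>w. w \<in> ball z (d * r) \<Longrightarrow> b \<le> ennreal (c * (1 + dist x z / r) powr (- D)) * a w"
  shows "b \<le> (\<Sum>l. ennreal (c * 2 powr D * 2 powr (- D * real l)) * sup_inf (2 ^ l * r) (d * r) a x)"
proof -
  let ?t = "dist x z / r"
  have t: "0 \<le> ?t" using assms by simp
  obtain m where m: "?t < 2 ^ m" using real_arch_pow[of 2 ?t] by auto
  define l where "l = (LEAST m. ?t < 2 ^ m)"
  have l: "?t < 2 ^ l" unfolding l_def by (rule LeastI[of _ m]) (rule m)
  have "2 ^ l \<le> 2 * (1 + ?t)"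
  proof (cases l)
    case (Suc k)
    then have "\<not> ?t < 2 ^ k" unfolding l_def by (intro not_less_Least) auto
    then show ?thesis using Suc by simp
  qed (use t in simp)
  then have "1 + ?t \<ge> 2 ^ l / 2" by (simp only: divide_le_eq mult.commute) simp
  then have "1 + ?t \<ge> 2 powr (real l - 1)" by (simp add: powr_diff powr_realpow)
  then have "(1 + ?t) powr (- D) \<le> (2 powr (real l - 1)) powr (- D)"
    using assms t by (intro powr_mono2') auto
  also have "\<dots> = 2 powr D * 2 powr (- D * real l)"
    by (simp add: powr_powr algebra_simps flip: powr_add)
  finally have w: "c * (1 + ?t) powr (- D) \<le> c * 2 powr D * 2 powr (- D * real l)"
    using assms by (simp add: mult_left_mono mult.assoc)
  \<comment> \<open>The bound passes to the infimum after division by the factor, which vanishes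
    only for \<open>c = 0\<close>; in that case \<open>b = 0\<close>.\<close>
  have "b \<le> ennreal (c * (1 + ?t) powr (- D)) * (INF w\<in>ball z (d * r). a w)"
  proof (cases "c = 0")
    case True
    then show ?thesis using b[of z] assms by simp
  next
    case False
    define C where "C = c * (1 + ?t) powr (- D)"
    have "0 < 1 + ?t" using t by linarith
    then have C: "0 < C" using False assms by (simp add: C_def)
    have "b / ennreal C \<le> (INF w\<in>ball z (d * r). a w)"
      using b C by (intro INF_greatest) (auto simp: C_def[symmetric] divide_le_ennreal_iff mult.commute)
    then show ?thesis
      using C by (simp add: C_def[symmetric] divide_le_ennreal_iff mult.commute)
  qed
  also have "\<dots> \<le> ennreal (c * 2 powr D * 2 powr (- D * real l)) * sup_inf (2 ^ l * r) (d * r) a x"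
    using l assms unfolding sup_inf_def
    by (intro mult_mono ennreal_leI w SUP_upper) (auto simp: field_simps)
  also have "\<dots> \<le> (\<Sum>l. ennreal (c * 2 powr D * 2 powr (- D * real l)) * sup_inf (2 ^ l * r) (d * r) a x)"
    using sum_le_suminf[of "\<lambda>l. ennreal (c * 2 powr D * 2 powr (- D * real l)) * sup_inf (2 ^ l * r) (d * r) a x" "{l}"]
    by simp
  finally show ?thesis .
qed


section \<open>Exponents above 1: Young's inequality and duality\<close>

lemma ennreal_Young:
  fixes u v :: ennreal
  assumes "1 < t"
  shows "u * v \<le> ennreal_rpow u t + ennreal_rpow v (t / (t - 1))"
\<comment> \<open>The curve v = u^(t-1) separates the region where u^t dominates the product from
  the region where the conjugate power of \<open>v\<close> does.\<close>
proof (cases "v \<le> ennreal_rpow u (t - 1)")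
  case True
  then have "u * v \<le> u * ennreal_rpow u (t - 1)" by (rule mult_left_mono) simp
  also have "\<dots> = ennreal_rpow u t" using ennreal_rpow_add[of 1 "t - 1" u] assms by simp
  finally show ?thesis by (simp add: add_increasing2)
next
  case False
  then have "ennreal_rpow (ennreal_rpow u (t - 1)) (1 / (t - 1)) \<le> ennreal_rpow v (1 / (t - 1))"
    using assms by (intro ennreal_rpow_mono) auto
  then have "u * v \<le> ennreal_rpow v (1 / (t - 1)) * v"
    using assms by (intro mult_right_mono) (auto simp: ennreal_rpow_rpow)
  also have "\<dots> = ennreal_rpow v (1 / (t - 1) + 1)"
    using ennreal_rpow_add[of "1 / (t - 1)" 1 v] assms by simp
  also have "1 / (t - 1) + 1 = t / (t - 1)" using assms by (simp add: field_simps)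
  finally show ?thesis by (simp add: add_increasing)
qed

text \<open>\<open>T\<close> is tested against its own power: for a truncation \<open>h\<close> of
  \<open>T\<close>, the weight w = h^(t-1) satisfies w^t' = h^t. Young's inequality with parameter
  \<open>\<kappa>\<close> and the strong type bound for \<open>maximal_fn w\<close> reproduce the
  integral of h^t with a factor at most 1/2, which is absorbed.\<close>

lemma nn_integral_rpow_le_of_dual_bound:
  fixes T S :: "'a::euclidean_space \<Rightarrow> ennreal"
  assumes [measurable]: "T \<in> borel_measurable borel" "S \<in> borel_measurable borel"
    and "1 < t" "0 \<le> C"
    and dual: "\<And>w. w \<in> borel_measurable borel \<Longrightarrow>
      (\<integral>\<^sup>+x. T x * w x \<partial>lborel) \<le> ennreal C * (\<integral>\<^sup>+x. S x * maximal_fn w x \<partial>lborel)"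
  defines "t' \<equiv> t / (t - 1)"
  defines "\<kappa> \<equiv> (2 * C * (5 ^ DIM('a) * (t' / (t' - 1)) * 2 powr t') + 1) powr (1 / t')"
  shows "(\<integral>\<^sup>+x. ennreal_rpow (T x) t \<partial>lborel) \<le> ennreal (2 * C * \<kappa> powr t) * (\<integral>\<^sup>+x. ennreal_rpow (S x) t \<partial>lborel)"
proof -
  have t': "1 < t'" "(t - 1) * t' = t" using assms by (auto simp: t'_def field_simps)
  define CM where "CM = 5 ^ DIM('a) * (t' / (t' - 1)) * 2 powr t'"
  have CM: "0 \<le> CM" using t' by (simp add: CM_def)
  have "\<kappa> = (2 * C * CM + 1) powr (1 / t')" by (simp only: \<kappa>_def CM_def)
  moreover have "0 < 2 * C * CM + 1" using CM \<open>0 \<le> C\<close> by (simp add: add_nonneg_pos)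
  ultimately have \<kappa>: "0 < \<kappa>" "\<kappa> powr t' = 2 * C * CM + 1"
    using t' by (auto simp: powr_powr)
  let ?I = "\<integral>\<^sup>+x. ennreal_rpow (S x) t \<partial>lborel"
  \<comment> \<open>Truncated in height and in space, so that the integral to be absorbed is
    finite.\<close>
  define h where "h N x = min (T x) (of_nat N) * indicator (ball 0 (real N)) x" for N :: nat and x
  have [measurable]: "h N \<in> borel_measurable borel" for N unfolding h_def by measurable
  have bound: "(\<integral>\<^sup>+x. ennreal_rpow (h N x) t \<partial>lborel) \<le> ennreal (2 * C * \<kappa> powr t) * ?I" for N
  proof -
    define X where "X = (\<integral>\<^sup>+x. ennreal_rpow (h N x) t \<partial>lborel)"
    define w where "w x = ennreal_rpow (h N x) (t - 1)" for x
    have [measurable]: "w \<in> borel_measurable borel" unfolding w_def by measurable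
    have "X \<le> (\<integral>\<^sup>+x. ennreal (real N powr t) * indicator (ball (0::'a) (real N)) x \<partial>lborel)"
      unfolding X_def
    proof (intro nn_integral_mono)
      fix x
      have "h N x \<le> of_nat N" by (simp add: h_def indicator_def)
      then have "ennreal_rpow (h N x) t \<le> ennreal_rpow (of_nat N) t"
        using \<open>1 < t\<close> by (intro ennreal_rpow_mono) auto
      then show "ennreal_rpow (h N x) t \<le> ennreal (real N powr t) * indicator (ball 0 (real N)) x"
        by (auto simp: h_def ennreal_rpow_ennreal indicator_def simp flip: ennreal_of_nat_eq_real_of_nat split: if_splits)
          (simp add: ennreal_of_nat_eq_real_of_nat ennreal_rpow_ennreal)
    qed
    also have "\<dots> < top"
      using emeasure_ball_neq_top[of "0::'a" "real N"] by (simp add: nn_integral_cmult_indicator ennreal_mult_less_top less_top)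
    finally have Xfin: "X < top" .
    have "X \<le> (\<integral>\<^sup>+x. T x * w x \<partial>lborel)"
      unfolding X_def
    proof (intro nn_integral_mono)
      fix x
      have "ennreal_rpow (h N x) t = h N x * w x"
        using ennreal_rpow_add[of 1 "t - 1" "h N x"] \<open>1 < t\<close> by (simp add: w_def)
      also have "\<dots> \<le> T x * w x"
        by (intro mult_right_mono) (auto simp: h_def indicator_def)
      finally show "ennreal_rpow (h N x) t \<le> T x * w x" .
    qed
    also have "\<dots> \<le> ennreal C * (\<integral>\<^sup>+x. S x * maximal_fn w x \<partial>lborel)"
      by (rule dual) simp
    also have "(\<integral>\<^sup>+x. S x * maximal_fn w x \<partial>lborel) \<le>
        (\<integral>\<^sup>+x. ennreal (\<kappa> powr t) * ennreal_rpow (S x) t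
          + ennreal (\<kappa> powr - t') * ennreal_rpow (maximal_fn w x) t' \<partial>lborel)"
    proof (intro nn_integral_mono)
      fix x
      have "S x * maximal_fn w x = (ennreal \<kappa> * ennreal (1 / \<kappa>)) * (S x * maximal_fn w x)"
        using \<kappa> by (simp flip: ennreal_mult)
      also have "\<dots> = (ennreal \<kappa> * S x) * (ennreal (1 / \<kappa>) * maximal_fn w x)"
        by (simp only: ac_simps)
      also have "\<dots> \<le> ennreal_rpow (ennreal \<kappa> * S x) t + ennreal_rpow (ennreal (1 / \<kappa>) * maximal_fn w x) t'"
        unfolding t'_def using \<open>1 < t\<close> by (rule ennreal_Young)
      also have "\<dots> = ennreal (\<kappa> powr t) * ennreal_rpow (S x) t
          + ennreal (\<kappa> powr - t') * ennreal_rpow (maximal_fn w x) t'"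
        using \<open>1 < t\<close> t' \<kappa> by (simp add: ennreal_rpow_mult ennreal_rpow_ennreal powr_divide powr_minus_divide)
      finally show "S x * maximal_fn w x \<le> ennreal (\<kappa> powr t) * ennreal_rpow (S x) t
          + ennreal (\<kappa> powr - t') * ennreal_rpow (maximal_fn w x) t'" .
    qed
    also have "\<dots> = ennreal (\<kappa> powr t) * ?I + ennreal (\<kappa> powr - t') * (\<integral>\<^sup>+x. ennreal_rpow (maximal_fn w x) t' \<partial>lborel)"
      by (subst nn_integral_add) (auto simp: nn_integral_cmult)
    also have "(\<integral>\<^sup>+x. ennreal_rpow (maximal_fn w x) t' \<partial>lborel) \<le> ennreal CM * (\<integral>\<^sup>+x. ennreal_rpow (w x) t' \<partial>lborel)"
      unfolding CM_def using t' by (intro maximal_fn_strong_type) auto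
    also have "(\<integral>\<^sup>+x. ennreal_rpow (w x) t' \<partial>lborel) = X"
      by (simp add: w_def X_def ennreal_rpow_rpow t')
    finally have "X \<le> ennreal C * (ennreal (\<kappa> powr t) * ?I + ennreal (\<kappa> powr - t') * (ennreal CM * X))"
      by (simp add: mult_left_mono add_left_mono)
    also have "\<dots> = ennreal (C * \<kappa> powr t) * ?I + ennreal (C * CM * \<kappa> powr - t') * X"
      using \<open>0 \<le> C\<close> CM by (simp add: ennreal_mult distrib_left ac_simps)
    \<comment> \<open>The choice \<kappa>^t' = 2 C CM + 1 makes the factor at most 1/2; the summand
      1 keeps \<open>\<kappa>\<close> positive when \<open>C = 0\<close>.\<close>
    also have "\<dots> \<le> ennreal (C * \<kappa> powr t) * ?I + ennreal (1 / 2) * X"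
    proof (intro add_left_mono mult_right_mono ennreal_leI)
      have "C * CM \<le> (1 / 2) * \<kappa> powr t'" using \<kappa> by simp
      then show "C * CM * \<kappa> powr - t' \<le> 1 / 2" using \<kappa>(1) by (simp add: powr_minus_divide divide_le_eq)
    qed simp
    finally have *: "X \<le> ennreal (C * \<kappa> powr t) * ?I + ennreal (1 / 2) * X" .
    have "ennreal (1/2) * X + ennreal (1/2) * X = X"
      by (subst distrib_right[symmetric], subst ennreal_plus[symmetric]) auto
    with * have "ennreal (1/2) * X \<le> ennreal (C * \<kappa> powr t) * ?I"
      using Xfin by (metis add.commute ennreal_add_left_cancel_le ennreal_mult_less_top ennreal_less_top less_top infinity_ennreal_def)
    then have "ennreal 2 * (ennreal (1/2) * X) \<le> ennreal 2 * (ennreal (C * \<kappa> powr t) * ?I)"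
      by (rule mult_left_mono) simp
    moreover have "ennreal 2 * (ennreal (1/2) * X) = X"
      by (subst mult.assoc[symmetric], subst ennreal_mult[symmetric]) auto
    moreover have "ennreal 2 * (ennreal (C * \<kappa> powr t) * ?I) = ennreal (2 * C * \<kappa> powr t) * ?I"
      using \<open>0 \<le> C\<close> by (subst mult.assoc[symmetric], subst ennreal_mult[symmetric]) (auto simp: mult.assoc)
    ultimately show ?thesis unfolding X_def by simp
  qed
  have lim: "(\<lambda>N. h N x) \<longlonglongrightarrow> T x" for x
  proof -
    have "(\<lambda>N. min (T x) (of_nat N)) \<longlonglongrightarrow> min (T x) top"
      by (intro tendsto_min tendsto_const of_nat_tendsto_top_ennreal)
    moreover have "\<forall>\<^sub>F N in sequentially. min (T x) (of_nat N) = h N x"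
    proof -
      obtain N0 :: nat where "norm x < N0" using reals_Archimedean2 by blast
      then show ?thesis by (intro eventually_sequentiallyI[of N0]) (auto simp: h_def)
    qed
    ultimately show ?thesis using Lim_transform_eventually by fastforce
  qed
  have inc: "incseq (\<lambda>N. h N x)" for x
    by (auto simp: incseq_def h_def indicator_def min_le_iff_disj)
  have "(SUP N. h N x) = T x" for x
    using LIMSEQ_SUP[OF inc] lim LIMSEQ_unique by blast
  then have "(\<integral>\<^sup>+x. ennreal_rpow (T x) t \<partial>lborel) = (\<integral>\<^sup>+x. (SUP N. ennreal_rpow (h N x) t) \<partial>lborel)"
    using \<open>1 < t\<close> inc by (subst ennreal_rpow_cont_mono[symmetric]) auto
  also have "\<dots> = (SUP N. \<integral>\<^sup>+x. ennreal_rpow (h N x) t \<partial>lborel)"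
    using inc \<open>1 < t\<close> by (intro nn_integral_monotone_convergence_SUP)
      (auto simp: incseq_def le_fun_def intro!: ennreal_rpow_mono)
  also have "\<dots> \<le> ennreal (2 * C * \<kappa> powr t) * ?I"
    by (intro SUP_least bound)
  finally show ?thesis .
qed

text \<open>The decay 2^(-D l) of the dyadic shell \<open>l\<close> competes with the volume growth
  2^(n l). For \<open>\<theta>\<close> at least 1 the shells are summed linearly and the series
  converges since D > n; for \<open>\<theta>\<close> below 1 the power is distributed over the
  shells first, and D \<theta> > n is what counts. \<open>C\<close> is chosen before
  \<open>a\<close>, \<open>b\<close> and \<open>r\<close>, so that weights and scales remain
  free.\<close>

theorem vector_valued_maximal_inequality:
  fixes c d D \<theta> :: real
  assumes "0 < d" "0 < \<theta>" "real DIM('a::euclidean_space) < D" "real DIM('a) < D * \<theta>" "0 \<le> c"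
  shows "\<exists>C\<ge>0. \<forall>(a :: 'i::countable \<Rightarrow> 'a \<Rightarrow> ennreal) b r.
    (\<forall>j. a j \<in> borel_measurable borel) \<longrightarrow> (\<forall>j. 0 < r j) \<longrightarrow>
    (\<forall>j x. \<exists>z. \<forall>w\<in>ball z (d * r j). b j x \<le> ennreal (c * (1 + dist x z / r j) powr (- D)) * a j w) \<longrightarrow>
    (\<integral>\<^sup>+x. ennreal_rpow (\<integral>\<^sup>+j. b j x \<partial>count_space UNIV) \<theta> \<partial>lborel) \<le>
      ennreal C * (\<integral>\<^sup>+x. ennreal_rpow (\<integral>\<^sup>+j. a j x \<partial>count_space UNIV) \<theta> \<partial>lborel)"
proof -
  let ?n = "DIM('a)"
  have D: "0 < D" using assms(3) by (rule le_less_trans[rotated]) simp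
  define g where "g l = c * 2 powr D * 2 powr (- D * real l)" for l :: nat
  have g: "0 \<le> g l" for l using assms by (simp add: g_def)
  have geo: "summable (\<lambda>l::nat. X * 2 powr (e * real l))" if "e < 0" for e X :: real
  proof -
    have "2 powr (e * real l) = (2 powr e) ^ l" for l by (simp add: powr_powr flip: powr_realpow)
    then show ?thesis using that by (auto intro!: summable_mult summable_geometric powr_less_one)
  qed
  define \<rho> where "\<rho> l = ((2 ^ l + d) / d) ^ ?n" for l :: nat
  have \<rho>0: "0 \<le> \<rho> l" for l using assms by (simp add: \<rho>_def)
  have \<rho>: "\<rho> l \<le> ((1 + d) / d) ^ ?n * 2 powr (real ?n * real l)" for l
  proof -
    have "2 ^ l + d \<le> (1 + d) * 2 ^ l"
      using assms by (simp add: distrib_right)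
    then have "(2 ^ l + d) / d \<le> (1 + d) / d * 2 ^ l"
      using assms by (simp add: divide_right_mono)
    then have "\<rho> l \<le> ((1 + d) / d * 2 ^ l) ^ ?n"
      unfolding \<rho>_def using assms by (intro power_mono) auto
    also have "\<dots> = ((1 + d) / d) ^ ?n * 2 powr (real ?n * real l)"
      by (subst power_mult_distrib) (simp flip: powr_realpow power_mult add: mult.commute powr_powr)
    finally show ?thesis .
  qed
  have bT: "(\<integral>\<^sup>+j. b j x \<partial>count_space UNIV)
      \<le> (\<Sum>l. ennreal (g l) * (\<integral>\<^sup>+j. sup_inf (2 ^ l * r j) (d * r j) (a j) x \<partial>count_space UNIV))"
    if that': "\<And>j. a j \<in> borel_measurable borel" "\<And>j. 0 < r j"
     "\<forall>j x. \<exists>z. \<forall>w\<in>ball z (d * r j). b j x \<le> ennreal (c * (1 + dist x z / r j) powr (- D)) * a j w"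
    for a b :: "'i \<Rightarrow> 'a \<Rightarrow> ennreal" and r x
  proof -
    have "(\<integral>\<^sup>+j. b j x \<partial>count_space UNIV)
      \<le> (\<integral>\<^sup>+j. (\<Sum>l. ennreal (g l) * sup_inf (2 ^ l * r j) (d * r j) (a j) x) \<partial>count_space UNIV)"
    proof (intro nn_integral_mono)
      fix j
      obtain z where "\<forall>w\<in>ball z (d * r j). b j x \<le> ennreal (c * (1 + dist x z / r j) powr (- D)) * a j w"
        using that'(3) by blast
      then show "b j x \<le> (\<Sum>l. ennreal (g l) * sup_inf (2 ^ l * r j) (d * r j) (a j) x)"
        unfolding g_def using that' assms D by (intro le_suminf_sup_inf[where z=z]) auto
    qed
    also have "\<dots> = (\<Sum>l. ennreal (g l) * (\<integral>\<^sup>+j. sup_inf (2 ^ l * r j) (d * r j) (a j) x \<partial>count_space UNIV))"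
      by (subst nn_integral_suminf) (auto simp: nn_integral_cmult)
    finally show ?thesis .
  qed
  show ?thesis
  proof (cases "\<theta> < 1")
    case True
    define K where "K l = 2 * 5 ^ ?n * \<rho> l / (1 - \<theta>)" for l
    have K: "0 \<le> K l" for l using True \<rho>0 by (simp add: K_def)
    have "summable (\<lambda>l. g l powr \<theta> * K l)"
    proof (rule summable_comparison_test')
      show "summable (\<lambda>l. ((c * 2 powr D) powr \<theta> * (2 * 5 ^ ?n / (1 - \<theta>)) * ((1 + d) / d) ^ ?n) *
         2 powr ((real ?n - D * \<theta>) * real l))"
        using assms by (intro geo) auto
      fix l :: nat
      have "g l powr \<theta> * K l \<le> g l powr \<theta> * ((2 * 5 ^ ?n / (1 - \<theta>)) * (((1 + d) / d) ^ ?n * 2 powr (real ?n * real l)))"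
        using True \<rho>[of l] by (intro mult_left_mono) (auto simp: K_def divide_right_mono)
      also have "\<dots> = (c * 2 powr D) powr \<theta> * 2 powr (- D * \<theta> * real l) *
          ((2 * 5 ^ ?n / (1 - \<theta>)) * (((1 + d) / d) ^ ?n * 2 powr (real ?n * real l)))"
        using assms by (simp add: g_def powr_mult powr_powr ac_simps)
      finally have "g l powr \<theta> * K l \<le> (c * 2 powr D) powr \<theta> * 2 powr (- D * \<theta> * real l) *
          ((2 * 5 ^ ?n / (1 - \<theta>)) * (((1 + d) / d) ^ ?n * 2 powr (real ?n * real l)))" .
      moreover have "2 powr ((real ?n - D * \<theta>) * real l) = 2 powr (- D * \<theta> * real l) * 2 powr (real ?n * real l)"
        by (simp add: algebra_simps flip: powr_add)
      ultimately show "norm (g l powr \<theta> * K l) \<le> ((c * 2 powr D) powr \<theta> * (2 * 5 ^ ?n / (1 - \<theta>)) * ((1 + d) / d) ^ ?n) *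
         2 powr ((real ?n - D * \<theta>) * real l)"
        using K[of l] by (simp only: real_norm_def abs_of_nonneg mult_nonneg_nonneg powr_ge_zero ac_simps)
    qed
    then have fin: "(\<Sum>l. ennreal (g l powr \<theta> * K l)) = ennreal (\<Sum>l. g l powr \<theta> * K l)"
      using K by (intro suminf_ennreal2) auto
    have "(\<integral>\<^sup>+x. ennreal_rpow (\<integral>\<^sup>+j. b j x \<partial>count_space UNIV) \<theta> \<partial>lborel) \<le>
      ennreal (\<Sum>l. g l powr \<theta> * K l) * (\<integral>\<^sup>+x. ennreal_rpow (\<integral>\<^sup>+j. a j x \<partial>count_space UNIV) \<theta> \<partial>lborel)"
      if [measurable]: "\<And>j. a j \<in> borel_measurable borel" and r: "\<And>j. 0 < r j"
       "\<forall>j x. \<exists>z. \<forall>w\<in>ball z (d * r j). b j x \<le> ennreal (c * (1 + dist x z / r j) powr (- D)) * a j w"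
      for a b :: "'i \<Rightarrow> 'a \<Rightarrow> ennreal" and r
    proof -
      let ?T = "\<lambda>l x. \<integral>\<^sup>+j. sup_inf (2 ^ l * r j) (d * r j) (a j) x \<partial>count_space UNIV"
      let ?I = "\<integral>\<^sup>+x. ennreal_rpow (\<integral>\<^sup>+j. a j x \<partial>count_space UNIV) \<theta> \<partial>lborel"
      have "(\<integral>\<^sup>+x. ennreal_rpow (\<integral>\<^sup>+j. b j x \<partial>count_space UNIV) \<theta> \<partial>lborel)
        \<le> (\<integral>\<^sup>+x. ennreal_rpow (\<Sum>l. ennreal (g l) * ?T l x) \<theta> \<partial>lborel)"
        using that assms by (intro nn_integral_mono ennreal_rpow_mono bT) auto
      also have "\<dots> \<le> (\<integral>\<^sup>+x. (\<Sum>l. ennreal_rpow (ennreal (g l) * ?T l x) \<theta>) \<partial>lborel)"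
        using assms True by (intro nn_integral_mono ennreal_rpow_suminf_le) auto
      also have "\<dots> = (\<Sum>l. ennreal (g l powr \<theta>) * (\<integral>\<^sup>+x. ennreal_rpow (?T l x) \<theta> \<partial>lborel))"
        using assms g by (subst nn_integral_suminf) (auto simp: ennreal_rpow_mult ennreal_rpow_ennreal nn_integral_cmult)
      also have "\<dots> \<le> (\<Sum>l. ennreal (g l powr \<theta>) * (ennreal (K l) * ?I))"
        using assms True r unfolding K_def \<rho>_def
        by (intro suminf_le mult_left_mono nn_integral_rpow_sup_inf_lt_1) auto
      also have "\<dots> = (\<Sum>l. ennreal (g l powr \<theta> * K l) * ?I)"
        using K by (simp add: ennreal_mult mult.assoc)
      also have "\<dots> = ennreal (\<Sum>l. g l powr \<theta> * K l) * ?I"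
        by (simp add: fin)
      finally show ?thesis .
    qed
    moreover have "0 \<le> (\<Sum>l. g l powr \<theta> * K l)"
      using K \<open>summable (\<lambda>l. g l powr \<theta> * K l)\<close> by (intro suminf_nonneg) auto
    ultimately show ?thesis by blast
  next
    case False
    have "summable (\<lambda>l. g l * (2 * \<rho> l))"
    proof (rule summable_comparison_test')
      show "summable (\<lambda>l. (c * 2 powr D * 2 * ((1 + d) / d) ^ ?n) * 2 powr ((real ?n - D) * real l))"
        using assms by (intro geo) auto
      fix l :: nat
      have "g l * (2 * \<rho> l) \<le> g l * (2 * (((1 + d) / d) ^ ?n * 2 powr (real ?n * real l)))"
        using \<rho>[of l] g by (intro mult_left_mono) auto
      moreover have "2 powr ((real ?n - D) * real l) = 2 powr (- D * real l) * 2 powr (real ?n * real l)"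
        by (simp add: algebra_simps flip: powr_add)
      ultimately have "g l * (2 * \<rho> l) \<le> (c * 2 powr D * 2 * ((1 + d) / d) ^ ?n) * 2 powr ((real ?n - D) * real l)"
        unfolding g_def by (simp only: ac_simps)
      then show "norm (g l * (2 * \<rho> l)) \<le> (c * 2 powr D * 2 * ((1 + d) / d) ^ ?n) * 2 powr ((real ?n - D) * real l)"
        using g[of l] \<rho>0[of l] by simp
    qed
    then have fin: "(\<Sum>l. ennreal (g l * (2 * \<rho> l))) = ennreal (\<Sum>l. g l * (2 * \<rho> l))"
      and C: "0 \<le> (\<Sum>l. g l * (2 * \<rho> l))"
      using g \<rho>0 by (auto intro!: suminf_ennreal2 suminf_nonneg)
    define C where "C = (\<Sum>l. g l * (2 * \<rho> l))"
    have dual: "(\<integral>\<^sup>+x. (\<Sum>l. ennreal (g l) * (\<integral>\<^sup>+j. sup_inf (2 ^ l * r j) (d * r j) (a j) x \<partial>count_space UNIV)) * w x \<partial>lborel)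
        \<le> ennreal C * (\<integral>\<^sup>+x. (\<integral>\<^sup>+j. a j x \<partial>count_space UNIV) * W x \<partial>lborel)"
      if [measurable]: "\<And>j. a j \<in> borel_measurable borel" "w \<in> borel_measurable borel" "W \<in> borel_measurable borel"
        and r: "\<And>j. 0 < r j"
        and W: "\<And>y s. 0 < s \<Longrightarrow> (\<integral>\<^sup>+x. w x * indicator (ball y s) x \<partial>lborel) \<le> W y * emeasure lborel (ball y s)"
      for a :: "'i \<Rightarrow> 'a \<Rightarrow> ennreal" and r w W
    proof -
      let ?T = "\<lambda>l x. \<integral>\<^sup>+j. sup_inf (2 ^ l * r j) (d * r j) (a j) x \<partial>count_space UNIV"
      let ?J = "\<integral>\<^sup>+x. (\<integral>\<^sup>+j. a j x \<partial>count_space UNIV) * W x \<partial>lborel"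
      have "(\<integral>\<^sup>+x. (\<Sum>l. ennreal (g l) * ?T l x) * w x \<partial>lborel) = (\<integral>\<^sup>+x. (\<Sum>l. ennreal (g l) * ?T l x * w x) \<partial>lborel)"
        by simp
      also have "\<dots> = (\<Sum>l. ennreal (g l) * (\<integral>\<^sup>+x. ?T l x * w x \<partial>lborel))"
        by (subst nn_integral_suminf) (auto simp: nn_integral_cmult mult.assoc)
      also have "\<dots> \<le> (\<Sum>l. ennreal (g l) * (ennreal (2 * \<rho> l) * ?J))"
      proof (intro suminf_le mult_left_mono)
        fix l
        show "(\<integral>\<^sup>+x. ?T l x * w x \<partial>lborel) \<le> ennreal (2 * \<rho> l) * ?J"
          \<comment> \<open>With an empty exceptional set the half-volume condition holds trivially
            at every point.\<close>
          using nn_integral_sum_sup_inf[of a w W "{}" UNIV d "2 ^ l" r] that \<open>0 < d\<close> by (simp add: \<rho>_def)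
      qed auto
      also have "\<dots> = (\<Sum>l. ennreal (g l * (2 * \<rho> l)) * ?J)"
        using g \<rho>0 by (simp add: ennreal_mult mult.assoc)
      also have "\<dots> = ennreal C * ?J"
        by (simp add: fin C_def)
      finally show ?thesis .
    qed
    show ?thesis
    proof (cases "\<theta> = 1")
      case True
      have "(\<integral>\<^sup>+x. (\<integral>\<^sup>+j. b j x \<partial>count_space UNIV) \<partial>lborel) \<le> ennreal C * (\<integral>\<^sup>+x. (\<integral>\<^sup>+j. a j x \<partial>count_space UNIV) \<partial>lborel)"
        if "\<And>j. a j \<in> borel_measurable borel" and "\<And>j. 0 < r j"
         "\<forall>j x. \<exists>z. \<forall>w\<in>ball z (d * r j). b j x \<le> ennreal (c * (1 + dist x z / r j) powr (- D)) * a j w"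
        for a b :: "'i \<Rightarrow> 'a \<Rightarrow> ennreal" and r
        using order.trans[OF nn_integral_mono[OF bT[OF that]] dual[of a "\<lambda>_. 1" "\<lambda>_. 1" r, simplified]] that by simp
      then show ?thesis using C True unfolding C_def[symmetric] by (auto intro!: exI[of _ C])
    next
      case \<theta>1: False
      then have \<theta>1: "1 < \<theta>" using False by simp
      define t' where "t' = \<theta> / (\<theta> - 1)"
      define \<kappa> where "\<kappa> = (2 * C * (5 ^ DIM('a) * (t' / (t' - 1)) * 2 powr t') + 1) powr (1 / t')"
      have "(\<integral>\<^sup>+x. ennreal_rpow (\<integral>\<^sup>+j. b j x \<partial>count_space UNIV) \<theta> \<partial>lborel) \<le>
        ennreal (2 * C * \<kappa> powr \<theta>) * (\<integral>\<^sup>+x. ennreal_rpow (\<integral>\<^sup>+j. a j x \<partial>count_space UNIV) \<theta> \<partial>lborel)"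
        if [measurable]: "\<And>j. a j \<in> borel_measurable borel" and r: "\<And>j. 0 < r j"
         "\<forall>j x. \<exists>z. \<forall>w\<in>ball z (d * r j). b j x \<le> ennreal (c * (1 + dist x z / r j) powr (- D)) * a j w"
        for a b :: "'i \<Rightarrow> 'a \<Rightarrow> ennreal" and r
      proof -
        have "(\<integral>\<^sup>+x. ennreal_rpow (\<integral>\<^sup>+j. b j x \<partial>count_space UNIV) \<theta> \<partial>lborel)
           \<le> (\<integral>\<^sup>+x. ennreal_rpow (\<Sum>l. ennreal (g l) * (\<integral>\<^sup>+j. sup_inf (2 ^ l * r j) (d * r j) (a j) x \<partial>count_space UNIV)) \<theta> \<partial>lborel)"
          using that assms by (intro nn_integral_mono ennreal_rpow_mono bT) auto
        also have "\<dots> \<le> ennreal (2 * C * \<kappa> powr \<theta>) * (\<integral>\<^sup>+x. ennreal_rpow (\<integral>\<^sup>+j. a j x \<partial>count_space UNIV) \<theta> \<partial>lborel)"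
          \<comment> \<open>The second weight is the maximal function of the first;
            \<open>maximal_fn_upper\<close>, taken at the centre of the ball, is the condition that
            \<open>dual\<close> asks for.\<close>
          unfolding \<kappa>_def t'_def using \<theta>1 C r
          by (intro nn_integral_rpow_le_of_dual_bound dual maximal_fn_upper) (auto simp: C_def)
        finally show ?thesis .
      qed
      moreover have "0 \<le> 2 * C * \<kappa> powr \<theta>" using C by (simp add: C_def)
      ultimately show ?thesis by blast
    qed
  qed
qed


section \<open>Smooth functions\<close>

lemma smooth_differentiable: "smooth f \<Longrightarrow> f differentiable at x"
  unfolding smooth_def using iterated_partial.simps(1)[of f]
  by (metis UNIV_I differentiable_on_def)

lemma iterated_partial_snoc: "iterated_partial (is @ [i]) f = iterated_partial is (partial_deriv i f)"
  by (induction "is") auto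

lemma smooth_partial_deriv: "smooth f \<Longrightarrow> smooth (partial_deriv i f)"
  unfolding smooth_def by (metis iterated_partial_snoc)

lemma smooth_continuous: "smooth f \<Longrightarrow> continuous_on UNIV f"
  by (meson continuous_at_imp_continuous_on differentiable_imp_continuous_within smooth_differentiable)

text \<open>Smoothness as a greatest fixed point: it suffices to exhibit a class of differentiable
  functions closed under partial derivatives, so that closure properties are proved with first
  derivatives only.\<close>

lemma smooth_coinduct:
  assumes "P f" and "\<And>g x. P g \<Longrightarrow> g differentiable at x" and "\<And>g i. P g \<Longrightarrow> P (partial_deriv i g)"
  shows "smooth f"
proof -
  have "P (iterated_partial is f)" for "is" by (induction "is") (use assms in auto)
  then show ?thesis unfolding smooth_def using assms(2) by (simp add: differentiable_on_def)
qed

lemma partial_derivI: "(f has_derivative f') (at x) \<Longrightarrow> partial_deriv i f x = f' (axis i 1)"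
  unfolding partial_deriv_def by (metis frechet_derivative_at)

lemma smooth_has_derivative: "smooth f \<Longrightarrow> (f has_derivative frechet_derivative f (at x)) (at x)"
  using smooth_differentiable frechet_derivative_works by blast

lemma smooth_const [simp]: "smooth (\<lambda>x::real^'n::finite. c)"
proof (rule smooth_coinduct[where P = "\<lambda>g. \<exists>c. g = (\<lambda>x. c)"])
  show "\<exists>c. partial_deriv i g = (\<lambda>x. c)" if "\<exists>c. g = (\<lambda>x. c)" for g :: "real^'n \<Rightarrow> 'a" and i
    using that by (auto intro!: exI[of _ 0] ext simp: partial_derivI[OF has_derivative_const])
qed auto

lemma smooth_bounded_linear:
  assumes "bounded_linear L" "smooth f"
  shows "smooth (\<lambda>x. L (f x))"
proof (rule smooth_coinduct[where P = "\<lambda>g. \<exists>f. smooth f \<and> g = (\<lambda>x. L (f x))"])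
  show "\<exists>g. smooth g \<and> (\<lambda>x. L (f x)) = (\<lambda>x. L (g x))" using assms by blast
next
  fix g x assume "\<exists>f. smooth f \<and> g = (\<lambda>x. L (f x))"
  then show "g differentiable at x"
    using bounded_linear.has_derivative[OF assms(1) smooth_has_derivative] differentiableI by blast
next
  fix g i assume "\<exists>f. smooth f \<and> g = (\<lambda>x. L (f x))"
  then obtain f where f: "smooth f" "g = (\<lambda>x. L (f x))" by blast
  have "partial_deriv i g = (\<lambda>x. L (partial_deriv i f x))"
    unfolding f(2) by (rule ext, subst partial_derivI[OF bounded_linear.has_derivative[OF assms(1) smooth_has_derivative[OF f(1)]]])
      (simp add: partial_deriv_def)
  then show "\<exists>f. smooth f \<and> partial_deriv i g = (\<lambda>x. L (f x))"
    using f smooth_partial_deriv by blast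
qed

lemma smooth_add:
  assumes "smooth f" "smooth g"
  shows "smooth (\<lambda>x. f x + g x)"
proof (rule smooth_coinduct[where P = "\<lambda>h. \<exists>f g. smooth f \<and> smooth g \<and> h = (\<lambda>x. f x + g x)"])
  fix h i assume "\<exists>f g. smooth f \<and> smooth g \<and> h = (\<lambda>x. f x + g x)"
  then obtain f g where f: "smooth f" "smooth g" "h = (\<lambda>x. f x + g x)" by blast
  have "partial_deriv i h = (\<lambda>x. partial_deriv i f x + partial_deriv i g x)"
    unfolding f(3) by (rule ext, subst partial_derivI[OF has_derivative_add[OF smooth_has_derivative[OF f(1)] smooth_has_derivative[OF f(2)]]])
      (simp add: partial_deriv_def)
  then show "\<exists>f g. smooth f \<and> smooth g \<and> partial_deriv i h = (\<lambda>x. f x + g x)"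
    using f smooth_partial_deriv by blast
qed (use assms smooth_differentiable in \<open>auto intro!: differentiable_add\<close>)

text \<open>The product rule turns one product into a sum of two, so products alone are not closed
  under partial derivatives. Their finite sums are, and serve as the invariant of
  \<open>smooth_coinduct\<close>.\<close>

inductive bilinear_sum :: "('b::real_normed_vector \<Rightarrow> 'c::real_normed_vector \<Rightarrow> 'd::real_normed_vector)
    \<Rightarrow> (real^'n::finite \<Rightarrow> 'd) \<Rightarrow> bool" for h where
  base: "smooth f \<Longrightarrow> smooth g \<Longrightarrow> bilinear_sum h (\<lambda>x. h (f x) (g x))"
| add: "bilinear_sum h u \<Longrightarrow> bilinear_sum h v \<Longrightarrow> bilinear_sum h (\<lambda>x. u x + v x)"

lemma has_derivative_bilinear_smooth:
  assumes "bounded_bilinear h" "smooth f" "smooth g"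
  shows "((\<lambda>x. h (f x) (g x)) has_derivative
     (\<lambda>t. h (f x) (frechet_derivative g (at x) t) + h (frechet_derivative f (at x) t) (g x))) (at x)"
  using bounded_bilinear.FDERIV[OF assms(1) smooth_has_derivative[OF assms(2)] smooth_has_derivative[OF assms(3)]] .

lemma partial_deriv_bilinear:
  assumes "bounded_bilinear h" "smooth f" "smooth g"
  shows "partial_deriv i (\<lambda>x. h (f x) (g x)) = (\<lambda>x. h (f x) (partial_deriv i g x) + h (partial_deriv i f x) (g x))"
  by (rule ext, subst partial_derivI[OF has_derivative_bilinear_smooth[OF assms]]) (simp add: partial_deriv_def)

lemma smooth_bilinear:
  assumes h: "bounded_bilinear h" and "smooth f" "smooth g"
  shows "smooth (\<lambda>x. h (f x) (g x))"
proof (rule smooth_coinduct[where P = "bilinear_sum h"])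
  have *: "(\<forall>x. u differentiable at x) \<and> (\<forall>i. bilinear_sum h (partial_deriv i u))" if "bilinear_sum h u" for u :: "real^'d \<Rightarrow> 'c"
    using that
  proof induction
    case (base f g)
    then show ?case
      using has_derivative_bilinear_smooth[OF h base] partial_deriv_bilinear[OF h base] smooth_partial_deriv
      by (auto simp: differentiable_def intro!: bilinear_sum.intros intro: base smooth_partial_deriv)
  next
    case (add u v)
    have "partial_deriv i (\<lambda>x. u x + v x) = (\<lambda>x. partial_deriv i u x + partial_deriv i v x)" for i
    proof
      fix x
      have "((\<lambda>x. u x + v x) has_derivative (\<lambda>t. frechet_derivative u (at x) t + frechet_derivative v (at x) t)) (at x)"
        using add frechet_derivative_works by (intro has_derivative_add) blast+
      then show "partial_deriv i (\<lambda>x. u x + v x) x = partial_deriv i u x + partial_deriv i v x"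
        by (subst partial_derivI) (auto simp: partial_deriv_def)
    qed
    then show ?case using add by (auto intro!: bilinear_sum.intros differentiable_add)
  qed
  show "u differentiable at x" if "bilinear_sum h u" for u :: "real^'d \<Rightarrow> 'c" and x using *[OF that] by blast
  show "bilinear_sum h (partial_deriv i u)" if "bilinear_sum h u" for u :: "real^'d \<Rightarrow> 'c" and i using *[OF that] by blast
qed (use assms in \<open>auto intro: bilinear_sum.intros\<close>)

lemma smooth_mult: "smooth f \<Longrightarrow> smooth g \<Longrightarrow> smooth (\<lambda>x. f x * (g x :: 'a::real_normed_algebra))"
  by (rule smooth_bilinear[OF bounded_bilinear_mult])

lemma smooth_component: "smooth (\<lambda>x::real^'n::finite. x $ i)"
proof (rule smooth_coinduct[where P = "\<lambda>g. (\<exists>i. g = (\<lambda>x. x $ i)) \<or> (\<exists>c. g = (\<lambda>x. c))"])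
  fix g :: "real^'n \<Rightarrow> real" and j assume "(\<exists>i. g = (\<lambda>x. x $ i)) \<or> (\<exists>c. g = (\<lambda>x. c))"
  then have "(\<exists>i. g = (\<lambda>x. x $ i)) \<or> smooth g" "(\<exists>i. g = (\<lambda>x. x $ i)) \<or> (\<exists>c. g = (\<lambda>x. c))" by auto
  moreover have "partial_deriv j (\<lambda>x::real^'n. x $ i) = (\<lambda>x. axis j 1 $ i)" for i
    by (rule ext, subst partial_derivI[OF bounded_linear_imp_has_derivative[OF bounded_linear_vec_nth]]) simp
  moreover have "partial_deriv j (\<lambda>x::real^'n. c::real) = (\<lambda>x. 0)" for c
    by (rule ext, subst partial_derivI[OF has_derivative_const]) simp
  ultimately show "(\<exists>i. partial_deriv j g = (\<lambda>x. x $ i)) \<or> (\<exists>c. partial_deriv j g = (\<lambda>x. c))" by auto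
qed (auto intro: bounded_linear_imp_differentiable bounded_linear_vec_nth)

lemma smooth_sum: "(\<And>i. i \<in> I \<Longrightarrow> smooth (f i)) \<Longrightarrow> smooth (\<lambda>x. \<Sum>i\<in>I. f i x)"
  by (induction I rule: infinite_finite_induct) (auto intro: smooth_add)

lemma smooth_prod:
  fixes f :: "'i \<Rightarrow> real^'n::finite \<Rightarrow> 'a::{real_normed_algebra_1, comm_ring_1}"
  shows "(\<And>i. i \<in> I \<Longrightarrow> smooth (f i)) \<Longrightarrow> smooth (\<lambda>x. \<Prod>i\<in>I. f i x)"
  by (induction I rule: infinite_finite_induct) (auto intro: smooth_mult)

lemma smooth_power:
  fixes f :: "real^'n::finite \<Rightarrow> 'a::{real_normed_algebra_1}"
  shows "smooth f \<Longrightarrow> smooth (\<lambda>x. f x ^ m)"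
  by (induction m) (auto intro: smooth_mult)

lemma partial_deriv_eq_0:
  assumes "open U" "x \<in> U" "\<And>y. y \<in> U \<Longrightarrow> f y = 0"
  shows "(f has_derivative (\<lambda>_. 0)) (at x)" "partial_deriv i f x = 0"
proof -
  have "\<forall>\<^sub>F y in at x. f y = 0" using assms by (intro eventually_at_topological[THEN iffD2]) auto
  then show *: "(f has_derivative (\<lambda>_. 0)) (at x)"
    using assms by (intro has_derivative_transform_eventually[OF has_derivative_const]) (auto elim: eventually_mono)
  then show "partial_deriv i f x = 0" by (simp add: partial_derivI)
qed

text \<open>The numerator vanishes near the origin, where the denominator may be zero.\<close>

lemma smooth_divide_power:
  fixes u d :: "real^'n::finite \<Rightarrow> complex"
  assumes "smooth u" "smooth d" "0 < e" "\<And>x. norm x < e \<Longrightarrow> u x = 0" "\<And>x. x \<noteq> 0 \<Longrightarrow> d x \<noteq> 0"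
  shows "smooth (\<lambda>x. u x / d x ^ m)"
proof (rule smooth_coinduct[where P = "\<lambda>g. \<exists>u m. smooth u \<and> (\<forall>x. norm x < e \<longrightarrow> u x = 0) \<and> g = (\<lambda>x. u x / d x ^ m)"])
  \<comment> \<open>The quotient rule in a form whose numerator vanishes near the origin again, so
    that the class reproduces itself. Near the origin both sides are 0, whatever \<open>d\<close> is
    there.\<close>
  have *: "\<exists>g'. ((\<lambda>x. u x / d x ^ m) has_derivative g') (at x) \<and>
      g' (axis i 1) = (partial_deriv i u x * d x - of_nat m * u x * partial_deriv i d x) / d x ^ Suc m"
    if u: "smooth u" "\<And>x. norm x < e \<Longrightarrow> u x = 0" for u m x i
  proof (cases "norm x < e")
    case True
    then have "partial_deriv i u x = 0" "((\<lambda>x. u x / d x ^ m) has_derivative (\<lambda>_. 0)) (at x)"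
      using u by (auto intro!: partial_deriv_eq_0[of "ball 0 e"])
    then show ?thesis using True u by (auto intro!: exI[of _ "\<lambda>_. 0"])
  next
    case False
    then have "x \<noteq> 0" using \<open>0 < e\<close> by auto
    then have d: "d x \<noteq> 0" by (rule assms)
    have "((\<lambda>x. d x ^ m) has_derivative (\<lambda>t. of_nat m * frechet_derivative d (at x) t * d x ^ (m - 1))) (at x)"
      by (rule has_derivative_power[OF smooth_has_derivative[OF assms(2)]])
    then have "((\<lambda>x. u x / d x ^ m) has_derivative (\<lambda>t. (frechet_derivative u (at x) t * d x ^ m -
      u x * (of_nat m * frechet_derivative d (at x) t * d x ^ (m - 1))) / (d x ^ m * d x ^ m))) (at x)"
      using d by (intro has_derivative_divide' smooth_has_derivative u) auto
    moreover have "(U * d x ^ m - u x * (of_nat m * D * d x ^ (m - 1))) / (d x ^ m * d x ^ m)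
       = (U * d x - of_nat m * u x * D) / d x ^ Suc m" for U D
      using d by (cases m) (auto simp: field_simps)
    ultimately show ?thesis unfolding partial_deriv_def by (intro exI conjI) auto
  qed
  fix g x i assume "\<exists>u m. smooth u \<and> (\<forall>x. norm x < e \<longrightarrow> u x = 0) \<and> g = (\<lambda>x. u x / d x ^ m)"
  then obtain u m where u: "smooth u" "\<And>x. norm x < e \<Longrightarrow> u x = 0" and g: "g = (\<lambda>x. u x / d x ^ m)" by blast
  show "g differentiable at x" using *[OF u, of m x] unfolding g differentiable_def by blast
  show "\<exists>u m. smooth u \<and> (\<forall>x. norm x < e \<longrightarrow> u x = 0) \<and> partial_deriv i g = (\<lambda>x. u x / d x ^ m)"
  proof (intro exI conjI allI impI)
    show "partial_deriv i g = (\<lambda>x. (partial_deriv i u x * d x + (- (of_nat m * u x * partial_deriv i d x))) / d x ^ Suc m)"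
    proof
      fix x
      show "partial_deriv i g x = (partial_deriv i u x * d x + (- (of_nat m * u x * partial_deriv i d x))) / d x ^ Suc m"
        using *[OF u, of m x i] unfolding g by (auto simp: partial_derivI)
    qed
    show "smooth (\<lambda>x. partial_deriv i u x * d x + (- (of_nat m * u x * partial_deriv i d x)))"
      using u assms smooth_partial_deriv
      by (intro smooth_add smooth_mult smooth_bounded_linear[OF bounded_linear_minus[OF bounded_linear_ident]]) auto
    show "partial_deriv i u x * d x + (- (of_nat m * u x * partial_deriv i d x)) = 0" if "norm x < e" for x
      using that u partial_deriv_eq_0(2)[of "ball 0 e" x u i] by auto
  qed
qed (use assms in auto)

section \<open>Integrals of functions with bounded support\<close>

lemma partial_deriv_bounded_support:
  fixes f :: "real^'n::finite \<Rightarrow> 'a::real_normed_vector"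
  assumes "\<And>x. R < norm x \<Longrightarrow> f x = 0"
  shows "R < norm x \<Longrightarrow> partial_deriv i f x = 0"
proof -
  assume "R < norm x"
  moreover have "open {x::real^'n. R < norm x}" by (intro open_Collect_less continuous_intros)
  ultimately show ?thesis using assms by (intro partial_deriv_eq_0(2)[of "{x. R < norm x}"]) auto
qed

lemma integrable_bounded_support:
  fixes f :: "'a::euclidean_space \<Rightarrow> 'b::{banach, second_countable_topology}"
  assumes "continuous_on UNIV f" "\<And>x. R < norm x \<Longrightarrow> f x = 0"
  shows "integrable lborel f"
proof -
  have "integrable lborel (\<lambda>x. indicator (cball 0 R) x *\<^sub>R f x)"
    using assms by (intro borel_integrable_compact) (auto intro: continuous_on_subset)
  moreover have "indicator (cball 0 R) x *\<^sub>R f x = f x" for x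
    using assms(2)[of x] by (auto simp: indicator_def)
  ultimately show ?thesis by simp
qed

lemma bounded_of_bounded_support:
  fixes f :: "'a::euclidean_space \<Rightarrow> 'b::real_normed_vector"
  assumes "continuous_on UNIV f" "\<And>x. R < norm x \<Longrightarrow> f x = 0"
  obtains M where "0 \<le> M" "\<And>x. norm (f x) \<le> M"
proof -
  have "bounded (f ` cball 0 R)"
    using assms by (intro compact_imp_bounded compact_continuous_image) (auto intro: continuous_on_subset)
  then obtain M where "\<And>x. x \<in> cball 0 R \<Longrightarrow> norm (f x) \<le> M" unfolding bounded_iff by blast
  then have "norm (f x) \<le> max M 0" for x
    using assms(2)[of x] by (cases "norm x \<le> R") (auto simp: le_max_iff_disj)
  then show ?thesis by (intro that[of "max M 0"]) auto
qed

lemma integrable_lborel_affine: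
  fixes f :: "'a::euclidean_space \<Rightarrow> 'b::{banach, second_countable_topology}"
  assumes "integrable lborel f" "c \<noteq> 0"
  shows "integrable lborel (\<lambda>x. f (t + c *\<^sub>R x))"
proof -
  have [measurable]: "f \<in> borel_measurable borel" using assms by auto
  have "integrable (density (distr lborel borel (\<lambda>x. t + c *\<^sub>R x)) (\<lambda>_. ennreal (\<bar>c\<bar>^DIM('a)))) f"
    using assms lborel_affine[of c t] by simp
  then have "integrable (distr lborel borel (\<lambda>x. t + c *\<^sub>R x)) (\<lambda>x. \<bar>c\<bar>^DIM('a) *\<^sub>R f x)"
    by (subst (asm) integrable_density) auto
  then have "integrable lborel (\<lambda>x. \<bar>c\<bar>^DIM('a) *\<^sub>R f (t + c *\<^sub>R x))"
    by (subst (asm) integrable_distr_eq) auto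
  then have "integrable lborel (\<lambda>x. (1 / \<bar>c\<bar>^DIM('a)) *\<^sub>R (\<bar>c\<bar>^DIM('a) *\<^sub>R f (t + c *\<^sub>R x)))"
    by (rule integrable_scaleR_right)
  then show ?thesis using assms(2) by (simp flip: power_mult_distrib)
qed

lemma integral_lborel_affine:
  fixes f :: "'a::euclidean_space \<Rightarrow> 'b::{banach, second_countable_topology}"
  assumes [measurable]: "f \<in> borel_measurable borel" and "c \<noteq> 0"
  shows "(LINT x|lborel. f x) = \<bar>c\<bar> ^ DIM('a) *\<^sub>R (LINT x|lborel. f (t + c *\<^sub>R x))"
proof -
  have "(LINT x|lborel. f x) = (LINT x|density (distr lborel borel (\<lambda>x. t + c *\<^sub>R x)) (\<lambda>_. ennreal (\<bar>c\<bar>^DIM('a))). f x)"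
    using lborel_affine[OF \<open>c \<noteq> 0\<close>, of t] by simp
  then show ?thesis by (simp add: integral_density integral_distr)
qed

text \<open>Difference quotients integrate to zero by translation invariance and converge to the
  partial derivative, dominated by the bound of that derivative on a fixed ball.\<close>

lemma integral_partial_deriv_eq_0:
  fixes f :: "real^'n::finite \<Rightarrow> 'a::{banach, second_countable_topology}"
  assumes diff: "\<And>x. f differentiable at x" and cont: "continuous_on UNIV (partial_deriv i f)"
    and supp: "\<And>x. R < norm x \<Longrightarrow> f x = 0"
  shows "(LINT x|lborel. partial_deriv i f x) = 0"
proof -
  obtain M where M: "0 \<le> M" "\<And>x. norm (partial_deriv i f x) \<le> M"
  proof (rule bounded_of_bounded_support[OF cont])
    fix x :: "real^'n" assume "R < norm x"
    then show "partial_deriv i f x = 0" by (intro partial_deriv_bounded_support[of R]) (use supp in auto)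
  qed blast
  have contf: "continuous_on UNIV f"
    using diff differentiable_imp_continuous_within by (intro continuous_at_imp_continuous_on) blast
  let ?e = "axis i 1 :: real^'n"
  have line: "((\<lambda>t. f (x + t *\<^sub>R ?e)) has_vector_derivative partial_deriv i f (x + t *\<^sub>R ?e)) (at t within S)" for x t S
  proof -
    have "(f has_derivative frechet_derivative f (at (x + t *\<^sub>R ?e))) (at (x + t *\<^sub>R ?e))"
      using diff frechet_derivative_works by blast
    moreover have "((\<lambda>t. x + t *\<^sub>R ?e) has_derivative (\<lambda>t. t *\<^sub>R ?e)) (at t within S)"
      by (auto intro!: derivative_eq_intros)
    ultimately have "((\<lambda>t. f (x + t *\<^sub>R ?e)) has_derivative
        (\<lambda>s. frechet_derivative f (at (x + t *\<^sub>R ?e)) (s *\<^sub>R ?e))) (at t within S)"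
      by (rule has_derivative_compose[rotated])
    then show ?thesis
      unfolding has_vector_derivative_def partial_deriv_def
      using linear_frechet_derivative[OF diff, of "x + t *\<^sub>R ?e"] by (simp add: linear_cmul)
  qed
  have lip: "norm (f (x + t *\<^sub>R ?e) - f x) \<le> M * t" if "0 \<le> t" for x t
  proof -
    have "norm (f (x + t *\<^sub>R ?e) - f (x + 0 *\<^sub>R ?e)) \<le> M * norm (t - 0)"
    proof (rule differentiable_bound)
      show "((\<lambda>t. f (x + t *\<^sub>R ?e)) has_derivative (\<lambda>s. s *\<^sub>R partial_deriv i f (x + t *\<^sub>R ?e))) (at t within UNIV)" for t
        using line[of x t UNIV] by (simp add: has_vector_derivative_def)
      show "onorm (\<lambda>s. s *\<^sub>R partial_deriv i f (x + t *\<^sub>R ?e)) \<le> M" for t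
        using M(2) by (intro onorm_le) (simp add: mult.commute[of M] mult_left_mono)
    qed auto
    then show ?thesis using that by simp
  qed
  \<comment> \<open>Steps of length at most 1 keep the supports of all quotients in the ball of
    radius R + 1.\<close>
  define h where "h m = 1 / real (Suc m)" for m
  have h: "0 < h m" "h m \<le> 1" for m by (auto simp: h_def)
  define q where "q m x = (f (x + h m *\<^sub>R ?e) - f x) /\<^sub>R h m" for m x
  have contq: "continuous_on UNIV (q m)" for m
    unfolding q_def by (intro continuous_intros continuous_on_compose2[OF contf]) auto
  have "(\<lambda>m. LINT x|lborel. q m x) \<longlonglongrightarrow> (LINT x|lborel. partial_deriv i f x)"
  proof (rule integral_dominated_convergence[where w = "\<lambda>x. M * indicator (cball 0 (R + 1)) x"])
    show "integrable lborel (\<lambda>x::real^'n. M * indicator (cball 0 (R + 1)) x)"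
      by (intro integrable_mult_right integrable_real_indicator) (auto intro: emeasure_bounded_finite simp flip: infinity_ennreal_def)
    show "AE x in lborel. (\<lambda>m. q m x) \<longlonglongrightarrow> partial_deriv i f x"
    proof (intro AE_I2)
      fix x
      have "((\<lambda>t. norm ((f (x + t *\<^sub>R ?e) - f x) /\<^sub>R t - partial_deriv i f x)) \<longlongrightarrow> 0) (at 0)"
      proof (rule Lim_transform_eventually)
        show "((\<lambda>t. norm (f (x + t *\<^sub>R ?e) - f x - t *\<^sub>R partial_deriv i f x) / norm t) \<longlongrightarrow> 0) (at 0)"
          using line[of x 0 UNIV] by (simp add: has_vector_derivative_def has_derivative_at)
        have "norm (f (x + t *\<^sub>R ?e) - f x - t *\<^sub>R partial_deriv i f x) / norm t
            = norm ((f (x + t *\<^sub>R ?e) - f x) /\<^sub>R t - partial_deriv i f x)" if "t \<noteq> 0" for t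
        proof -
          have "(f (x + t *\<^sub>R ?e) - f x) /\<^sub>R t - partial_deriv i f x
              = (f (x + t *\<^sub>R ?e) - f x - t *\<^sub>R partial_deriv i f x) /\<^sub>R t"
            using that by (simp add: scaleR_diff_right)
          then show ?thesis by (simp add: divide_inverse mult.commute)
        qed
        then show "\<forall>\<^sub>F t in at 0. norm (f (x + t *\<^sub>R ?e) - f x - t *\<^sub>R partial_deriv i f x) / norm t
            = norm ((f (x + t *\<^sub>R ?e) - f x) /\<^sub>R t - partial_deriv i f x)"
          by (auto simp: eventually_at_filter)
      qed
      then have "((\<lambda>t. (f (x + t *\<^sub>R ?e) - f x) /\<^sub>R t) \<longlongrightarrow> partial_deriv i f x) (at 0)"
        by (simp add: tendsto_norm_zero_iff LIM_zero_iff)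
      moreover have "filterlim h (at 0) sequentially"
        unfolding h_def filterlim_at using LIMSEQ_Suc[OF lim_1_over_n] by (auto simp: eventually_sequentially)
      ultimately show "(\<lambda>m. q m x) \<longlonglongrightarrow> partial_deriv i f x"
        unfolding q_def by (rule filterlim_compose)
    qed
    show "AE x in lborel. norm (q m x) \<le> M * indicator (cball 0 (R + 1)) x" for m
    proof (intro AE_I2)
      fix x
      show "norm (q m x) \<le> M * indicator (cball 0 (R + 1)) x"
      proof (cases "norm x \<le> R + 1")
        case True
        have "norm (q m x) = norm (f (x + h m *\<^sub>R ?e) - f x) / h m"
          using h(1)[of m] by (simp add: q_def divide_inverse mult.commute)
        also have "\<dots> \<le> M" using lip[of "h m" x] h(1)[of m] by (simp add: divide_le_eq)
        finally show ?thesis using True by simp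
      next
        case False
        have "norm x \<le> norm (x + h m *\<^sub>R ?e) + norm (h m *\<^sub>R ?e)"
          using norm_triangle_ineq4[of "x + h m *\<^sub>R ?e" "h m *\<^sub>R ?e"] by simp
        then have "R < norm (x + h m *\<^sub>R ?e)" using False h[of m] by simp
        then show ?thesis using False supp[of x] supp[of "x + h m *\<^sub>R ?e"] by (simp add: q_def)
      qed
    qed
  qed (use cont contq in \<open>auto intro: borel_measurable_continuous_onI\<close>)
  moreover have "(LINT x|lborel. q m x) = 0" for m
  proof -
    have int: "integrable lborel f" using contf supp by (rule integrable_bounded_support)
    have "integrable lborel (\<lambda>x. f (x + h m *\<^sub>R ?e))" "(LINT x|lborel. f (x + h m *\<^sub>R ?e)) = (LINT x|lborel. f x)"
      using integrable_lborel_affine[OF int, of 1 "h m *\<^sub>R ?e"]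
        integral_lborel_affine[of f 1 "h m *\<^sub>R ?e"] int by (auto simp: add.commute)
    then show ?thesis using int by (simp add: q_def)
  qed
  ultimately show ?thesis by (simp add: LIMSEQ_const_iff)
qed


section \<open>Oscillatory integrals\<close>

lemma has_derivative_cis_inner:
  fixes y :: "'a::real_inner"
  shows "((\<lambda>x. cis (y \<bullet> x)) has_derivative (\<lambda>t. complex_of_real (y \<bullet> t) * \<i> * cis (y \<bullet> x))) (at x within S)"
proof -
  have "((\<lambda>x. \<i> * complex_of_real (y \<bullet> x)) has_derivative (\<lambda>t. \<i> * complex_of_real (y \<bullet> t))) (at x within S)"
    by (intro bounded_linear_imp_has_derivative bounded_linear_const_mult
        bounded_linear_compose[OF bounded_linear_of_real bounded_linear_inner_right])
  moreover have "(exp has_derivative (*) (exp (\<i> * complex_of_real (y \<bullet> x)))) (at (\<i> * complex_of_real (y \<bullet> x)))"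
    using DERIV_exp has_field_derivative_def by blast
  ultimately have "((\<lambda>x. exp (\<i> * complex_of_real (y \<bullet> x))) has_derivative
      (\<lambda>t. exp (\<i> * complex_of_real (y \<bullet> x)) * (\<i> * complex_of_real (y \<bullet> t)))) (at x within S)"
    by (rule has_derivative_compose)
  then show ?thesis by (simp add: cis_conv_exp ac_simps)
qed

lemma cis_inner_measurable [measurable]:
  "f \<in> borel_measurable M \<Longrightarrow> g \<in> borel_measurable M \<Longrightarrow>
    (\<lambda>x. cis ((f x :: 'a::euclidean_space) \<bullet> g x)) \<in> borel_measurable M"
  by (simp add: cis_conv_exp)

lemma bilinear_measurable:
  fixes h :: "'b::euclidean_space \<Rightarrow> 'c::euclidean_space \<Rightarrow> 'd::real_normed_vector"
  assumes h: "bounded_bilinear h" and "f \<in> borel_measurable M" "g \<in> borel_measurable M"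
  shows "(\<lambda>x. h (f x) (g x)) \<in> borel_measurable M"
proof (rule borel_measurable_continuous_Pair[OF assms(2,3)])
  show "continuous_on UNIV (\<lambda>x. h (fst x) (snd x))"
    by (intro bounded_bilinear.continuous_on[OF h] continuous_intros)
qed

lemma smooth_iterated_partial: "smooth f \<Longrightarrow> smooth (iterated_partial is f)"
  by (induction "is") (auto intro: smooth_partial_deriv)

lemma iterated_partial_bounded_support:
  fixes f :: "real^'n::finite \<Rightarrow> 'b::real_normed_vector"
  assumes "\<And>x. R < norm x \<Longrightarrow> f x = 0"
  shows "R < norm x \<Longrightarrow> iterated_partial is f x = 0"
  using assms
proof (induction "is" arbitrary: x)
  case (Cons i "is")
  then show ?case using partial_deriv_bounded_support[of R "iterated_partial is f" x i] by auto
qed auto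

text \<open>The two instances of interest are the complex multiplication and \<open>cscale\<close>.\<close>

locale complex_scaling = bounded_bilinear h
  for h :: "complex \<Rightarrow> 'c::euclidean_space \<Rightarrow> 'c" +
  assumes norm_h: "norm (h z u) = cmod z * norm u"
    and h_mult: "h (z * w) u = h z (h w u)"
    and h_1: "h 1 u = u"
    and h_adjoint: "inner (h z u) v = inner u (h (cnj z) v)"
begin

lemmas h_measurable [measurable] = bilinear_measurable[OF bounded_bilinear_axioms]

lemma integrable_cis:
  fixes f :: "'a::euclidean_space \<Rightarrow> 'c"
  assumes "integrable lborel f"
  shows "integrable lborel (\<lambda>x. h (cis (y \<bullet> x)) (f x))"
proof (rule Bochner_Integration.integrable_bound[OF assms])
  have [measurable]: "f \<in> borel_measurable borel" using assms by auto
  show "(\<lambda>x. h (cis (y \<bullet> x)) (f x)) \<in> borel_measurable lborel" by measurable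
qed (simp add: norm_h)

lemma norm_integral_cis_le:
  fixes f :: "'a::euclidean_space \<Rightarrow> 'c"
  assumes "integrable lborel f"
  shows "norm (LINT x|lborel. h (cis (y \<bullet> x)) (f x)) \<le> (LINT x|lborel. norm (f x))"
  using integral_norm_bound[of lborel "\<lambda>x. h (cis (y \<bullet> x)) (f x)"] by (simp add: norm_h)

lemma continuous_integral_cis:
  fixes f :: "'a::euclidean_space \<Rightarrow> 'c"
  assumes "integrable lborel f"
  shows "continuous_on UNIV (\<lambda>y. LINT x|lborel. h (cis (y \<bullet> x)) (f x))"
proof (intro continuous_at_imp_continuous_on ballI, unfold continuous_at_sequentially o_def, intro allI impI)
  have [measurable]: "f \<in> borel_measurable borel" using assms by auto
  fix y :: 'a and u :: "nat \<Rightarrow> 'a" assume u: "u \<longlonglongrightarrow> y"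
  show "(\<lambda>m. LINT x|lborel. h (cis (u m \<bullet> x)) (f x)) \<longlonglongrightarrow> (LINT x|lborel. h (cis (y \<bullet> x)) (f x))"
  proof (rule integral_dominated_convergence[where w = "\<lambda>x. norm (f x)"])
    show "AE x in lborel. (\<lambda>m. h (cis (u m \<bullet> x)) (f x)) \<longlonglongrightarrow> h (cis (y \<bullet> x)) (f x)"
      using u by (intro AE_I2 tendsto tendsto_const tendsto_intros) (auto simp: cis_conv_exp intro!: tendsto_intros)
  qed (use assms in \<open>auto simp: norm_h\<close>)
qed

lemma integral_h:
  fixes f :: "'a::euclidean_space \<Rightarrow> 'c"
  assumes "integrable lborel f"
  shows "(LINT x|lborel. h z (f x)) = h z (LINT x|lborel. f x)"
  by (rule integral_bounded_linear[OF bounded_linear_right assms])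

lemma h_uminus: "h (- z) u = - h z u"
  by (rule minus_left)

text \<open>Integration by parts: the derivative of the product of \<open>f\<close> with the
  exponential has integral zero.\<close>

lemma integral_cis_partial_deriv:
  fixes f :: "real^'n::finite \<Rightarrow> 'c"
  assumes f: "smooth f" and supp: "\<And>x. R < norm x \<Longrightarrow> f x = 0"
  shows "(LINT x|lborel. h (cis (y \<bullet> x)) (partial_deriv i f x))
    = h (- \<i> * complex_of_real (y $ i)) (LINT x|lborel. h (cis (y \<bullet> x)) (f x))"
proof -
  define F where "F x = h (cis (y \<bullet> x)) (f x)" for x
  have cont: "continuous_on UNIV f" "continuous_on UNIV (partial_deriv i f)"
    using f smooth_partial_deriv smooth_continuous by blast+
  have ccis: "continuous_on UNIV (\<lambda>x::real^'n. cis (y \<bullet> x))"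
    unfolding cis_conv_exp by (intro continuous_intros)
  have der: "(F has_derivative (\<lambda>t. h (cis (y \<bullet> x)) (frechet_derivative f (at x) t) +
      h (complex_of_real (y \<bullet> t) * \<i> * cis (y \<bullet> x)) (f x))) (at x)" for x
    unfolding F_def by (rule FDERIV[OF has_derivative_cis_inner smooth_has_derivative[OF f]])
  have pF: "partial_deriv i F x = h (cis (y \<bullet> x)) (partial_deriv i f x) + h (complex_of_real (y $ i) * \<i>) (F x)" for x
    by (subst partial_derivI[OF der]) (simp add: partial_deriv_def F_def h_mult inner_axis)
  have contF: "continuous_on UNIV F" unfolding F_def
    by (intro continuous_on cont ccis)
  have suppF: "F x = 0" if "R < norm x" for x using supp[OF that] by (simp add: F_def zero_right)
  have supp': "partial_deriv i f x = 0" if "R < norm x" for x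
    using supp that by (rule partial_deriv_bounded_support)
  have int: "integrable lborel f" "integrable lborel (partial_deriv i f)" "integrable lborel F"
    using integrable_bounded_support[of f R] integrable_bounded_support[of "partial_deriv i f" R]
      integrable_bounded_support[of F R] cont contF supp supp' suppF by blast+
  have "(LINT x|lborel. partial_deriv i F x) = 0"
  proof (rule integral_partial_deriv_eq_0[of F i R])
    show "F differentiable at x" for x using der differentiableI by blast
    show "continuous_on UNIV (partial_deriv i F)"
      unfolding pF by (intro continuous_intros continuous_on cont ccis contF)
  qed (rule suppF)
  also have "(LINT x|lborel. partial_deriv i F x) = (LINT x|lborel. h (cis (y \<bullet> x)) (partial_deriv i f x))
      + h (complex_of_real (y $ i) * \<i>) (LINT x|lborel. F x)"
    unfolding pF using int bounded_linear_right
    by (subst Bochner_Integration.integral_add)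
      (auto intro: integrable_cis integrable_bounded_linear simp: integral_h)
  finally have "(LINT x|lborel. h (cis (y \<bullet> x)) (partial_deriv i f x))
      = - h (complex_of_real (y $ i) * \<i>) (LINT x|lborel. F x)"
    by (simp add: eq_neg_iff_add_eq_0)
  then show ?thesis by (simp add: F_def h_uminus mult.commute)
qed

lemma integral_cis_iterated_partial:
  fixes f :: "real^'n::finite \<Rightarrow> 'c"
  assumes f: "smooth f" and supp: "\<And>x. R < norm x \<Longrightarrow> f x = 0"
  shows "(LINT x|lborel. h (cis (y \<bullet> x)) (iterated_partial is f x))
    = h (\<Prod>i\<leftarrow>is. - \<i> * complex_of_real (y $ i)) (LINT x|lborel. h (cis (y \<bullet> x)) (f x))"
proof (induction "is")
  case (Cons i "is")
  have "(LINT x|lborel. h (cis (y \<bullet> x)) (partial_deriv i (iterated_partial is f) x))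
    = h (- \<i> * complex_of_real (y $ i)) (LINT x|lborel. h (cis (y \<bullet> x)) (iterated_partial is f x))"
    using smooth_iterated_partial[OF f] iterated_partial_bounded_support[of R f, OF supp]
    by (rule integral_cis_partial_deriv)
  then show ?case by (simp only: iterated_partial.simps list.map prod_list.Cons Cons.IH h_mult)
qed (simp add: h_1)

text \<open>The largest coordinate of \<open>y\<close> controls its norm up to the factor n, and
  \<open>L\<close> derivatives in that direction yield the decay. The bounds of all directions are
  added, so the constant does not depend on which coordinate is largest. For \<open>norm y\<close>
  at most 1 the plain integral bound suffices.\<close>

lemma integral_cis_decay:
  fixes f :: "real^'n::finite \<Rightarrow> 'c"
  assumes f: "smooth f" and supp: "\<And>x. R < norm x \<Longrightarrow> f x = 0"
  shows "\<exists>C\<ge>0. \<forall>y. (1 + norm y) ^ L * norm (LINT x|lborel. h (cis (y \<bullet> x)) (f x)) \<le> C"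
proof -
  define K where "K y = (LINT x|lborel. h (cis (y \<bullet> x)) (f x))" for y
  define M where "M i = (LINT x|lborel. norm (iterated_partial (replicate L i) f x))" for i
  define N where "N = (LINT x|lborel. norm (f x))"
  have int: "integrable lborel (iterated_partial is f)" for "is"
    using smooth_iterated_partial[OF f] iterated_partial_bounded_support[of R f, OF supp]
    by (intro integrable_bounded_support[of _ R] smooth_continuous)
  have M: "\<bar>y $ i\<bar> ^ L * norm (K y) \<le> M i" for y i
  proof -
    have "norm (LINT x|lborel. h (cis (y \<bullet> x)) (iterated_partial (replicate L i) f x)) \<le> M i"
      unfolding M_def by (rule norm_integral_cis_le[OF int])
    then have "norm (h (\<Prod>i\<leftarrow>replicate L i. - \<i> * complex_of_real (y $ i)) (K y)) \<le> M i"
      using integral_cis_iterated_partial[OF f supp] by (simp add: K_def)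
    then show ?thesis by (simp add: norm_h norm_power norm_mult)
  qed
  have N: "norm (K y) \<le> N" for y
    unfolding K_def N_def using norm_integral_cis_le[OF int[of "[]"]] by simp
  have "0 \<le> N" unfolding N_def by simp
  have "0 \<le> M i" for i unfolding M_def by simp
  have bound: "(1 + norm y) ^ L * norm (K y) \<le> 2 ^ L * (N + real CARD('n) ^ L * (\<Sum>i\<in>UNIV. M i))" for y
  proof (cases "norm y \<le> 1")
    case True
    then have "(1 + norm y) ^ L \<le> 2 ^ L" by (intro power_mono) auto
    then have "(1 + norm y) ^ L * norm (K y) \<le> 2 ^ L * N" using N by (intro mult_mono) auto
    also have "\<dots> \<le> 2 ^ L * (N + real CARD('n) ^ L * (\<Sum>i\<in>UNIV. M i))"
      using \<open>\<And>i. 0 \<le> M i\<close> by (simp add: sum_nonneg)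
    finally show ?thesis .
  next
    case False
    obtain m where m: "\<And>i. \<bar>y $ i\<bar> \<le> \<bar>y $ m\<bar>"
    proof -
      have "finite (range (\<lambda>i. \<bar>y $ i\<bar>))" by simp
      then have "Max (range (\<lambda>i. \<bar>y $ i\<bar>)) \<in> range (\<lambda>i. \<bar>y $ i\<bar>)" by (intro Max_in) auto
      then obtain m where "\<bar>y $ m\<bar> = Max (range (\<lambda>i. \<bar>y $ i\<bar>))" by (metis rangeE)
      then show ?thesis by (intro that[of m]) simp
    qed
    have "norm y \<le> (\<Sum>i\<in>UNIV. \<bar>y $ i\<bar>)" by (rule norm_le_l1_cart)
    also have "\<dots> \<le> real CARD('n) * \<bar>y $ m\<bar>" using sum_bounded_above[of UNIV "\<lambda>i. \<bar>y $ i\<bar>" "\<bar>y $ m\<bar>"] m by simp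
    finally have "norm y \<le> real CARD('n) * \<bar>y $ m\<bar>" .
    then have "1 + norm y \<le> 2 * (real CARD('n) * \<bar>y $ m\<bar>)" using False by linarith
    then have "(1 + norm y) ^ L \<le> (2 * (real CARD('n) * \<bar>y $ m\<bar>)) ^ L" by (intro power_mono) auto
    then have "(1 + norm y) ^ L * norm (K y) \<le> (2 * (real CARD('n) * \<bar>y $ m\<bar>)) ^ L * norm (K y)"
      by (intro mult_right_mono) auto
    also have "\<dots> = 2 ^ L * (real CARD('n) ^ L * (\<bar>y $ m\<bar> ^ L * norm (K y)))"
      by (simp add: power_mult_distrib)
    also have "\<dots> \<le> 2 ^ L * (real CARD('n) ^ L * (\<Sum>i\<in>UNIV. M i))"
      using M[of y m] member_le_sum[of m UNIV M] \<open>\<And>i. 0 \<le> M i\<close> by (intro mult_left_mono) force+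
    also have "\<dots> \<le> 2 ^ L * (N + real CARD('n) ^ L * (\<Sum>i\<in>UNIV. M i))" using \<open>0 \<le> N\<close> by simp
    finally show ?thesis .
  qed
  then show ?thesis
    unfolding K_def[symmetric] using \<open>0 \<le> N\<close> \<open>\<And>i. 0 \<le> M i\<close>
    by (intro exI[of _ "2 ^ L * (N + real CARD('n) ^ L * (\<Sum>i\<in>UNIV. M i))"]) (simp add: sum_nonneg)
qed

end

interpretation cmult: complex_scaling "(*)"
  by unfold_locales (auto simp: algebra_simps norm_mult inner_complex_def intro: exI[of _ 1])

lemma norm_cscale: "norm (cscale z u) = cmod z * norm (u :: 'a::real_inner \<times> 'a)"
proof -
  obtain a b where u: "u = (a, b)" by (cases u)
  have "(norm (cscale z u))\<^sup>2 = (cmod z * norm u)\<^sup>2"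
    unfolding power_mult_distrib cmod_power2 power2_norm_eq_inner u cscale_def
    by (simp add: inner_simps algebra_simps inner_commute power2_eq_square)
  then show ?thesis by (simp add: power2_eq_iff_nonneg)
qed

lemma complex_scaling_cscale: "complex_scaling (cscale :: complex \<Rightarrow> 'a::euclidean_space \<times> 'a \<Rightarrow> 'a \<times> 'a)"
proof
  show "\<exists>K. \<forall>a b. norm (cscale a (b :: 'a \<times> 'a)) \<le> norm a * norm b * K"
    by (intro exI[of _ 1]) (simp add: norm_cscale)
qed (auto simp: norm_cscale, auto simp: cscale_def algebra_simps inner_prod_def inner_simps)

interpretation cscale: complex_scaling "cscale :: complex \<Rightarrow> 'a::euclidean_space \<times> 'a \<Rightarrow> 'a \<times> 'a"
  by (rule complex_scaling_cscale)

lemma integrable_lborel_prod: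
  fixes g :: "'a::euclidean_space \<Rightarrow> real \<Rightarrow> 'c::{real_normed_field, banach, second_countable_topology}"
  assumes "\<And>b. b \<in> Basis \<Longrightarrow> integrable lborel (g b)"
  shows "integrable lborel (\<lambda>x::'a. \<Prod>b\<in>Basis. g b (x \<bullet> b))"
    and "(LINT x|(lborel :: 'a measure). (\<Prod>b\<in>Basis. g b (x \<bullet> b))) = (\<Prod>b\<in>Basis. (LINT t|lborel. g b t))"
proof -
  interpret product_sigma_finite "\<lambda>_::'a. lborel :: real measure"
    by unfold_locales
  have [measurable]: "b \<in> Basis \<Longrightarrow> g b \<in> borel_measurable borel" for b using assms[of b] by auto
  have eq: "(lborel :: 'a measure) = distr (\<Pi>\<^sub>M b\<in>Basis. lborel) borel (\<lambda>f. \<Sum>b\<in>Basis. f b *\<^sub>R b)"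
    by (rule lborel_eq)
  have coord: "(\<Prod>b\<in>Basis. g b ((\<Sum>b\<in>Basis. f b *\<^sub>R b) \<bullet> b)) = (\<Prod>b\<in>Basis. g b (f b))" for f :: "'a \<Rightarrow> real"
    by (intro prod.cong) auto
  show "integrable lborel (\<lambda>x::'a. \<Prod>b\<in>Basis. g b (x \<bullet> b))"
    unfolding eq using assms
    by (subst integrable_distr_eq) (auto simp: coord intro!: product_integrable_prod)
  show "(LINT x|(lborel :: 'a measure). (\<Prod>b\<in>Basis. g b (x \<bullet> b))) = (\<Prod>b\<in>Basis. (LINT t|lborel. g b t))"
    unfolding eq using assms
    by (subst integral_distr) (auto simp: coord intro!: product_integral_prod)
qed

text \<open>For each of the n basis vectors, (1 + norm x)^2 is at least 1 plus the square of that
  coordinate, so a product of one-dimensional functions 1/(1 + t^2) is an integrable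
  majorant.\<close>

lemma integrable_inverse_norm_power:
  "integrable lborel (\<lambda>x::'a::euclidean_space. 1 / (1 + norm x) ^ (2 * DIM('a)))"
proof (rule Bochner_Integration.integrable_bound)
  have "integrable lborel (\<lambda>t::real. inverse (1 + t\<^sup>2))"
    using integrable_inverse_1_plus_square by (simp add: set_integrable_def)
  then show "integrable lborel (\<lambda>x::'a. \<Prod>b\<in>Basis. inverse (1 + (x \<bullet> b)\<^sup>2))"
    by (intro integrable_lborel_prod) auto
  show "AE x::'a in lborel. norm (1 / (1 + norm x) ^ (2 * DIM('a))) \<le> norm (\<Prod>b\<in>Basis. inverse (1 + (x \<bullet> b)\<^sup>2))"
  proof (intro AE_I2)
    fix x :: 'a
    have "1 / (1 + norm x) ^ (2 * DIM('a)) = (\<Prod>b\<in>(Basis::'a set). inverse ((1 + norm x)\<^sup>2))"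
      by (simp add: prod_constant power_mult divide_inverse power_inverse)
    also have "\<dots> \<le> (\<Prod>b\<in>Basis. inverse (1 + (x \<bullet> b)\<^sup>2))"
    proof (intro prod_mono conjI le_imp_inverse_le)
      fix b :: 'a assume "b \<in> Basis"
      then have "\<bar>x \<bullet> b\<bar> \<le> norm x" by (rule Basis_le_norm)
      then have "(x \<bullet> b)\<^sup>2 \<le> (norm x)\<^sup>2" by (simp add: abs_le_square_iff[symmetric])
      then show "1 + (x \<bullet> b)\<^sup>2 \<le> (1 + norm x)\<^sup>2"
        using norm_ge_zero[of x] unfolding power2_sum one_power2 by linarith
    qed (auto simp: add_pos_nonneg)
    finally show "norm (1 / (1 + norm x) ^ (2 * DIM('a))) \<le> norm (\<Prod>b\<in>Basis. inverse (1 + (x \<bullet> b)\<^sup>2))"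
      by simp
  qed
qed simp


section \<open>Fourier inversion\<close>

text \<open>This is the characteristic function of the standard normal distribution, freed from the
  factor 1/sqrt(2 pi) of its density.\<close>

lemma integral_gaussian_1:
  "integrable lborel (\<lambda>s. cis (t * s) * complex_of_real (exp (- s\<^sup>2 / 2)))"
  "(LINT s|lborel. cis (t * s) * complex_of_real (exp (- s\<^sup>2 / 2))) = complex_of_real (sqrt (2 * pi) * exp (- t\<^sup>2 / 2))"
proof -
  have *: "exp (- s\<^sup>2 / 2) = sqrt (2 * pi) * std_normal_density s" for s
    by (simp add: std_normal_density_def)
  have int: "integrable lborel std_normal_density" by simp
  show "integrable lborel (\<lambda>s. cis (t * s) * complex_of_real (exp (- s\<^sup>2 / 2)))"
    unfolding * by (rule Bochner_Integration.integrable_bound[OF integrable_mult_right[OF int, of "sqrt (2 * pi)"]])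
      (auto simp: norm_mult cis_conv_exp)
  have "(LINT s|lborel. std_normal_density s *\<^sub>R iexp (t * s)) = char std_normal_distribution t"
    unfolding char_def by (subst integral_density) auto
  also have "\<dots> = complex_of_real (exp (- t\<^sup>2 / 2))" by (simp add: char_std_normal_distribution)
  finally have "(LINT s|lborel. complex_of_real (sqrt (2 * pi)) * (std_normal_density s *\<^sub>R iexp (t * s))) =
     complex_of_real (sqrt (2 * pi)) * complex_of_real (exp (- t\<^sup>2 / 2))"
    by (simp only: integral_mult_right_zero)
  moreover have "cis (t * s) * complex_of_real (exp (- s\<^sup>2 / 2)) =
      complex_of_real (sqrt (2 * pi)) * (std_normal_density s *\<^sub>R iexp (t * s))" for s
    unfolding *[of s] by (simp add: scaleR_conv_of_real cis_conv_exp)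
  ultimately show "(LINT s|lborel. cis (t * s) * complex_of_real (exp (- s\<^sup>2 / 2))) = complex_of_real (sqrt (2 * pi) * exp (- t\<^sup>2 / 2))"
    by (simp only: of_real_mult)
qed

lemma integral_gaussian:
  fixes t :: "'a::euclidean_space"
  shows "integrable lborel (\<lambda>x::'a. cis (t \<bullet> x) * complex_of_real (exp (- (norm x)\<^sup>2 / 2)))"
    and "(LINT x|lborel. cis (t \<bullet> x) * complex_of_real (exp (- (norm x)\<^sup>2 / 2)))
      = complex_of_real (sqrt (2 * pi) ^ DIM('a) * exp (- (norm t)\<^sup>2 / 2))"
proof -
  have e: "exp (- (norm x)\<^sup>2 / 2) = (\<Prod>b\<in>Basis. exp (- (x \<bullet> b)\<^sup>2 / 2))" for x :: 'a
  proof -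
    have "(norm x)\<^sup>2 = (\<Sum>b\<in>Basis. (x \<bullet> b)\<^sup>2)"
      by (subst power2_norm_eq_inner, subst euclidean_inner) (simp add: power2_eq_square)
    then show ?thesis by (simp add: sum_negf flip: exp_sum sum_divide_distrib)
  qed
  have c: "cis (t \<bullet> x) = (\<Prod>b\<in>Basis. cis ((t \<bullet> b) * (x \<bullet> b)))" for x :: 'a
    by (simp add: euclidean_inner[of t x] cis_conv_exp sum_distrib_left exp_sum)
  have *: "cis (t \<bullet> x) * complex_of_real (exp (- (norm x)\<^sup>2 / 2))
     = (\<Prod>b\<in>Basis. cis ((t \<bullet> b) * (x \<bullet> b)) * complex_of_real (exp (- (x \<bullet> b)\<^sup>2 / 2)))" for x :: 'a
    unfolding e c by (simp add: prod.distrib)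
  show "integrable lborel (\<lambda>x::'a. cis (t \<bullet> x) * complex_of_real (exp (- (norm x)\<^sup>2 / 2)))"
    unfolding * by (rule integrable_lborel_prod(1)) (rule integral_gaussian_1)
  show "(LINT x|lborel. cis (t \<bullet> x) * complex_of_real (exp (- (norm x)\<^sup>2 / 2)))
      = complex_of_real (sqrt (2 * pi) ^ DIM('a) * exp (- (norm t)\<^sup>2 / 2))"
    unfolding *
    by (subst integrable_lborel_prod(2), rule integral_gaussian_1(1), simp only: integral_gaussian_1(2) e[of t])
      (simp add: prod.distrib)
qed

lemma integrable_gaussian: "integrable lborel (\<lambda>x::'a::euclidean_space. exp (- (norm x)\<^sup>2 / 2))"
  using integrable_norm[OF integral_gaussian(1)[of "0::'a"]] by simp

lemma integrable_pair_bound: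
  fixes F :: "'a::euclidean_space \<times> 'b::euclidean_space \<Rightarrow> 'c::{banach, second_countable_topology}"
    and u :: "'a \<Rightarrow> real" and v :: "'b \<Rightarrow> real"
  assumes "F \<in> borel_measurable borel" "integrable lborel u" "integrable lborel v"
    and "\<And>x y. norm (F (x, y)) \<le> u x * v y"
  shows "integrable (lborel \<Otimes>\<^sub>M lborel) F"
proof (rule Bochner_Integration.integrable_bound)
  have [measurable]: "u \<in> borel_measurable borel" "v \<in> borel_measurable borel" using assms by auto
  show "integrable (lborel \<Otimes>\<^sub>M lborel) (\<lambda>(x, y). u x * v y)"
    by (rule lborel_pair.Fubini_integrable) (use assms in \<open>auto simp: abs_mult\<close>)
  show "F \<in> borel_measurable (lborel \<Otimes>\<^sub>M lborel)"
    using assms(1) by (simp add: lborel_prod)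
  show "AE p in lborel \<Otimes>\<^sub>M lborel. norm (F p) \<le> norm (case p of (x, y) \<Rightarrow> u x * v y)"
    using assms(4) by (intro AE_I2) (force intro: order_trans[OF _ abs_ge_self])
qed

lemma integral_swap_bound:
  fixes F :: "'a::euclidean_space \<Rightarrow> 'b::euclidean_space \<Rightarrow> 'c::{banach, second_countable_topology}"
    and u :: "'a \<Rightarrow> real" and v :: "'b \<Rightarrow> real"
  assumes "(\<lambda>p. F (fst p) (snd p)) \<in> borel_measurable borel" "integrable lborel u" "integrable lborel v"
    and "\<And>x y. norm (F x y) \<le> u x * v y"
  shows "(LINT x|lborel. LINT y|lborel. F x y) = (LINT y|lborel. LINT x|lborel. F x y)"
  using lborel_pair.Fubini_integral[of F] integrable_pair_bound[of "\<lambda>p. F (fst p) (snd p)" u v] assms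
  by (simp add: case_prod_beta')

text \<open>Gaussian regularisation: once a Gaussian factor of width 1/e is inserted, the order of
  integration may be changed, and the integral becomes a Gaussian average of \<open>m\<close> at
  scale e around \<xi>. Both forms have a limit as e tends to 0. In (2 pi)^n one factor sqrt(2 pi)^n
  comes from the transform of the Gaussian and one from its mass.\<close>

theorem fourier_inversion:
  fixes m :: "'a::euclidean_space \<Rightarrow> complex"
  defines "K \<equiv> \<lambda>y. LINT x|lborel. cis (y \<bullet> x) * m x"
  assumes cont: "continuous_on UNIV m" and int: "integrable lborel m"
    and M: "\<And>x. cmod (m x) \<le> M" and intK: "integrable lborel K"
  shows "(LINT y|lborel. cis (- (y \<bullet> \<xi>)) * K y) = complex_of_real ((2 * pi) ^ DIM('a)) * m \<xi>"
proof -
  let ?n = "DIM('a)" and ?s = "sqrt (2 * pi)"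
  let ?g = "\<lambda>x::'a. exp (- (norm x)\<^sup>2 / 2)"
  have [measurable]: "m \<in> borel_measurable borel" "K \<in> borel_measurable borel" using int intK by auto
  define e where "e N = 1 / real (Suc N)" for N
  have e: "0 < e N" for N by (simp add: e_def)
  have elim: "e \<longlonglongrightarrow> 0" unfolding e_def using LIMSEQ_Suc[OF lim_1_over_n] by simp
  define I where "I N = (LINT y|lborel. cis (- (y \<bullet> \<xi>)) * K y * complex_of_real (?g (e N *\<^sub>R y)))" for N
  have "I \<longlonglongrightarrow> (LINT y|lborel. cis (- (y \<bullet> \<xi>)) * K y)"
    unfolding I_def
  proof (rule integral_dominated_convergence[where w = "\<lambda>y. cmod (K y)"])
    show "AE y in lborel. (\<lambda>N. cis (- (y \<bullet> \<xi>)) * K y * complex_of_real (?g (e N *\<^sub>R y))) \<longlonglongrightarrow> cis (- (y \<bullet> \<xi>)) * K y"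
    proof (intro AE_I2)
      fix y
      have "(\<lambda>N. cis (- (y \<bullet> \<xi>)) * K y * complex_of_real (?g (e N *\<^sub>R y)))
          \<longlonglongrightarrow> cis (- (y \<bullet> \<xi>)) * K y * complex_of_real (?g (0 *\<^sub>R y))"
        by (intro tendsto_intros elim) auto
      then show "(\<lambda>N. cis (- (y \<bullet> \<xi>)) * K y * complex_of_real (?g (e N *\<^sub>R y))) \<longlonglongrightarrow> cis (- (y \<bullet> \<xi>)) * K y" by simp
    qed
    show "AE y in lborel. norm (cis (- (y \<bullet> \<xi>)) * K y * complex_of_real (?g (e N *\<^sub>R y))) \<le> cmod (K y)" for N
      by (intro AE_I2) (simp add: norm_mult mult_left_le)
  qed (use intK in \<open>auto simp flip: inner_minus_left\<close>)
  moreover have I: "I N = complex_of_real (?s ^ ?n) * (LINT z|lborel. m (\<xi> + e N *\<^sub>R z) * complex_of_real (?g z))" for N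
  proof -
    have ig: "integrable lborel (\<lambda>y::'a. ?g (e N *\<^sub>R y))"
      using integrable_lborel_affine[OF integrable_gaussian, of "e N" "0::'a"] e[of N] by simp
    have inner: "(LINT y|lborel. cis ((\<eta> - \<xi>) \<bullet> y) * complex_of_real (?g (e N *\<^sub>R y)))
        = complex_of_real (?s ^ ?n / e N ^ ?n) * complex_of_real (?g ((\<eta> - \<xi>) /\<^sub>R e N))" for \<eta>
    proof -
      have "(LINT y|lborel. cis ((\<eta> - \<xi>) \<bullet> y) * complex_of_real (?g (e N *\<^sub>R y)))
         = \<bar>1 / e N\<bar> ^ ?n *\<^sub>R (LINT w|lborel. cis ((\<eta> - \<xi>) \<bullet> (0 + (1 / e N) *\<^sub>R w)) * complex_of_real (?g (e N *\<^sub>R (0 + (1 / e N) *\<^sub>R w))))"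
        using e[of N] by (intro integral_lborel_affine) auto
      also have "\<dots> = \<bar>1 / e N\<bar> ^ ?n *\<^sub>R (LINT w|lborel. cis (((\<eta> - \<xi>) /\<^sub>R e N) \<bullet> w) * complex_of_real (?g w))"
      proof -
        have "e N *\<^sub>R (0 + (1 / e N) *\<^sub>R w) = w" "(\<eta> - \<xi>) \<bullet> (0 + (1 / e N) *\<^sub>R w) = ((\<eta> - \<xi>) /\<^sub>R e N) \<bullet> w" for w :: 'a
          using e[of N] by (auto simp: divide_inverse)
        then show ?thesis by (simp only:)
      qed
      also have "\<dots> = \<bar>1 / e N\<bar> ^ ?n *\<^sub>R complex_of_real (?s ^ ?n * ?g ((\<eta> - \<xi>) /\<^sub>R e N))"
        by (subst integral_gaussian(2)) simp
      finally show ?thesis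
        using e[of N] by (simp add: scaleR_conv_of_real power_divide)
    qed
    have "I N = (LINT y|lborel. LINT \<eta>|lborel. cis ((\<eta> - \<xi>) \<bullet> y) * complex_of_real (?g (e N *\<^sub>R y)) * m \<eta>)"
      unfolding I_def K_def
    proof (intro Bochner_Integration.integral_cong refl)
      fix y
      have "cis (- (y \<bullet> \<xi>)) * (LINT x|lborel. cis (y \<bullet> x) * m x) * complex_of_real (?g (e N *\<^sub>R y))
        = (cis (- (y \<bullet> \<xi>)) * complex_of_real (?g (e N *\<^sub>R y))) * (LINT x|lborel. cis (y \<bullet> x) * m x)" by simp
      also have "\<dots> = (LINT x|lborel. (cis (- (y \<bullet> \<xi>)) * complex_of_real (?g (e N *\<^sub>R y))) * (cis (y \<bullet> x) * m x))"
        by (rule integral_mult_right_zero[symmetric])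
      also have "\<dots> = (LINT \<eta>|lborel. cis ((\<eta> - \<xi>) \<bullet> y) * complex_of_real (?g (e N *\<^sub>R y)) * m \<eta>)"
      proof (intro Bochner_Integration.integral_cong refl)
        fix x
        have "(x - \<xi>) \<bullet> y = - (y \<bullet> \<xi>) + y \<bullet> x"
          by (simp add: inner_diff_left inner_commute[of y])
        then have "cis ((x - \<xi>) \<bullet> y) = cis (- (y \<bullet> \<xi>)) * cis (y \<bullet> x)"
          by (simp only: cis_mult)
        then show "(cis (- (y \<bullet> \<xi>)) * complex_of_real (?g (e N *\<^sub>R y))) * (cis (y \<bullet> x) * m x)
           = cis ((x - \<xi>) \<bullet> y) * complex_of_real (?g (e N *\<^sub>R y)) * m x" by simp
      qed
      finally show "cis (- (y \<bullet> \<xi>)) * (LINT x|lborel. cis (y \<bullet> x) * m x) * complex_of_real (?g (e N *\<^sub>R y))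
        = (LINT \<eta>|lborel. cis ((\<eta> - \<xi>) \<bullet> y) * complex_of_real (?g (e N *\<^sub>R y)) * m \<eta>)" .
    qed
    also have "\<dots> = (LINT \<eta>|lborel. LINT y|lborel. cis ((\<eta> - \<xi>) \<bullet> y) * complex_of_real (?g (e N *\<^sub>R y)) * m \<eta>)"
    proof (rule integral_swap_bound)
      show "(\<lambda>p. cis ((snd p - \<xi>) \<bullet> fst p) * complex_of_real (?g (e N *\<^sub>R fst p)) * m (snd p)) \<in> borel_measurable borel"
        unfolding borel_prod[symmetric] by measurable
      show "norm (cis ((\<eta> - \<xi>) \<bullet> y) * complex_of_real (?g (e N *\<^sub>R y)) * m \<eta>) \<le> ?g (e N *\<^sub>R y) * cmod (m \<eta>)" for y \<eta>
        by (simp only: norm_mult norm_cis norm_of_real abs_exp_cancel mult_1_left order_refl)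
    qed (use int ig in \<open>auto intro: integrable_norm\<close>)
    also have "\<dots> = (LINT \<eta>|lborel. complex_of_real (?s ^ ?n / e N ^ ?n) * (complex_of_real (?g ((\<eta> - \<xi>) /\<^sub>R e N)) * m \<eta>))"
      unfolding inner[symmetric] mult.assoc[symmetric] by (simp only: integral_mult_left_zero)
    also have "\<dots> = complex_of_real (?s ^ ?n / e N ^ ?n) * (LINT \<eta>|lborel. complex_of_real (?g ((\<eta> - \<xi>) /\<^sub>R e N)) * m \<eta>)"
      by (rule integral_mult_right_zero)
    also have "(LINT \<eta>|lborel. complex_of_real (?g ((\<eta> - \<xi>) /\<^sub>R e N)) * m \<eta>)
       = \<bar>e N\<bar> ^ ?n *\<^sub>R (LINT z|lborel. complex_of_real (?g (((\<xi> + e N *\<^sub>R z) - \<xi>) /\<^sub>R e N)) * m (\<xi> + e N *\<^sub>R z))"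
      using e[of N] by (intro integral_lborel_affine) auto
    also have "\<dots> = e N ^ ?n *\<^sub>R (LINT z|lborel. m (\<xi> + e N *\<^sub>R z) * complex_of_real (?g z))"
      using e[of N] by (simp add: mult.commute)
    finally show ?thesis using e[of N] by (simp add: scaleR_conv_of_real)
  qed
  moreover have "I \<longlonglongrightarrow> complex_of_real (?s ^ ?n) * (LINT z|lborel. m \<xi> * complex_of_real (?g z))"
    unfolding I
  proof (intro tendsto_mult tendsto_const integral_dominated_convergence[where w = "\<lambda>z. M * ?g z"])
    show "integrable lborel (\<lambda>z::'a. M * ?g z)" using integrable_gaussian by (rule integrable_mult_right)
    show "AE z in lborel. (\<lambda>N. m (\<xi> + e N *\<^sub>R z) * complex_of_real (?g z)) \<longlonglongrightarrow> m \<xi> * complex_of_real (?g z)"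
    proof (intro AE_I2 tendsto_mult tendsto_const)
      fix z
      have "(\<lambda>N. \<xi> + e N *\<^sub>R z) \<longlonglongrightarrow> \<xi> + 0 *\<^sub>R z" by (intro tendsto_intros elim)
      then show "(\<lambda>N. m (\<xi> + e N *\<^sub>R z)) \<longlonglongrightarrow> m \<xi>"
        using continuous_on_tendsto_compose[OF cont, of _ \<xi>] by simp
    qed
    show "AE z in lborel. norm (m (\<xi> + e N *\<^sub>R z) * complex_of_real (?g z)) \<le> M * ?g z" for N
      using M by (intro AE_I2) (simp add: norm_mult)
  qed auto
  moreover have "(LINT z|lborel. m \<xi> * complex_of_real (?g z)) = m \<xi> * complex_of_real (?s ^ ?n)"
    using integral_gaussian(2)[of "0::'a"] by simp
  ultimately have "(LINT y|lborel. cis (- (y \<bullet> \<xi>)) * K y) = complex_of_real (?s ^ ?n) * (m \<xi> * complex_of_real (?s ^ ?n))"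
    using LIMSEQ_unique by metis
  also have "\<dots> = complex_of_real ((?s * ?s) ^ ?n) * m \<xi>"
    by (simp only: power_mult_distrib of_real_mult ac_simps)
  finally show ?thesis by simp
qed


section \<open>Kernels and Peetre's maximal function\<close>

lemma integrable_dominated:
  fixes f :: "'a \<Rightarrow> 'b::{banach, second_countable_topology}" and g :: "'a \<Rightarrow> real"
  assumes "integrable M g" "f \<in> borel_measurable M" "\<And>x. norm (f x) \<le> g x"
  shows "integrable M f"
proof (rule Bochner_Integration.integrable_bound[OF assms(1,2)], rule AE_I2)
  fix x
  show "norm (f x) \<le> norm (g x)" using assms(3)[of x] by simp
qed

text \<open>All that is used of the kernel of a multiplier: weighted integrability bounds
  convolutions by Peetre functions, the weighted continuity of translations gives large values on
  whole balls, and the transforms in both directions represent and invert the Littlewood-Paley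
  pieces.\<close>

lemma schwartz_kernel:
  fixes m :: "real^'n::finite \<Rightarrow> complex"
  assumes m: "smooth m" and supp: "\<And>x. R < norm x \<Longrightarrow> m x = 0"
  obtains K :: "real^'n \<Rightarrow> complex"
  where "continuous_on UNIV K"
    and "\<And>A. integrable lborel (\<lambda>y. cmod (K y) * (1 + norm y) ^ A)"
    and "\<And>\<xi>. (LINT y|lborel. cis (- (y \<bullet> \<xi>)) * K y) = m \<xi>"
    and "\<And>A e. 0 < e \<Longrightarrow> \<exists>d>0. \<forall>s. norm s < d \<longrightarrow>
      integrable lborel (\<lambda>y. cmod (K y - K (y + s)) * (1 + norm y) ^ A) \<and>
      (LINT y|lborel. cmod (K y - K (y + s)) * (1 + norm y) ^ A) \<le> e"
    and "\<And>y. (LINT x|lborel. cis (y \<bullet> x) * m x) = complex_of_real ((2 * pi) ^ CARD('n)) * K y"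
proof -
  let ?c = "complex_of_real ((2 * pi) ^ CARD('n))"
  define K0 where "K0 y = (LINT x|lborel. cis (y \<bullet> x) * m x)" for y
  define K where "K y = K0 y / ?c" for y
  have cm: "continuous_on UNIV m" by (rule smooth_continuous[OF m])
  have im: "integrable lborel m" by (rule integrable_bounded_support[OF cm supp])
  have cK0: "continuous_on UNIV K0" unfolding K0_def by (rule cmult.continuous_integral_cis[OF im])
  then have cK: "continuous_on UNIV K" unfolding K_def by (intro continuous_intros) auto
  then have [measurable]: "K \<in> borel_measurable borel" by (rule borel_measurable_continuous_onI)
  have decay: "\<exists>C\<ge>0. \<forall>y. cmod (K y) * (1 + norm y) ^ L \<le> C" for L
  proof -
    have "\<exists>C\<ge>0. \<forall>y. (1 + norm y) ^ L * cmod (K0 y) \<le> C"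
      unfolding K0_def using m supp by (rule cmult.integral_cis_decay)
    then obtain C where "0 \<le> C" and C: "\<And>y. (1 + norm y) ^ L * cmod (K0 y) \<le> C" by metis
    have "cmod (K y) * (1 + norm y) ^ L \<le> C / (2 * pi) ^ CARD('n)" for y
    proof -
      have "cmod (K y) = cmod (K0 y) / (2 * pi) ^ CARD('n)"
        unfolding K_def norm_divide norm_of_real by simp
      then have "cmod (K y) * (1 + norm y) ^ L = (1 + norm y) ^ L * cmod (K0 y) / (2 * pi) ^ CARD('n)"
        by (metis times_divide_eq_left mult.commute)
      also have "\<dots> \<le> C / (2 * pi) ^ CARD('n)"
        by (intro divide_right_mono C) simp
      finally show ?thesis .
    qed
    then show ?thesis using \<open>0 \<le> C\<close> by (intro exI[of _ "C / (2 * pi) ^ CARD('n)"] conjI allI) auto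
  qed
  \<comment> \<open>A shift by at most 1 is built in, through 1 + |y| <= 2 (1 + |y + s|). The result
    is one integrable majorant for all small translations.\<close>
  have bound: "\<exists>C\<ge>0. \<forall>y s. norm s \<le> 1 \<longrightarrow> cmod (K (y + s)) * (1 + norm y) ^ A \<le> C * (1 / (1 + norm y) ^ (2 * DIM(real^'n)))" for A
  proof -
    let ?L = "A + 2 * DIM(real^'n)"
    obtain C where C: "0 \<le> C" "\<And>y. cmod (K y) * (1 + norm y) ^ ?L \<le> C" using decay[of ?L] by blast
    have "cmod (K (y + s)) * (1 + norm y) ^ A \<le> 2 ^ ?L * C * (1 / (1 + norm y) ^ (2 * DIM(real^'n)))"
      if "norm s \<le> 1" for y s
    proof -
      have "norm y \<le> norm (y + s) + norm s" using norm_triangle_ineq4[of "y + s" s] by simp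
      then have "1 + norm y \<le> 2 * (1 + norm (y + s))" using that norm_ge_zero[of "y + s"]
        unfolding distrib_left by linarith
      then have "(1 + norm y) ^ ?L \<le> (2 * (1 + norm (y + s))) ^ ?L" by (intro power_mono) auto
      then have "cmod (K (y + s)) * (1 + norm y) ^ ?L \<le> cmod (K (y + s)) * (2 * (1 + norm (y + s))) ^ ?L"
        by (rule mult_left_mono) simp
      also have "\<dots> = 2 ^ ?L * (cmod (K (y + s)) * (1 + norm (y + s)) ^ ?L)"
        by (simp only: power_mult_distrib ac_simps)
      also have "\<dots> \<le> 2 ^ ?L * C" using C by (intro mult_left_mono) auto
      finally have "cmod (K (y + s)) * (1 + norm y) ^ A * (1 + norm y) ^ (2 * DIM(real^'n)) \<le> 2 ^ ?L * C"
        by (simp add: power_add mult.assoc)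
      moreover have "0 < (1 + norm y) ^ (2 * DIM(real^'n))" by (intro zero_less_power add_pos_nonneg) auto
      ultimately show ?thesis by (simp only: pos_le_divide_eq[symmetric] times_divide_eq_right mult_1_right)
    qed
    then show ?thesis using C by (intro exI[of _ "2 ^ ?L * C"]) auto
  qed
  have int: "integrable lborel (\<lambda>y. cmod (K (y + s)) * (1 + norm y) ^ A)" if s1: "norm s \<le> 1" for s A
  proof -
    obtain C where C: "\<And>y. cmod (K (y + s)) * (1 + norm y) ^ A \<le> C * (1 / (1 + norm y) ^ (2 * DIM(real^'n)))"
      using bound[of A] s1 by blast
    show ?thesis
      by (rule integrable_dominated[OF integrable_mult_right[OF integrable_inverse_norm_power, of C]])
        (use C in auto)
  qed
  have intK: "integrable lborel K"
    using int[of 0 0] by (simp add: integrable_norm_iff)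
  show thesis
  proof (rule that[of K])
    show "integrable lborel (\<lambda>y. cmod (K y) * (1 + norm y) ^ A)" for A using int[of 0 A] by simp
    show "(LINT x|lborel. cis (y \<bullet> x) * m x) = ?c * K y" for y by (simp add: K_def K0_def)
    obtain M where "\<And>x. cmod (m x) \<le> M" using bounded_of_bounded_support[OF cm supp] by blast
    moreover have K0: "K0 = (\<lambda>y. ?c * K y)" by (auto simp: K_def)
    ultimately have inv: "(LINT y|lborel. cis (- (y \<bullet> \<xi>)) * K0 y) = ?c * m \<xi>" for \<xi>
      using fourier_inversion[OF cm im, of M \<xi>] intK unfolding K0_def[symmetric] by simp
    show "(LINT y|lborel. cis (- (y \<bullet> \<xi>)) * K y) = m \<xi>" for \<xi>
    proof -
      have "?c * (LINT y|lborel. cis (- (y \<bullet> \<xi>)) * K y) = (LINT y|lborel. ?c * (cis (- (y \<bullet> \<xi>)) * K y))"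
        by (rule integral_mult_right_zero[symmetric])
      also have "\<dots> = ?c * m \<xi>" using inv[of \<xi>] unfolding K0 by (simp only: ac_simps)
      finally show ?thesis by simp
    qed
    show "\<exists>d>0. \<forall>s. norm s < d \<longrightarrow> integrable lborel (\<lambda>y. cmod (K y - K (y + s)) * (1 + norm y) ^ A) \<and>
      (LINT y|lborel. cmod (K y - K (y + s)) * (1 + norm y) ^ A) \<le> e" if "0 < e" for A e
    proof (rule ccontr)
      let ?q = "\<lambda>s y. cmod (K y - K (y + s)) * (1 + norm y) ^ A"
      obtain C where C: "\<And>y s. norm s \<le> 1 \<Longrightarrow> cmod (K (y + s)) * (1 + norm y) ^ A \<le> C * (1 / (1 + norm y) ^ (2 * DIM(real^'n)))"
        using bound[of A] by blast
      define w where "w y = 2 * C * (1 / (1 + norm y) ^ (2 * DIM(real^'n)))" for y :: "real^'n"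
      have w: "integrable lborel w" unfolding w_def by (intro integrable_mult_right integrable_inverse_norm_power)
      have qw: "?q s y \<le> w y" if "norm s \<le> 1" for s y
      proof -
        have "?q s y \<le> (cmod (K y) + cmod (K (y + s))) * (1 + norm y) ^ A"
          by (intro mult_right_mono norm_triangle_ineq4) auto
        also have "\<dots> \<le> w y" using C[of 0 y] C[OF that, of y] by (simp add: w_def distrib_right)
        finally show ?thesis .
      qed
      have iq: "integrable lborel (?q s)" if "norm s \<le> 1" for s
      proof (rule integrable_dominated[OF w])
        show "norm (?q s y) \<le> w y" for y using qw[OF that, of y] by simp
      qed measurable
      \<comment> \<open>Otherwise there are shifts tending to 0 that keep the integrals above
        \<open>e\<close>, against dominated convergence and the continuity of
        \<open>K\<close>.\<close>
      assume neg: "\<not> ?thesis"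
      have "\<exists>s. norm s < 1 / real (Suc N) \<and> e < (LINT y|lborel. ?q s y)" for N
      proof -
        obtain s where s: "norm s < 1 / real (Suc N)" "\<not> (integrable lborel (?q s) \<and> (LINT y|lborel. ?q s y) \<le> e)"
        proof -
          have "0 < 1 / real (Suc N)" by simp
          with neg have "\<not> (\<forall>s. norm s < 1 / real (Suc N) \<longrightarrow> integrable lborel (?q s) \<and> (LINT y|lborel. ?q s y) \<le> e)"
            by blast
          then show ?thesis using that by blast
        qed
        moreover have "1 / real (Suc N) \<le> 1" by simp
        ultimately have "norm s \<le> 1" by linarith
        then show ?thesis using s iq by force
      qed
      then have "\<forall>N. \<exists>s. norm s < 1 / real (Suc N) \<and> e < (LINT y|lborel. ?q s y)" by (rule allI)
      from choice[OF this] obtain s where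
        s: "\<And>N. norm (s N) < 1 / real (Suc N)" "\<And>N. e < (LINT y|lborel. ?q (s N) y)" by blast
      have s1: "norm (s N) \<le> 1" for N
      proof -
        have "1 / real (Suc N) \<le> 1" by simp
        then show ?thesis using s(1)[of N] by linarith
      qed
      have s0: "s \<longlonglongrightarrow> 0"
      proof (rule Lim_null_comparison)
        show "\<forall>\<^sub>F N in sequentially. norm (s N) \<le> 1 / real (Suc N)"
          using s(1) by (intro always_eventually allI less_imp_le)
        show "(\<lambda>N. 1 / real (Suc N)) \<longlonglongrightarrow> 0" by (rule LIMSEQ_Suc[OF lim_1_over_n])
      qed
      have "(\<lambda>N. LINT y|lborel. ?q (s N) y) \<longlonglongrightarrow> (LINT y|(lborel :: (real^'n) measure). (0::real))"
      proof (rule integral_dominated_convergence[OF _ _ w])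
        show "AE y in lborel. (\<lambda>N. ?q (s N) y) \<longlonglongrightarrow> 0"
        proof (intro AE_I2)
          fix y
          have "(\<lambda>N. y + s N) \<longlonglongrightarrow> y + 0" by (intro tendsto_intros s0)
          then have "(\<lambda>N. K (y + s N)) \<longlonglongrightarrow> K y"
            using continuous_on_tendsto_compose[OF cK, of _ y] by simp
          then have "(\<lambda>N. ?q (s N) y) \<longlonglongrightarrow> cmod (K y - K y) * (1 + norm y) ^ A" by (intro tendsto_intros)
          then show "(\<lambda>N. ?q (s N) y) \<longlonglongrightarrow> 0" by simp
        qed
        show "AE y in lborel. norm (?q (s N) y) \<le> w y" for N
          using qw[OF s1] by (intro AE_I2) simp
      qed auto
      then have "0 \<ge> e"
        using s(2) by (intro LIMSEQ_le_const[of "\<lambda>N. LINT y|lborel. ?q (s N) y"]) (auto intro: less_imp_le)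
      then show False using that by simp
    qed
  qed (rule cK)
qed

text \<open>Peetre's maximal function with \<open>y\<close> measured in units of the wavelength
  \<open>\<tau>\<close>, so that one kernel serves all dyadic levels. The real supremum is
  meaningful for bounded \<open>f\<close>.\<close>

definition peetre_max :: "nat \<Rightarrow> real \<Rightarrow> ('a::real_normed_vector \<Rightarrow> 'c::real_normed_vector) \<Rightarrow> 'a \<Rightarrow> real" where
  "peetre_max A \<tau> f x = (SUP y. norm (f (x - \<tau> *\<^sub>R y)) / (1 + norm y) ^ A)"

lemma bdd_above_peetre_max:
  fixes f :: "'a::real_normed_vector \<Rightarrow> 'c::real_normed_vector"
  assumes "bounded (range f)"
  shows "bdd_above (range (\<lambda>y. norm (f (x - \<tau> *\<^sub>R y)) / (1 + norm y) ^ A))"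
proof -
  obtain M where M: "\<And>x. norm (f x) \<le> M" using assms by (auto simp: bounded_iff)
  show ?thesis
  proof (rule bdd_aboveI2)
    fix y :: 'a
    have "1 \<le> (1 + norm y) ^ A" by (intro one_le_power) simp
    then have "norm (f (x - \<tau> *\<^sub>R y)) / (1 + norm y) ^ A \<le> norm (f (x - \<tau> *\<^sub>R y)) / 1"
      by (intro divide_left_mono) (auto simp: add_pos_nonneg)
    then show "norm (f (x - \<tau> *\<^sub>R y)) / (1 + norm y) ^ A \<le> M" using M[of "x - \<tau> *\<^sub>R y"] by simp
  qed
qed

lemma peetre_max_upper:
  assumes "bounded (range f)"
  shows "norm (f (x - \<tau> *\<^sub>R y)) \<le> peetre_max A \<tau> f x * (1 + norm y) ^ A"
proof -
  have "norm (f (x - \<tau> *\<^sub>R y)) / (1 + norm y) ^ A \<le> peetre_max A \<tau> f x"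
    unfolding peetre_max_def by (intro cSUP_upper bdd_above_peetre_max assms) simp
  moreover have "0 < (1 + norm y) ^ A" by (intro zero_less_power add_pos_nonneg) auto
  ultimately show ?thesis by (simp add: divide_le_eq)
qed

lemma norm_le_peetre_max: "bounded (range f) \<Longrightarrow> norm (f x) \<le> peetre_max A \<tau> f x"
  using peetre_max_upper[of f x \<tau> 0 A] by simp

lemma peetre_max_nonneg: "bounded (range f) \<Longrightarrow> 0 \<le> peetre_max A \<tau> f x"
  using norm_le_peetre_max[of f x A \<tau>] norm_ge_zero order_trans by blast

context complex_scaling
begin

text \<open>A multiplier that is the transform of \<open>K\<close>, dilated by
  \<open>\<tau>\<close>, acts as convolution with \<open>K\<close> at scale \<open>\<tau>\<close>:
  after Fubini the two exponentials combine to the one of the translated point.\<close>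

lemma integral_multiplier_shift:
  fixes g :: "'a::euclidean_space \<Rightarrow> 'c" and K :: "'a \<Rightarrow> complex"
  assumes g: "integrable lborel g" and K: "integrable lborel K"
  shows "(LINT \<xi>|lborel. h (cis (x \<bullet> \<xi>)) (h (LINT y|lborel. cis (- (y \<bullet> (\<tau> *\<^sub>R \<xi>))) * K y) (g \<xi>)))
    = (LINT y|lborel. h (K y) (LINT \<xi>|lborel. h (cis ((x - \<tau> *\<^sub>R y) \<bullet> \<xi>)) (g \<xi>)))"
proof -
  have [measurable]: "g \<in> borel_measurable borel" "K \<in> borel_measurable borel" using assms by auto
  let ?F = "\<lambda>\<xi> y. h (cis ((x - \<tau> *\<^sub>R y) \<bullet> \<xi>) * K y) (g \<xi>)"
  have "(LINT \<xi>|lborel. h (cis (x \<bullet> \<xi>)) (h (LINT y|lborel. cis (- (y \<bullet> (\<tau> *\<^sub>R \<xi>))) * K y) (g \<xi>)))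
    = (LINT \<xi>|lborel. LINT y|lborel. ?F \<xi> y)"
  proof (intro Bochner_Integration.integral_cong refl)
    fix \<xi>
    have i: "integrable lborel (\<lambda>y. cis (- (y \<bullet> (\<tau> *\<^sub>R \<xi>))) * K y)"
      using cmult.integrable_cis[OF K, of "- (\<tau> *\<^sub>R \<xi>)"] by (simp add: inner_commute)
    have bl: "bounded_linear (\<lambda>z. h (cis (x \<bullet> \<xi>)) (h z (g \<xi>)))"
      by (rule bounded_linear_compose[OF bounded_linear_right bounded_linear_left])
    have "h (cis (x \<bullet> \<xi>)) (h (LINT y|lborel. cis (- (y \<bullet> (\<tau> *\<^sub>R \<xi>))) * K y) (g \<xi>))
      = (LINT y|lborel. h (cis (x \<bullet> \<xi>)) (h (cis (- (y \<bullet> (\<tau> *\<^sub>R \<xi>))) * K y) (g \<xi>)))"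
      by (rule integral_bounded_linear[OF bl i, symmetric])
    also have "\<dots> = (LINT y|lborel. ?F \<xi> y)"
      by (intro Bochner_Integration.integral_cong refl)
        (simp add: h_mult[symmetric] mult.assoc[symmetric] cis_mult inner_diff_left)
    finally show "h (cis (x \<bullet> \<xi>)) (h (LINT y|lborel. cis (- (y \<bullet> (\<tau> *\<^sub>R \<xi>))) * K y) (g \<xi>)) = (LINT y|lborel. ?F \<xi> y)" .
  qed
  also have "\<dots> = (LINT y|lborel. LINT \<xi>|lborel. ?F \<xi> y)"
  proof (rule integral_swap_bound)
    show "(\<lambda>p. ?F (fst p) (snd p)) \<in> borel_measurable borel" unfolding borel_prod[symmetric] by measurable
    show "norm (?F \<xi> y) \<le> norm (g \<xi>) * cmod (K y)" for \<xi> y by (simp add: norm_h norm_mult)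
  qed (use assms in \<open>auto intro: integrable_norm\<close>)
  also have "\<dots> = (LINT y|lborel. h (K y) (LINT \<xi>|lborel. h (cis ((x - \<tau> *\<^sub>R y) \<bullet> \<xi>)) (g \<xi>)))"
    by (intro Bochner_Integration.integral_cong refl)
      (simp add: h_mult mult.commute[of "cis _"] integral_h integrable_cis g)
  finally show ?thesis .
qed

text \<open>The values of \<open>f\<close> are replaced by the Peetre function at the single point
  \<open>z\<close>; the polynomial growth this allows is charged to the kernel.\<close>

lemma norm_integral_shift_le:
  fixes f :: "'a::euclidean_space \<Rightarrow> 'c"
  assumes [measurable]: "K \<in> borel_measurable borel" "f \<in> borel_measurable borel"
    and f: "bounded (range f)"
    and K: "integrable lborel (\<lambda>y. cmod (K y) * (1 + norm y) ^ A)"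
  shows "norm (LINT y|lborel. h (K y) (f (z - \<tau> *\<^sub>R y)))
    \<le> (LINT y|lborel. cmod (K y) * (1 + norm y) ^ A) * peetre_max A \<tau> f z"
    and "integrable lborel (\<lambda>y. h (K y) (f (z - \<tau> *\<^sub>R y)))"
proof -
  have le: "norm (h (K y) (f (z - \<tau> *\<^sub>R y))) \<le> cmod (K y) * (1 + norm y) ^ A * peetre_max A \<tau> f z" for y
    unfolding norm_h using mult_left_mono[OF peetre_max_upper[OF f, of z \<tau> y A], of "cmod (K y)"] by (simp add: ac_simps)
  show int: "integrable lborel (\<lambda>y. h (K y) (f (z - \<tau> *\<^sub>R y)))"
    by (rule integrable_dominated[OF integrable_mult_left[OF K, of "peetre_max A \<tau> f z"]]) (use le in auto)
  have "norm (LINT y|lborel. h (K y) (f (z - \<tau> *\<^sub>R y))) \<le> (LINT y|lborel. norm (h (K y) (f (z - \<tau> *\<^sub>R y))))"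
    by (rule integral_norm_bound)
  also have "\<dots> \<le> (LINT y|lborel. cmod (K y) * (1 + norm y) ^ A * peetre_max A \<tau> f z)"
    using le K int by (intro integral_mono) (auto intro: integrable_norm)
  finally show "norm (LINT y|lborel. h (K y) (f (z - \<tau> *\<^sub>R y)))
    \<le> (LINT y|lborel. cmod (K y) * (1 + norm y) ^ A) * peetre_max A \<tau> f z" by simp
qed

text \<open>
  A function reproduced by a smooth kernel varies by at most a quarter of its Peetre maximal
  function on a small ball, hence it is large on the whole ball around an almost extremal point.
\<close>

lemma peetre_max_large_ball:
  fixes f :: "'a::euclidean_space \<Rightarrow> 'c"
  assumes K: "continuous_on UNIV K" "\<And>A. integrable lborel (\<lambda>y. cmod (K y) * (1 + norm y) ^ A)"
    and d: "\<And>s. norm s < d \<Longrightarrow> integrable lborel (\<lambda>y. cmod (K y - K (y + s)) * (1 + norm y) ^ A) \<and>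
      (LINT y|lborel. cmod (K y - K (y + s)) * (1 + norm y) ^ A) \<le> 1 / 4"
    and "0 < \<tau>" and f: "bounded (range f)" and [measurable]: "f \<in> borel_measurable borel"
    and repr: "\<And>x. f x = (LINT y|lborel. h (K y) (f (x - \<tau> *\<^sub>R y)))"
  shows "\<exists>z. \<forall>w\<in>ball z (d * \<tau>). peetre_max A \<tau> f x * (1 + dist x z / \<tau>) ^ A \<le> 2 * norm (f w)"
proof (cases "peetre_max A \<tau> f x = 0")
  case True
  then show ?thesis by auto
next
  case False
  define S where "S = peetre_max A \<tau> f x"
  have S: "0 < S" using False peetre_max_nonneg[OF f, of A \<tau> x] by (simp add: S_def)
  have [measurable]: "K \<in> borel_measurable borel" using K(1) by (rule borel_measurable_continuous_onI)
  \<comment> \<open>A point where 3/4 of the supremum is exceeded. A variation by at most 1/4 in its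
    neighbourhood leaves one half, hence the factor 2 in the claim.\<close>
  have "(3 / 4) * S < (SUP y. norm (f (x - \<tau> *\<^sub>R y)) / (1 + norm y) ^ A)"
    using S by (simp add: S_def peetre_max_def)
  then obtain t where "t \<in> range (\<lambda>y. norm (f (x - \<tau> *\<^sub>R y)) / (1 + norm y) ^ A)" "(3 / 4) * S < t"
    by (rule less_cSupE) blast+
  then obtain y where y: "(3 / 4) * S < norm (f (x - \<tau> *\<^sub>R y)) / (1 + norm y) ^ A" by blast
  define z where "z = x - \<tau> *\<^sub>R y"
  let ?Y = "(1 + norm y) ^ A"
  have Y: "0 < ?Y" by (intro zero_less_power add_pos_nonneg) auto
  have fz: "(3 / 4) * S * ?Y < norm (f z)" using y Y by (simp add: z_def less_divide_eq)
  have dist: "dist x z / \<tau> = norm y" using \<open>0 < \<tau>\<close> by (simp add: z_def dist_norm)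
  have "S * ?Y \<le> 2 * norm (f w)" if w: "w \<in> ball z (d * \<tau>)" for w
  proof -
    define s where "s = (w - z) /\<^sub>R \<tau>"
    have ws: "w = z + \<tau> *\<^sub>R s" using \<open>0 < \<tau>\<close> by (simp add: s_def)
    have "norm s = norm (w - z) / \<tau>" using \<open>0 < \<tau>\<close> by (simp add: s_def divide_inverse mult.commute)
    then have s: "norm s < d" using w \<open>0 < \<tau>\<close> by (simp add: dist_norm norm_minus_commute divide_less_eq)
    note ds = d[OF s]
    have "f w = (LINT t|lborel. h (K t) (f (w - \<tau> *\<^sub>R t)))" by (rule repr)
    \<comment> \<open>The translation from \<open>z\<close> to \<open>w\<close> is moved from
      \<open>f\<close> to the kernel.\<close>
    also have "\<dots> = (LINT t|lborel. h (K (s + 1 *\<^sub>R t)) (f (w - \<tau> *\<^sub>R (s + 1 *\<^sub>R t))))"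
      by (subst integral_lborel_affine[of _ 1 s]) auto
    also have "\<dots> = (LINT t|lborel. h (K (t + s)) (f (z - \<tau> *\<^sub>R t)))"
      by (simp add: ws scaleR_add_right add.commute algebra_simps)
    finally have fw: "f w = (LINT t|lborel. h (K (t + s)) (f (z - \<tau> *\<^sub>R t)))" .
    have i1: "integrable lborel (\<lambda>t. h (K t) (f (z - \<tau> *\<^sub>R t)))"
      by (rule norm_integral_shift_le(2)[OF _ _ f K(2)]) auto
    have i3: "integrable lborel (\<lambda>t. h (K t - K (t + s)) (f (z - \<tau> *\<^sub>R t)))"
      by (rule norm_integral_shift_le(2)[where A=A, OF _ _ f]) (use ds in auto)
    have "(\<lambda>t. h (K (t + s)) (f (z - \<tau> *\<^sub>R t))) = (\<lambda>t. h (K t) (f (z - \<tau> *\<^sub>R t)) - h (K t - K (t + s)) (f (z - \<tau> *\<^sub>R t)))"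
      by (simp add: diff_left)
    then have "f w = (LINT t|lborel. h (K t) (f (z - \<tau> *\<^sub>R t))) - (LINT t|lborel. h (K t - K (t + s)) (f (z - \<tau> *\<^sub>R t)))"
      unfolding fw using i1 i3 by simp
    then have "norm (f z - f w) = norm (LINT t|lborel. h (K t - K (t + s)) (f (z - \<tau> *\<^sub>R t)))"
      using repr[of z] by simp
    also have "\<dots> \<le> (LINT t|lborel. cmod (K t - K (t + s)) * (1 + norm t) ^ A) * peetre_max A \<tau> f z"
      by (rule norm_integral_shift_le(1)[OF _ _ f]) (use ds in auto)
    also have "\<dots> \<le> 1 / 4 * (S * ?Y)"
    proof (intro mult_mono)
      \<comment> \<open>The weight is submultiplicative, so that passing from \<open>x\<close> to
        \<open>z\<close> costs just the factor \<open>?Y\<close>, which the lower bound for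
        \<open>f z\<close> contains as well.\<close>
      show "peetre_max A \<tau> f z \<le> S * ?Y"
        unfolding peetre_max_def
      proof (rule cSUP_least)
        fix t
        have "norm (f (z - \<tau> *\<^sub>R t)) \<le> S * (1 + norm (y + t)) ^ A"
          using peetre_max_upper[OF f, of x \<tau> "y + t" A] by (simp add: z_def S_def algebra_simps)
        also have "\<dots> \<le> S * ((1 + norm y) * (1 + norm t)) ^ A"
        proof (intro mult_left_mono power_mono)
          have "0 \<le> norm y * norm t" by simp
          then show "1 + norm (y + t) \<le> (1 + norm y) * (1 + norm t)"
            using norm_triangle_ineq[of y t] by (simp only: ring_distribs mult_1_left mult_1_right)
        qed (use S in auto)
        finally have "norm (f (z - \<tau> *\<^sub>R t)) \<le> S * ?Y * (1 + norm t) ^ A" by (simp add: power_mult_distrib mult.assoc)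
        moreover have "0 < (1 + norm t) ^ A" by (intro zero_less_power add_pos_nonneg) auto
        ultimately show "norm (f (z - \<tau> *\<^sub>R t)) / (1 + norm t) ^ A \<le> S * ?Y" by (simp add: divide_le_eq)
      qed simp
    qed (use ds peetre_max_nonneg[OF f] in auto)
    finally have "norm (f z) \<le> norm (f w) + 1 / 4 * (S * ?Y)"
      using norm_triangle_sub[of "f z" "f w"] by linarith
    then show ?thesis using fz by linarith
  qed
  then show ?thesis unfolding S_def[symmetric] by (intro exI[of _ z]) (simp add: dist)
qed

text \<open>\<open>f\<close> is the convolution of \<open>u\<close> with \<open>c K\<close>. That
  makes it integrable, although it is given only as an inverse transform, and Fubini then computes
  its transform.\<close>

lemma integral_convolution:
  fixes u :: "'a::euclidean_space \<Rightarrow> 'c" and m K :: "'a \<Rightarrow> complex"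
  assumes u: "integrable lborel u" and m: "integrable lborel m" and K: "integrable lborel K"
    and mK: "\<And>y. (LINT x|lborel. cis (y \<bullet> x) * m x) = c * K y"
    and Km: "\<And>\<xi>. (LINT y|lborel. cis (- (y \<bullet> \<xi>)) * K y) = m \<xi>"
  defines "v \<equiv> \<lambda>\<xi>. LINT y|lborel. h (cis (- (y \<bullet> \<xi>))) (u y)"
  defines "f \<equiv> \<lambda>x. LINT \<xi>|lborel. h (cis (x \<bullet> \<xi>)) (h (m \<xi>) (v \<xi>))"
  shows "integrable lborel f"
    and "(LINT x|lborel. h (cis (- (x \<bullet> \<xi>))) (f x)) = h (c * m \<xi>) (v \<xi>)"
proof -
  have [measurable]: "u \<in> borel_measurable borel" "m \<in> borel_measurable borel" "K \<in> borel_measurable borel"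
    using assms by auto
  have f: "f x = (LINT y|lborel. h (c * K (x - y)) (u y))" for x
  proof -
    have "f x = (LINT \<xi>|lborel. LINT y|lborel. h (cis ((x - y) \<bullet> \<xi>) * m \<xi>) (u y))"
      unfolding f_def
    proof (intro Bochner_Integration.integral_cong refl)
      fix \<xi>
      have "integrable lborel (\<lambda>y. h (cis (- (y \<bullet> \<xi>))) (u y))"
        using integrable_cis[OF u, of "- \<xi>"] by (simp add: inner_commute)
      then have "h (cis (x \<bullet> \<xi>) * m \<xi>) (v \<xi>) = (LINT y|lborel. h (cis (x \<bullet> \<xi>) * m \<xi>) (h (cis (- (y \<bullet> \<xi>))) (u y)))"
        unfolding v_def by (rule integral_h[symmetric])
      moreover have "cis ((x - y) \<bullet> \<xi>) = cis (x \<bullet> \<xi>) * cis (- (y \<bullet> \<xi>))" for y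
        by (simp add: cis_mult inner_diff_left)
      ultimately show "h (cis (x \<bullet> \<xi>)) (h (m \<xi>) (v \<xi>)) = (LINT y|lborel. h (cis ((x - y) \<bullet> \<xi>) * m \<xi>) (u y))"
        by (simp only: h_mult[symmetric] ac_simps)
    qed
    also have "\<dots> = (LINT y|lborel. LINT \<xi>|lborel. h (cis ((x - y) \<bullet> \<xi>) * m \<xi>) (u y))"
    proof (rule integral_swap_bound)
      show "(\<lambda>p. h (cis ((x - snd p) \<bullet> fst p) * m (fst p)) (u (snd p))) \<in> borel_measurable borel"
        unfolding borel_prod[symmetric] by measurable
      show "norm (h (cis ((x - y) \<bullet> \<xi>) * m \<xi>) (u y)) \<le> cmod (m \<xi>) * norm (u y)" for \<xi> y
        by (simp add: norm_h norm_mult)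
    qed (use u m in \<open>auto intro: integrable_norm\<close>)
    also have "\<dots> = (LINT y|lborel. h (c * K (x - y)) (u y))"
    proof (intro Bochner_Integration.integral_cong refl)
      fix y
      have "(LINT \<xi>|lborel. h (cis ((x - y) \<bullet> \<xi>) * m \<xi>) (u y)) = h (LINT \<xi>|lborel. cis ((x - y) \<bullet> \<xi>) * m \<xi>) (u y)"
        by (rule integral_bounded_linear[OF bounded_linear_left cmult.integrable_cis[OF m]])
      then show "(LINT \<xi>|lborel. h (cis ((x - y) \<bullet> \<xi>) * m \<xi>) (u y)) = h (c * K (x - y)) (u y)" by (simp add: mK)
    qed
    finally show ?thesis .
  qed
  have shiftK: "integrable lborel (\<lambda>x. K (x - y))" for y
    using integrable_lborel_affine[OF K, of 1 "- y"] by simp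
  have shiftN: "(LINT x|lborel. cmod (K (x - y))) = (LINT x|lborel. cmod (K x))" for y
    using integral_lborel_affine[of "\<lambda>x. cmod (K x)" 1 "- y"] by simp
  \<comment> \<open>Fubini is used twice, with \<open>z\<close> = 1 for the integrability of
    \<open>f\<close> and with the exponential for its transform; both have modulus 1.\<close>
  have pair: "integrable (lborel \<Otimes>\<^sub>M lborel) (\<lambda>(y, x). h (z x * (c * K (x - y))) (u y))"
    if [measurable]: "z \<in> borel_measurable borel" and z: "\<And>x. cmod (z x) = 1" for z :: "'a \<Rightarrow> complex"
  proof (rule lborel_pair.Fubini_integrable)
    show "(\<lambda>(y, x). h (z x * (c * K (x - y))) (u y)) \<in> borel_measurable (lborel \<Otimes>\<^sub>M lborel)"
      by measurable
    have "(\<lambda>y. LINT x|lborel. norm (case (y, x) of (y, x) \<Rightarrow> h (z x * (c * K (x - y))) (u y)))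
      = (\<lambda>y. cmod c * (LINT x|lborel. cmod (K x)) * norm (u y))"
      by (simp add: norm_h norm_mult z shiftN)
    then show "integrable lborel (\<lambda>y. LINT x|lborel. norm (case (y, x) of (y, x) \<Rightarrow> h (z x * (c * K (x - y))) (u y)))"
      using u by (simp only:) (intro integrable_mult_right integrable_norm)
    show "AE y in lborel. integrable lborel (\<lambda>x. case (y, x) of (y, x) \<Rightarrow> h (z x * (c * K (x - y))) (u y))"
    proof (intro AE_I2)
      fix y
      have "integrable lborel (\<lambda>x. cmod c * cmod (K (x - y)) * norm (u y))"
        using shiftK[of y] by (intro integrable_mult_left integrable_mult_right integrable_norm)
      then show "integrable lborel (\<lambda>x. case (y, x) of (y, x) \<Rightarrow> h (z x * (c * K (x - y))) (u y))"
        by (rule Bochner_Integration.integrable_bound) (auto simp: norm_h norm_mult z)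
    qed
  qed
  have "integrable lborel (\<lambda>x. LINT y|lborel. h (1 * (c * K (x - y))) (u y))"
    using lborel_pair.integrable_snd[OF pair[of "\<lambda>_. 1"]] by simp
  then show "integrable lborel f" unfolding f by simp
  have cis: "(\<lambda>x. cis (- (x \<bullet> \<xi>))) \<in> borel_measurable borel"
    unfolding inner_minus_left[symmetric] by measurable
  have "(LINT x|lborel. h (cis (- (x \<bullet> \<xi>))) (f x)) = (LINT x|lborel. LINT y|lborel. h (cis (- (x \<bullet> \<xi>)) * (c * K (x - y))) (u y))"
  proof (intro Bochner_Integration.integral_cong refl)
    fix x
    show "h (cis (- (x \<bullet> \<xi>))) (f x) = (LINT y|lborel. h (cis (- (x \<bullet> \<xi>)) * (c * K (x - y))) (u y))"
    proof (cases "integrable lborel (\<lambda>y. h (c * K (x - y)) (u y))")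
      case True
      then show ?thesis unfolding f h_mult[of "cis _"] by (rule integral_h[symmetric])
    next
      \<comment> \<open>Where the convolution integral fails to converge, both sides are 0 by the
        default value of the integral.\<close>
      case no: False
      have "\<not> integrable lborel (\<lambda>y. h (cis (- (x \<bullet> \<xi>)) * (c * K (x - y))) (u y))"
      proof
        assume "integrable lborel (\<lambda>y. h (cis (- (x \<bullet> \<xi>)) * (c * K (x - y))) (u y))"
        then have "integrable lborel (\<lambda>y. h (c * K (x - y)) (u y))"
          by (rule Bochner_Integration.integrable_bound) (auto simp: norm_h norm_mult)
        with no show False by simp
      qed
      with no show ?thesis unfolding f by (simp add: not_integrable_integral_eq zero_right)
    qed
  qed
  also have "\<dots> = (LINT y|lborel. LINT x|lborel. h (cis (- (x \<bullet> \<xi>)) * (c * K (x - y))) (u y))"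
    using lborel_pair.Fubini_integral[OF pair[OF cis]] by simp
  also have "\<dots> = (LINT y|lborel. h (c * m \<xi>) (h (cis (- (y \<bullet> \<xi>))) (u y)))"
  proof (intro Bochner_Integration.integral_cong refl)
    fix y
    have i: "integrable lborel (\<lambda>x. cis (- (x \<bullet> \<xi>)) * K (x - y))"
      using cmult.integrable_cis[OF shiftK[of y], of "- \<xi>"] by (simp add: inner_commute)
    have "(LINT x|lborel. cis (- (x \<bullet> \<xi>)) * K (x - y)) = (LINT x|lborel. cis (- ((y + 1 *\<^sub>R x) \<bullet> \<xi>)) * K ((y + 1 *\<^sub>R x) - y))"
      by (subst integral_lborel_affine[of _ 1 y]) (use cis in auto)
    also have "\<dots> = (LINT x|lborel. cis (- (y \<bullet> \<xi>)) * (cis (- (x \<bullet> \<xi>)) * K x))"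
    proof (intro Bochner_Integration.integral_cong refl)
      fix x
      have "cis (- ((y + 1 *\<^sub>R x) \<bullet> \<xi>)) = cis (- (y \<bullet> \<xi>)) * cis (- (x \<bullet> \<xi>))"
        by (simp add: cis_mult inner_add_left)
      then show "cis (- ((y + 1 *\<^sub>R x) \<bullet> \<xi>)) * K ((y + 1 *\<^sub>R x) - y) = cis (- (y \<bullet> \<xi>)) * (cis (- (x \<bullet> \<xi>)) * K x)"
        by (simp only: mult.assoc) simp
    qed
    also have "\<dots> = cis (- (y \<bullet> \<xi>)) * m \<xi>" by (simp add: Km)
    finally have e: "(LINT x|lborel. cis (- (x \<bullet> \<xi>)) * K (x - y)) = cis (- (y \<bullet> \<xi>)) * m \<xi>" .
    have bl: "bounded_linear (\<lambda>w. h (c * w) (u y))"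
      by (rule bounded_linear_compose[OF bounded_linear_left bounded_linear_mult_right])
    have "(LINT x|lborel. h (c * (cis (- (x \<bullet> \<xi>)) * K (x - y))) (u y)) = h (c * (cis (- (y \<bullet> \<xi>)) * m \<xi>)) (u y)"
      using integral_bounded_linear[OF bl i] e by simp
    then show "(LINT x|lborel. h (cis (- (x \<bullet> \<xi>)) * (c * K (x - y))) (u y)) = h (c * m \<xi>) (h (cis (- (y \<bullet> \<xi>))) (u y))"
      by (simp add: h_mult[symmetric] ac_simps)
  qed
  also have "\<dots> = h (c * m \<xi>) (v \<xi>)"
    unfolding v_def using integrable_cis[OF u, of "- \<xi>"] by (intro integral_h) (simp add: inner_commute)
  finally show "(LINT x|lborel. h (cis (- (x \<bullet> \<xi>))) (f x)) = h (c * m \<xi>) (v \<xi>)" .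
qed

end


section \<open>Nikolskii's inequality and the Jawerth embedding\<close>

text \<open>By \<open>gf\<close> the reverse transform of \<open>f\<close> returns \<open>r\<close>
  times \<open>g\<close>. Paired with \<open>g\<close>, and with the exponential moved to the other
  side of the inner product, it rebuilds \<open>f\<close>.\<close>

lemma (in complex_scaling) plancherel:
  fixes f g :: "'a::euclidean_space \<Rightarrow> 'c"
  assumes f: "integrable lborel f" and g: "integrable lborel g"
    and fg: "\<And>x. f x = (LINT \<xi>|lborel. h (cis (x \<bullet> \<xi>)) (g \<xi>))"
    and gf: "\<And>\<xi>. (LINT x|lborel. h (cis (- (x \<bullet> \<xi>))) (f x)) = h (complex_of_real r) (g \<xi>)"
  shows "r * (LINT \<xi>|lborel. (norm (g \<xi>))\<^sup>2) = (LINT x|lborel. (norm (f x))\<^sup>2)"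
proof -
  have [measurable]: "f \<in> borel_measurable borel" "g \<in> borel_measurable borel" using assms by auto
  have cis: "(\<lambda>p :: 'a \<times> 'a. cis (- (snd p \<bullet> fst p))) \<in> borel_measurable (borel \<Otimes>\<^sub>M borel)"
    unfolding inner_minus_left[symmetric] by measurable
  have hr: "inner (h (complex_of_real r) u) u = r * (norm u)\<^sup>2" for u
    by (metis h_1 inner_scaleR_left mult.right_neutral of_real_def power2_norm_eq_inner scaleR_left)
  have "r * (LINT \<xi>|lborel. (norm (g \<xi>))\<^sup>2) = (LINT \<xi>|lborel. inner (LINT x|lborel. h (cis (- (x \<bullet> \<xi>))) (f x)) (g \<xi>))"
    unfolding gf hr by simp
  also have "\<dots> = (LINT \<xi>|lborel. LINT x|lborel. inner (h (cis (- (x \<bullet> \<xi>))) (f x)) (g \<xi>))"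
  proof (intro Bochner_Integration.integral_cong refl)
    fix \<xi>
    have "integrable lborel (\<lambda>x. h (cis (- (x \<bullet> \<xi>))) (f x))"
      using integrable_cis[OF f, of "- \<xi>"] by (simp add: inner_commute)
    then show "inner (LINT x|lborel. h (cis (- (x \<bullet> \<xi>))) (f x)) (g \<xi>) = (LINT x|lborel. inner (h (cis (- (x \<bullet> \<xi>))) (f x)) (g \<xi>))"
      by (rule integral_bounded_linear[OF bounded_linear_inner_left, symmetric])
  qed
  also have "\<dots> = (LINT x|lborel. LINT \<xi>|lborel. inner (h (cis (- (x \<bullet> \<xi>))) (f x)) (g \<xi>))"
  proof (rule integral_swap_bound)
    show "(\<lambda>p. inner (h (cis (- (snd p \<bullet> fst p))) (f (snd p))) (g (fst p))) \<in> borel_measurable borel"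
      unfolding borel_prod[symmetric] using cis by measurable
    show "norm (inner (h (cis (- (x \<bullet> \<xi>))) (f x)) (g \<xi>)) \<le> norm (g \<xi>) * norm (f x)" for x \<xi>
      using Cauchy_Schwarz_ineq2[of "h (cis (- (x \<bullet> \<xi>))) (f x)" "g \<xi>"] by (simp add: norm_h mult.commute)
  qed (use f g in \<open>auto intro: integrable_norm\<close>)
  also have "\<dots> = (LINT x|lborel. inner (f x) (f x))"
  proof (intro Bochner_Integration.integral_cong refl)
    fix x
    have "(LINT \<xi>|lborel. inner (h (cis (- (x \<bullet> \<xi>))) (f x)) (g \<xi>)) = (LINT \<xi>|lborel. inner (f x) (h (cis (x \<bullet> \<xi>)) (g \<xi>)))"
      by (simp add: h_adjoint cis_cnj)
    also have "\<dots> = inner (f x) (f x)"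
      by (subst (2) fg) (rule integral_bounded_linear[OF bounded_linear_inner_right integrable_cis[OF g]])
    finally show "(LINT \<xi>|lborel. inner (h (cis (- (x \<bullet> \<xi>))) (f x)) (g \<xi>)) = inner (f x) (f x)" .
  qed
  finally show ?thesis by (simp add: power2_norm_eq_inner)
qed

text \<open>
  The constant \<open>\<rho>\<^sup>n\<close> carries no further factor, so its power \<open>1/p\<close> stays under control as
  \<open>p \<rightarrow> 0\<close>; this uses \<open>4 \<rho> \<le> 2 \<pi> \<rho>\<close>.
\<close>

lemma (in complex_scaling) nikolskii_le_2:
  fixes f g :: "'a::euclidean_space \<Rightarrow> 'c"
  assumes f: "integrable lborel f" and g: "integrable lborel g" and bf: "bounded (range f)" and bg: "bounded (range g)"
    and fg: "\<And>x. f x = (LINT \<xi>|lborel. h (cis (x \<bullet> \<xi>)) (g \<xi>))"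
    and gf: "\<And>\<xi>. (LINT x|lborel. h (cis (- (x \<bullet> \<xi>))) (f x)) = h (complex_of_real ((2 * pi) ^ DIM('a))) (g \<xi>)"
    and supp: "\<And>\<xi>. 2 * \<rho> < norm \<xi> \<Longrightarrow> g \<xi> = 0" and "0 < \<rho>"
    and p: "0 < p" "p \<le> 2"
  shows "ennreal (norm (f x) powr p) \<le> ennreal (\<rho> ^ DIM('a)) * (\<integral>\<^sup>+y. ennreal (norm (f y) powr p) \<partial>lborel)"
proof -
  let ?n = "DIM('a)" and ?r = "(2 * pi) ^ DIM('a)"
  have [measurable]: "f \<in> borel_measurable borel" "g \<in> borel_measurable borel" using assms by auto
  \<comment> \<open>The volume of a cube of side 4 \<rho>, which contains the ball carrying
    \<open>g\<close>; it can be compared with (2 pi)^n factor by factor.\<close>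
  define V where "V = (4 * \<rho>) ^ ?n"
  have V: "0 < V" using \<open>0 < \<rho>\<close> by (simp add: V_def)
  define u :: 'a where "u = (\<Sum>b\<in>Basis. (2 * \<rho>) *\<^sub>R b)"
  have ub: "u \<bullet> b = 2 * \<rho>" if "b \<in> Basis" for b
    unfolding u_def using that by (subst inner_sum_left_Basis) auto
  define Q where "Q = cbox (- u) u"
  have Q: "emeasure lborel Q = ennreal V"
  proof -
    have "(\<Prod>b\<in>Basis. (u - - u) \<bullet> b) = (\<Prod>b\<in>(Basis :: 'a set). 4 * \<rho>)"
      by (intro prod.cong) (auto simp: inner_add_left ub)
    then show ?thesis
      unfolding Q_def using \<open>0 < \<rho>\<close> by (subst emeasure_lborel_cbox) (auto simp: V_def ub)
  qed
  have gQ: "g \<xi> = 0" if \<xi>: "\<xi> \<notin> Q" for \<xi>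
  proof (rule supp)
    obtain b where "b \<in> Basis" "\<bar>\<xi> \<bullet> b\<bar> > 2 * \<rho>" using \<xi> by (force simp: Q_def mem_box ub)
    then show "2 * \<rho> < norm \<xi>" using Basis_le_norm[of b \<xi>] by linarith
  qed
  have sq: "integrable lborel (\<lambda>x. (norm (u x))\<^sup>2)" if u: "integrable lborel u" "bounded (range u)" for u :: "'a \<Rightarrow> 'c"
  proof -
    obtain M where M: "\<And>x. norm (u x) \<le> M" using u by (auto simp: bounded_iff)
    show ?thesis
      by (rule integrable_dominated[OF integrable_mult_right[OF integrable_norm[OF u(1)], of M]])
        (use u M in \<open>auto simp: power2_eq_square intro!: mult_right_mono\<close>)
  qed
  define a where "a = (LINT \<xi>|lborel. norm (g \<xi>))"
  \<comment> \<open>Cauchy-Schwarz for the norm of \<open>g\<close> against the indicator of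
    \<open>Q\<close>, written as the positivity of one square with the optimal coefficient
    a/V.\<close>
  have "0 \<le> (LINT \<xi>|lborel. (norm (g \<xi>) - a / V * indicator Q \<xi>)\<^sup>2)" by (rule Bochner_Integration.integral_nonneg) simp
  also have "\<dots> = (LINT \<xi>|lborel. (norm (g \<xi>))\<^sup>2 - 2 * (a / V) * norm (g \<xi>) + (a / V)\<^sup>2 * indicator Q \<xi>)"
    using gQ by (intro Bochner_Integration.integral_cong refl) (auto simp: indicator_def power2_diff)
  also have "\<dots> = (LINT \<xi>|lborel. (norm (g \<xi>))\<^sup>2) - 2 * (a / V) * a + (a / V)\<^sup>2 * V"
    using sq[OF g bg] g Q V
    by (subst Bochner_Integration.integral_add) (auto simp: a_def measure_def Q_def emeasure_lborel_cbox_eq)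
  finally have "a\<^sup>2 \<le> V * (LINT \<xi>|lborel. (norm (g \<xi>))\<^sup>2)"
    using V by (simp add: power2_eq_square field_simps)
  also have "(LINT \<xi>|lborel. (norm (g \<xi>))\<^sup>2) = (LINT x|lborel. (norm (f x))\<^sup>2) / ?r"
    using plancherel[OF f g fg gf] by (simp add: field_simps)
  finally have a: "a\<^sup>2 \<le> V / ?r * (LINT x|lborel. (norm (f x))\<^sup>2)" by simp
  have Vr: "V / ?r \<le> \<rho> ^ ?n"
  proof -
    have "V / ?r = (4 * \<rho> / (2 * pi)) ^ ?n" by (simp only: V_def power_divide)
    also have "\<dots> \<le> \<rho> ^ ?n"
      using \<open>0 < \<rho>\<close> pi_gt3 by (intro power_mono) (auto simp: field_simps)
    finally show ?thesis .
  qed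
  have fa: "norm (f x) \<le> a" for x
    unfolding a_def fg by (rule norm_integral_cis_le[OF g])
  show ?thesis
  proof (cases "a = 0 \<or> (\<integral>\<^sup>+y. ennreal (norm (f y) powr p) \<partial>lborel) = top")
    case True
    then show ?thesis
      using fa[of x] \<open>0 < \<rho>\<close> by (auto simp: ennreal_mult_top)
  next
    case False
    \<comment> \<open>As |f| never exceeds \<open>a\<close>, |f|^2 is at most a^(2-p) |f|^p.
      Estimating \<open>a\<close> itself instead of the supremum of |f| closes the inequality:
      division by a^(2-p) leaves a^p.\<close>
    have a0: "0 < a" using False fa[of x] norm_ge_zero[of "f x"] by linarith
    have "ennreal (LINT x|lborel. (norm (f x))\<^sup>2) = (\<integral>\<^sup>+x. ennreal ((norm (f x))\<^sup>2) \<partial>lborel)"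
      by (rule nn_integral_eq_integral[OF sq[OF f bf], symmetric]) simp
    also have "\<dots> \<le> (\<integral>\<^sup>+x. ennreal (a powr (2 - p)) * ennreal (norm (f x) powr p) \<partial>lborel)"
    proof (intro nn_integral_mono)
      fix x
      show "ennreal ((norm (f x))\<^sup>2) \<le> ennreal (a powr (2 - p)) * ennreal (norm (f x) powr p)"
      proof (cases "f x = 0")
        case False
        then have "(norm (f x))\<^sup>2 = norm (f x) powr (2 - p) * norm (f x) powr p"
          by (simp flip: powr_add add: powr_numeral)
        also have "\<dots> \<le> a powr (2 - p) * norm (f x) powr p"
          using p fa by (intro mult_right_mono powr_mono2) auto
        finally show ?thesis by (simp flip: ennreal_mult)
      qed simp
    qed
    also have "\<dots> = ennreal (a powr (2 - p)) * (\<integral>\<^sup>+x. ennreal (norm (f x) powr p) \<partial>lborel)"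
      by (rule nn_integral_cmult) simp
    finally have *: "ennreal (LINT x|lborel. (norm (f x))\<^sup>2) \<le> ennreal (a powr (2 - p)) * (\<integral>\<^sup>+x. ennreal (norm (f x) powr p) \<partial>lborel)" .
    obtain I where I: "(\<integral>\<^sup>+x. ennreal (norm (f x) powr p) \<partial>lborel) = ennreal I" "0 \<le> I"
      using False by (cases "\<integral>\<^sup>+x. ennreal (norm (f x) powr p) \<partial>lborel") auto
    have "(LINT x|lborel. (norm (f x))\<^sup>2) \<le> a powr (2 - p) * I"
      using * I by (simp flip: ennreal_mult)
    then have "a\<^sup>2 \<le> \<rho> ^ ?n * (a powr (2 - p) * I)"
      by (rule order_trans[OF a mult_mono[OF Vr]]) (use \<open>0 < \<rho>\<close> in auto)
    then have "a powr p * a powr (2 - p) \<le> (\<rho> ^ ?n * I) * a powr (2 - p)"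
      using a0 by (simp flip: powr_add add: powr_numeral ac_simps)
    then have "a powr p \<le> \<rho> ^ ?n * I" using a0 by simp
    moreover have "norm (f x) powr p \<le> a powr p" using p fa by (intro powr_mono2) auto
    ultimately have "ennreal (norm (f x) powr p) \<le> ennreal (\<rho> ^ ?n * I)" by (intro ennreal_leI) linarith
    then show ?thesis unfolding I(1) using \<open>0 < \<rho>\<close> I(2) by (simp add: ennreal_mult)
  qed
qed

section \<open>Sums over dyadic levels and the embedding\<close>

lemma infsum_ennreal_conv_nn_integral:
  fixes f :: "int \<Rightarrow> ennreal"
  shows "(\<Sum>\<^sub>\<infinity>j\<in>UNIV. f j) = (\<integral>\<^sup>+j. f j \<partial>count_space UNIV)"
proof -
  let ?e = "from_nat_into (UNIV :: int set)"
  have e: "bij_betw ?e UNIV UNIV"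
    by (rule bij_betw_from_nat_into) (auto intro: infinite_UNIV_int)
  have "(\<Sum>\<^sub>\<infinity>j\<in>UNIV. f j) = (\<Sum>\<^sub>\<infinity>i\<in>UNIV. f (?e i))"
    by (rule infsum_reindex_bij_betw[OF e, symmetric])
  also have "\<dots> = (\<Sum>i. f (?e i))"
    by (intro sums_unique has_sum_imp_sums has_sum_infsum nonneg_summable_on_complete) auto
  also have "\<dots> = (\<integral>\<^sup>+i. f (?e i) \<partial>count_space UNIV)"
    by (simp add: nn_integral_count_space_nat)
  also have "\<dots> = (\<integral>\<^sup>+j. f j \<partial>count_space UNIV)"
    by (rule nn_integral_bij_count_space[OF e])
  finally show ?thesis .
qed

lemma nn_integral_powr_int_atMost:
  assumes "0 < c"
  shows "(\<integral>\<^sup>+j. ennreal (2 powr (real_of_int j * c)) * indicator {..J} j \<partial>count_space (UNIV :: int set))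
    = ennreal (2 powr (real_of_int J * c) / (1 - 2 powr - c))"
proof -
  have bij: "bij_betw (\<lambda>i::nat. J - int i) UNIV {..J}"
    by (rule bij_betw_byWitness[where f'="\<lambda>j. nat (J - j)"]) auto
  have c: "2 powr - c < 1" using assms by (intro powr_less_one) auto
  have "(\<integral>\<^sup>+j. ennreal (2 powr (real_of_int j * c)) * indicator {..J} j \<partial>count_space (UNIV :: int set))
      = (\<integral>\<^sup>+j. ennreal (2 powr (real_of_int j * c)) \<partial>count_space {..J})"
    by (simp add: nn_integral_count_space_indicator)
  also have "\<dots> = (\<integral>\<^sup>+i. ennreal (2 powr (real_of_int (J - int i) * c)) \<partial>count_space UNIV)"
    by (rule nn_integral_bij_count_space[OF bij, symmetric])
  also have "\<dots> = (\<Sum>i. ennreal (2 powr (real_of_int J * c) * (2 powr - c) ^ i))"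
    unfolding nn_integral_count_space_nat
    by (intro suminf_cong arg_cong[where f=ennreal])
      (simp add: powr_powr algebra_simps flip: powr_realpow powr_add)
  also have "\<dots> = ennreal (\<Sum>i. 2 powr (real_of_int J * c) * (2 powr - c) ^ i)"
    using c by (intro suminf_ennreal2 summable_mult summable_geometric) auto
  also have "(\<Sum>i. 2 powr (real_of_int J * c) * (2 powr - c) ^ i) = 2 powr (real_of_int J * c) / (1 - 2 powr - c)"
    using c by (subst suminf_mult) (auto simp: suminf_geometric intro!: summable_geometric)
  finally show ?thesis .
qed

text \<open>
  The sum is split at the level where the two available bounds balance. The constant does not
  depend on \<open>p\<^sub>2\<close>, \<open>s\<^sub>2\<close>, \<open>\<sigma>\<close>: the high frequencies are controlled with the same summability
  exponent \<open>q\<close> on both sides, without a geometric series.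
\<close>

lemma jawerth_embedding:
  fixes a :: "int \<Rightarrow> 'a::euclidean_space \<Rightarrow> real" and \<kappa> p\<^sub>1 p\<^sub>2 q s\<^sub>2 \<sigma> :: real
  assumes [measurable]: "\<And>j. a j \<in> borel_measurable borel" and a: "\<And>j x. 0 \<le> a j x"
    and p: "0 < p\<^sub>2" "p\<^sub>2 < p\<^sub>1" and "0 < q" "0 < \<kappa>"
    and s: "\<sigma> - DIM('a) / p\<^sub>1 = s\<^sub>2 - DIM('a) / p\<^sub>2"
    and nik: "\<And>j x. ennreal (a j x powr p\<^sub>2) \<le> ennreal (\<kappa> powr p\<^sub>2 * 2 powr (real_of_int j * DIM('a))) *
      (\<integral>\<^sup>+y. ennreal (a j y powr p\<^sub>2) \<partial>lborel)"
  defines "C \<equiv> (\<kappa> powr q * 2 powr (DIM('a) * q / p\<^sub>1) / (1 - 2 powr - (DIM('a) * q / p\<^sub>1)) + 1) powr (1 / q)"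
  shows "ennreal_rpow (\<integral>\<^sup>+x. ennreal_rpow (\<integral>\<^sup>+j. ennreal (2 powr (real_of_int j * \<sigma> * q) * a j x powr q) \<partial>count_space UNIV) (p\<^sub>1 / q) \<partial>lborel) (1 / p\<^sub>1)
    \<le> ennreal C * ennreal_rpow (\<integral>\<^sup>+x. ennreal_rpow (\<integral>\<^sup>+j. ennreal (2 powr (real_of_int j * s\<^sub>2 * q) * a j x powr q) \<partial>count_space UNIV) (p\<^sub>2 / q) \<partial>lborel) (1 / p\<^sub>2)"
proof -
  define n where "n = real DIM('a)"
  have n: "1 \<le> n" "0 < n" by (auto simp: n_def Suc_le_eq)
  define G where "G x = (\<integral>\<^sup>+j. ennreal (2 powr (real_of_int j * s\<^sub>2 * q) * a j x powr q) \<partial>count_space UNIV)" for x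
  define H where "H x = (\<integral>\<^sup>+j. ennreal (2 powr (real_of_int j * \<sigma> * q) * a j x powr q) \<partial>count_space UNIV)" for x
  have [measurable]: "G \<in> borel_measurable borel" "H \<in> borel_measurable borel"
    unfolding G_def H_def by measurable
  have G0H0: "H x = 0" if "G x = 0" for x
    using that by (simp add: G_def H_def nn_integral_0_iff_AE AE_count_space)
  define E where "E = (\<integral>\<^sup>+x. ennreal_rpow (G x) (p\<^sub>2 / q) \<partial>lborel)"
  define b where "b = n * q / p\<^sub>1"
  have b: "0 < b" using p n \<open>0 < q\<close> by (simp add: b_def)
  define B where "B = \<kappa> powr q * 2 powr b / (1 - 2 powr - b)"
  have b1: "2 powr - b < 1" using b by (intro powr_less_one) auto
  have B: "0 \<le> B" using b1 by (simp add: B_def)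
  have C: "C = (B + 1) powr (1 / q)" by (simp add: C_def B_def b_def n_def)
  then have C0: "0 < C" using B by simp
  define d where "d = s\<^sub>2 - \<sigma>"
  have d: "d = n / p\<^sub>2 - n / p\<^sub>1" using s by (simp add: d_def n_def)
  then have d0: "0 < d" using p n by (simp add: divide_strict_left_mono)
  have goal: "ennreal_rpow (\<integral>\<^sup>+x. ennreal_rpow (H x) (p\<^sub>1 / q) \<partial>lborel) (1 / p\<^sub>1) \<le> ennreal C * ennreal_rpow E (1 / p\<^sub>2)"
  proof (cases "E = top \<or> E = 0")
    case True
    then show ?thesis
    proof
      assume "E = 0"
      then have "AE x in lborel. G x = 0" unfolding E_def by (subst (asm) nn_integral_0_iff_AE) auto
      then have "(\<integral>\<^sup>+x. ennreal_rpow (H x) (p\<^sub>1 / q) \<partial>lborel) = 0"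
        by (subst nn_integral_0_iff_AE) (auto elim!: eventually_mono simp: G0H0)
      then show ?thesis by simp
    qed (use C0 in \<open>simp add: ennreal_mult_top\<close>)
  next
    case False
    then obtain E' where E': "E = ennreal E'" "0 < E'" by (cases E) (auto simp: less_le)
    define N where "N = E' powr (1 / p\<^sub>2)"
    have N: "0 < N" "N powr p\<^sub>2 = E'" using E' p by (auto simp: N_def powr_powr)
    \<comment> \<open>A single term never exceeds the full sum, so every weighted piece has its
      \<open>p\<^sub>2\<close>-norm bounded by \<open>N\<close>. The hypothesis \<open>nik\<close>
      makes this a supremum bound, and the relation between the exponents turns n/p2 into
      n/p1.\<close>
    have sup: "2 powr (real_of_int j * \<sigma>) * a j x \<le> \<kappa> * N * 2 powr (real_of_int j * n / p\<^sub>1)" for j x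
    proof -
      let ?A = "\<integral>\<^sup>+y. ennreal (a j y powr p\<^sub>2) \<partial>lborel"
      have "ennreal (2 powr (real_of_int j * s\<^sub>2 * p\<^sub>2)) * ?A
          = (\<integral>\<^sup>+y. ennreal (2 powr (real_of_int j * s\<^sub>2 * p\<^sub>2)) * ennreal (a j y powr p\<^sub>2) \<partial>lborel)"
        by (rule nn_integral_cmult[symmetric]) simp
      also have "\<dots> \<le> E"
        unfolding E_def
      proof (intro nn_integral_mono)
        fix y
        have "ennreal (2 powr (real_of_int j * s\<^sub>2 * q) * a j y powr q) \<le> G y"
          unfolding G_def by (rule nn_integral_ge_point) simp
        then have "ennreal_rpow (ennreal (2 powr (real_of_int j * s\<^sub>2 * q) * a j y powr q)) (p\<^sub>2 / q) \<le> ennreal_rpow (G y) (p\<^sub>2 / q)"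
          using p \<open>0 < q\<close> by (intro ennreal_rpow_mono) auto
        then show "ennreal (2 powr (real_of_int j * s\<^sub>2 * p\<^sub>2)) * ennreal (a j y powr p\<^sub>2) \<le> ennreal_rpow (G y) (p\<^sub>2 / q)"
          using \<open>0 < q\<close> by (simp add: ennreal_rpow_ennreal powr_mult powr_powr mult.assoc flip: ennreal_mult)
      qed
      finally have *: "ennreal (2 powr (real_of_int j * s\<^sub>2 * p\<^sub>2)) * ?A \<le> ennreal E'" by (simp add: E')
      have "ennreal ((2 powr (real_of_int j * s\<^sub>2) * a j x) powr p\<^sub>2)
         = ennreal (2 powr (real_of_int j * s\<^sub>2 * p\<^sub>2)) * ennreal (a j x powr p\<^sub>2)"
        using a by (simp add: powr_mult powr_powr ennreal_mult)
      also have "\<dots> \<le> ennreal (2 powr (real_of_int j * s\<^sub>2 * p\<^sub>2)) * (ennreal (\<kappa> powr p\<^sub>2 * 2 powr (real_of_int j * n)) * ?A)"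
        using nik[of j x] unfolding n_def by (rule mult_left_mono) simp
      also have "\<dots> = ennreal (\<kappa> powr p\<^sub>2 * 2 powr (real_of_int j * n)) * (ennreal (2 powr (real_of_int j * s\<^sub>2 * p\<^sub>2)) * ?A)"
        by (simp only: ac_simps)
      also have "\<dots> \<le> ennreal (\<kappa> powr p\<^sub>2 * 2 powr (real_of_int j * n)) * ennreal E'"
        using * by (rule mult_left_mono) simp
      also have "\<dots> = ennreal ((\<kappa> * 2 powr (real_of_int j * n / p\<^sub>2) * N) powr p\<^sub>2)"
        using p N E' \<open>0 < \<kappa>\<close> by (simp add: powr_mult powr_powr ennreal_mult)
      finally have "(2 powr (real_of_int j * s\<^sub>2) * a j x) powr p\<^sub>2 \<le> (\<kappa> * 2 powr (real_of_int j * n / p\<^sub>2) * N) powr p\<^sub>2"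
        by simp
      then have "2 powr (real_of_int j * s\<^sub>2) * a j x \<le> \<kappa> * 2 powr (real_of_int j * n / p\<^sub>2) * N"
        using p N \<open>0 < \<kappa>\<close> powr_less_mono2[of p\<^sub>2 "\<kappa> * 2 powr (real_of_int j * n / p\<^sub>2) * N" "2 powr (real_of_int j * s\<^sub>2) * a j x"]
        by (cases "\<kappa> * 2 powr (real_of_int j * n / p\<^sub>2) * N < 2 powr (real_of_int j * s\<^sub>2) * a j x") auto
      then have "2 powr (- (real_of_int j * d)) * (2 powr (real_of_int j * s\<^sub>2) * a j x)
         \<le> 2 powr (- (real_of_int j * d)) * (\<kappa> * 2 powr (real_of_int j * n / p\<^sub>2) * N)"
        by (rule mult_left_mono) simp
      moreover have "2 powr (- (real_of_int j * d)) * 2 powr (real_of_int j * s\<^sub>2) = 2 powr (real_of_int j * \<sigma>)"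
        by (simp add: d_def algebra_simps flip: powr_add)
      moreover have "2 powr (- (real_of_int j * d)) * 2 powr (real_of_int j * n / p\<^sub>2) = 2 powr (real_of_int j * n / p\<^sub>1)"
        by (simp add: d algebra_simps flip: powr_add)
      ultimately show ?thesis by (simp only: mult.assoc[symmetric]) (simp only: ac_simps)
    qed
    \<comment> \<open>Pointwise interpolation between the global quantity \<open>N\<close> and the
      local one \<open>G x\<close>. Integrated, the power of \<open>G\<close> gives back
      \<open>E\<close>, which is the \<open>p\<^sub>2\<close>-th power of \<open>N\<close>.\<close>
    have pt: "ennreal_rpow (H x) (p\<^sub>1 / q) \<le> ennreal ((B + 1) powr (p\<^sub>1 / q) * N powr (p\<^sub>1 - p\<^sub>2)) * ennreal_rpow (G x) (p\<^sub>2 / q)" for x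
    proof (cases "G x = top \<or> G x = 0")
      case True
      then show ?thesis
      proof
        assume "G x = top"
        moreover have "0 < (B + 1) powr (p\<^sub>1 / q) * N powr (p\<^sub>1 - p\<^sub>2)" using B N by simp
        ultimately show ?thesis using B N by (simp add: ennreal_mult_top)
      qed (simp add: G0H0)
    next
      case False
      then obtain G' where G': "G x = ennreal G'" "0 < G'" by (cases "G x") (auto simp: less_le)
      define \<gamma> where "\<gamma> = G' powr (1 / q)"
      have \<gamma>: "0 < \<gamma>" "\<gamma> powr q = G'" using G' \<open>0 < q\<close> by (auto simp: \<gamma>_def powr_powr)
      \<comment> \<open>2^J is taken close to the frequency at which the two bounds N 2^(J n/p1) and
        \<gamma> 2^(-J d) agree up to constants, that is 2^(J n/p2) = \<gamma>/N, because d = n/p2 -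
        n/p1.\<close>
      define t where "t = (\<gamma> / N) powr (p\<^sub>2 / n)"
      have t: "0 < t" using \<gamma> N by (simp add: t_def)
      define J where "J = \<lceil>log 2 t\<rceil>"
      have "log 2 t \<le> real_of_int J" "real_of_int J \<le> log 2 t + 1" by (auto simp: J_def)
      then have "2 powr log 2 t \<le> 2 powr real_of_int J" "2 powr real_of_int J \<le> 2 powr (log 2 t + 1)"
        by (auto intro: powr_mono)
      then have J: "t \<le> 2 powr real_of_int J" "2 powr real_of_int J \<le> 2 * t"
        using t by (auto simp: powr_add)
      \<comment> \<open>The common size of both bounds at the balancing frequency, in q-th
        powers.\<close>
      let ?R = "N powr (q * (1 - p\<^sub>2 / p\<^sub>1)) * \<gamma> powr (q * p\<^sub>2 / p\<^sub>1)"
      have low: "(\<kappa> * N) powr q * (2 powr (real_of_int J * b) / (1 - 2 powr - b)) \<le> B * ?R"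
      proof -
        have "2 powr (real_of_int J * b) = (2 powr real_of_int J) powr b" by (simp add: powr_powr)
        also have "\<dots> \<le> (2 * t) powr b" using J b t by (intro powr_mono2) auto
        also have "\<dots> = 2 powr b * (\<gamma> / N) powr (q * p\<^sub>2 / p\<^sub>1)"
          using t n by (simp add: powr_mult t_def powr_powr b_def mult.commute)
        finally have "(\<kappa> * N) powr q * (2 powr (real_of_int J * b) / (1 - 2 powr - b))
          \<le> (\<kappa> * N) powr q * ((2 powr b * (\<gamma> / N) powr (q * p\<^sub>2 / p\<^sub>1)) / (1 - 2 powr - b))"
          using b1 by (intro mult_left_mono divide_right_mono) auto
        also have "\<dots> = B * (N powr q * (\<gamma> / N) powr (q * p\<^sub>2 / p\<^sub>1))"
          using N \<open>0 < \<kappa>\<close> by (simp add: B_def powr_mult)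
        also have "N powr q * (\<gamma> / N) powr (q * p\<^sub>2 / p\<^sub>1) = ?R"
          using N \<gamma> by (simp add: powr_divide right_diff_distrib powr_diff)
        finally show ?thesis .
      qed
      have high: "2 powr (- (real_of_int J * d * q)) * G' \<le> ?R"
      proof -
        have "2 powr (- (real_of_int J * d * q)) = (2 powr real_of_int J) powr (- (d * q))"
          by (simp add: powr_powr mult.assoc)
        also have "\<dots> \<le> t powr (- (d * q))" using J t d0 \<open>0 < q\<close> by (intro powr_mono2') auto
        also have "\<dots> = (\<gamma> / N) powr (- (q * (1 - p\<^sub>2 / p\<^sub>1)))"
        proof -
          have "p\<^sub>2 / n * - (d * q) = - (q * (1 - p\<^sub>2 / p\<^sub>1))"
            using n p by (simp add: d field_simps)
          then show ?thesis by (simp only: t_def powr_powr)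
        qed
        finally have "2 powr (- (real_of_int J * d * q)) * G' \<le> (\<gamma> / N) powr (- (q * (1 - p\<^sub>2 / p\<^sub>1))) * \<gamma> powr q"
          using \<gamma> G' by (simp add: mult_right_mono)
        also have "\<dots> = ?R"
        proof -
          have "\<gamma> powr q = \<gamma> powr (q * (1 - p\<^sub>2 / p\<^sub>1)) * \<gamma> powr (q * p\<^sub>2 / p\<^sub>1)"
            by (simp add: algebra_simps flip: powr_add)
          moreover have "(\<gamma> / N) powr (- e) = N powr e / \<gamma> powr e" for e
            using N \<gamma> by (simp add: powr_divide powr_minus)
          ultimately show ?thesis using \<gamma> by simp
        qed
        finally show ?thesis .
      qed
      have "H x \<le> (\<integral>\<^sup>+j. ennreal ((\<kappa> * N) powr q) * (ennreal (2 powr (real_of_int j * b)) * indicator {..J} j) +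
          ennreal (2 powr (- (real_of_int J * d * q))) * ennreal (2 powr (real_of_int j * s\<^sub>2 * q) * a j x powr q) \<partial>count_space UNIV)"
        unfolding H_def
      proof (intro nn_integral_mono)
        fix j :: int
        show "ennreal (2 powr (real_of_int j * \<sigma> * q) * a j x powr q) \<le>
          ennreal ((\<kappa> * N) powr q) * (ennreal (2 powr (real_of_int j * b)) * indicator {..J} j) +
          ennreal (2 powr (- (real_of_int J * d * q))) * ennreal (2 powr (real_of_int j * s\<^sub>2 * q) * a j x powr q)"
        proof (cases "j \<le> J")
          case True
          have "2 powr (real_of_int j * \<sigma> * q) * a j x powr q = (2 powr (real_of_int j * \<sigma>) * a j x) powr q"
            using a by (simp add: powr_mult powr_powr)
          also have "\<dots> \<le> (\<kappa> * N * 2 powr (real_of_int j * n / p\<^sub>1)) powr q"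
            using sup a \<open>0 < q\<close> by (intro powr_mono2) auto
          also have "\<dots> = (\<kappa> * N) powr q * 2 powr (real_of_int j * b)"
            using N \<open>0 < \<kappa>\<close> by (simp add: powr_mult powr_powr b_def mult.assoc)
          finally have "ennreal (2 powr (real_of_int j * \<sigma> * q) * a j x powr q) \<le> ennreal ((\<kappa> * N) powr q * 2 powr (real_of_int j * b))"
            by (rule ennreal_leI)
          then show ?thesis using True by (simp add: ennreal_mult add_increasing2)
        next
          case False
          have "2 powr (real_of_int j * \<sigma> * q) = 2 powr (- (real_of_int j * d * q)) * 2 powr (real_of_int j * s\<^sub>2 * q)"
            by (simp add: d_def algebra_simps flip: powr_add)
          \<comment> \<open>Above \<open>J\<close> the decaying factor is frozen at its value at
            \<open>J\<close>; the remaining sum is part of \<open>G x\<close>.\<close>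
          also have "\<dots> \<le> 2 powr (- (real_of_int J * d * q)) * 2 powr (real_of_int j * s\<^sub>2 * q)"
            using False d0 \<open>0 < q\<close> by (intro mult_right_mono powr_mono) (auto intro!: mult_right_mono)
          finally have "2 powr (real_of_int j * \<sigma> * q) * a j x powr q
              \<le> 2 powr (- (real_of_int J * d * q)) * 2 powr (real_of_int j * s\<^sub>2 * q) * a j x powr q"
            by (rule mult_right_mono) simp
          then have "2 powr (real_of_int j * \<sigma> * q) * a j x powr q
              \<le> 2 powr (- (real_of_int J * d * q)) * (2 powr (real_of_int j * s\<^sub>2 * q) * a j x powr q)"
            by (simp only: mult.assoc)
          then show ?thesis using False by (simp add: ennreal_leI flip: ennreal_mult)
        qed
      qed
      also have "\<dots> = ennreal ((\<kappa> * N) powr q) * ennreal (2 powr (real_of_int J * b) / (1 - 2 powr - b)) +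
          ennreal (2 powr (- (real_of_int J * d * q))) * G x"
        by (subst nn_integral_add) (auto simp: nn_integral_cmult nn_integral_powr_int_atMost[OF b] G_def)
      also have "\<dots> = ennreal ((\<kappa> * N) powr q * (2 powr (real_of_int J * b) / (1 - 2 powr - b)) + 2 powr (- (real_of_int J * d * q)) * G')"
        using b1 G' by (simp flip: ennreal_mult ennreal_plus)
      also have "\<dots> \<le> ennreal ((B + 1) * ?R)"
        using add_mono[OF low high] by (intro ennreal_leI) (simp add: distrib_right)
      finally have "ennreal_rpow (H x) (p\<^sub>1 / q) \<le> ennreal_rpow (ennreal ((B + 1) * ?R)) (p\<^sub>1 / q)"
        using p \<open>0 < q\<close> by (intro ennreal_rpow_mono) auto
      also have "\<dots> = ennreal (((B + 1) * ?R) powr (p\<^sub>1 / q))"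
        using B by (intro ennreal_rpow_ennreal) simp
      also have "((B + 1) * ?R) powr (p\<^sub>1 / q) = (B + 1) powr (p\<^sub>1 / q) * N powr (p\<^sub>1 - p\<^sub>2) * G' powr (p\<^sub>2 / q)"
      proof -
        have "q * (1 - p\<^sub>2 / p\<^sub>1) * (p\<^sub>1 / q) = p\<^sub>1 - p\<^sub>2" "q * p\<^sub>2 / p\<^sub>1 * (p\<^sub>1 / q) = p\<^sub>2"
          using p \<open>0 < q\<close> by (auto simp: field_simps)
        then have "?R powr (p\<^sub>1 / q) = N powr (p\<^sub>1 - p\<^sub>2) * \<gamma> powr p\<^sub>2"
          using N \<gamma> by (simp only: powr_mult powr_ge_zero powr_powr)
        moreover have "\<gamma> powr p\<^sub>2 = G' powr (p\<^sub>2 / q)" by (simp add: \<gamma>_def powr_powr)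
        ultimately show ?thesis using B by (simp only: powr_mult powr_ge_zero mult_nonneg_nonneg)
      qed
      finally show ?thesis
        using G' by (simp add: ennreal_rpow_ennreal ennreal_mult)
    qed
    have "(\<integral>\<^sup>+x. ennreal_rpow (H x) (p\<^sub>1 / q) \<partial>lborel)
       \<le> (\<integral>\<^sup>+x. ennreal ((B + 1) powr (p\<^sub>1 / q) * N powr (p\<^sub>1 - p\<^sub>2)) * ennreal_rpow (G x) (p\<^sub>2 / q) \<partial>lborel)"
      by (intro nn_integral_mono pt)
    also have "\<dots> = ennreal ((B + 1) powr (p\<^sub>1 / q) * N powr (p\<^sub>1 - p\<^sub>2)) * E"
      unfolding E_def by (rule nn_integral_cmult) simp
    also have "\<dots> = ennreal ((B + 1) powr (p\<^sub>1 / q) * N powr p\<^sub>1)"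
      using N E' by (simp add: powr_diff flip: ennreal_mult)
    finally have "ennreal_rpow (\<integral>\<^sup>+x. ennreal_rpow (H x) (p\<^sub>1 / q) \<partial>lborel) (1 / p\<^sub>1)
      \<le> ennreal_rpow (ennreal ((B + 1) powr (p\<^sub>1 / q) * N powr p\<^sub>1)) (1 / p\<^sub>1)"
      using p by (intro ennreal_rpow_mono) auto
    also have "\<dots> = ennreal (C * N)"
      using p N B by (simp add: ennreal_rpow_ennreal powr_mult powr_powr C)
    also have "\<dots> = ennreal C * ennreal_rpow E (1 / p\<^sub>2)"
      using C0 N E' by (simp add: ennreal_mult N_def ennreal_rpow_ennreal)
    finally show ?thesis .
  qed
  then show ?thesis unfolding H_def G_def E_def .
qed


section \<open>Smooth left inverses of injective symbols\<close>

text \<open>Determinants and Cramer's rule concern matrices indexed by a finite type; this makes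
  such a type of the orthonormal basis.\<close>

typedef (overloaded) 'a basis_index = "Basis :: 'a::euclidean_space set"
  using nonempty_Basis by blast

instance basis_index :: (euclidean_space) finite
proof
  show "finite (UNIV :: 'a basis_index set)"
    using type_definition.univ[OF type_definition_basis_index] by (metis finite_Basis finite_imageI)
qed

lemma Rep_basis_index_Basis [simp]: "Rep_basis_index i \<in> Basis"
  using Rep_basis_index .

lemma sum_basis_index: "(\<Sum>i\<in>UNIV. f (Rep_basis_index i)) = (\<Sum>b\<in>Basis. f b)"
  by (rule sum.reindex_bij_betw) (simp add: bij_betw_def inj_on_def Rep_basis_index_inject
      type_definition.Rep_range[OF type_definition_basis_index])

lemma smooth_det:
  fixes M :: "real^'n::finite \<Rightarrow> real^'i^'i"
  assumes "\<And>i j. smooth (\<lambda>\<xi>. M \<xi> $ i $ j)"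
  shows "smooth (\<lambda>\<xi>. det (M \<xi>))"
  unfolding det_def using assms by (intro smooth_sum smooth_mult smooth_prod) auto

lemma smooth_complex_of_real: "smooth f \<Longrightarrow> smooth (\<lambda>x. complex_of_real (f x))"
  by (rule smooth_bounded_linear[OF bounded_linear_of_real])

text \<open>The left inverse is \<open>(L\<^sup>* L)\<^sup>-\<^sup>1 L\<^sup>*\<close>, its smoothness away from the origin comes from Cramer's rule.\<close>

lemma smooth_left_inverse:
  fixes L :: "real^'n::finite \<Rightarrow> 'v::euclidean_space \<Rightarrow> 'z::euclidean_space" and \<eta> :: "real^'n \<Rightarrow> complex"
  assumes lin: "\<And>\<xi>. linear (L \<xi>)" and smooth: "\<And>v b. smooth (\<lambda>\<xi>. L \<xi> v \<bullet> b)"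
    and inj: "\<And>\<xi> v. \<xi> \<noteq> 0 \<Longrightarrow> L \<xi> v = 0 \<Longrightarrow> v = 0"
    and \<eta>: "smooth \<eta>" "0 < e" "\<And>\<xi>. norm \<xi> < e \<Longrightarrow> \<eta> \<xi> = 0" "\<And>\<xi>. R < norm \<xi> \<Longrightarrow> \<eta> \<xi> = 0"
  shows "\<exists>m :: 'v \<Rightarrow> 'z \<Rightarrow> real^'n \<Rightarrow> complex.
    (\<forall>a b. smooth (m a b) \<and> (\<forall>\<xi>. R < norm \<xi> \<longrightarrow> m a b \<xi> = 0)) \<and>
    (\<forall>\<xi> v. \<forall>a\<in>Basis. \<eta> \<xi> * complex_of_real (v \<bullet> a) = (\<Sum>b\<in>Basis. m a b \<xi> * complex_of_real (L \<xi> v \<bullet> b)))"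
proof -
  let ?e = "Rep_basis_index :: 'v basis_index \<Rightarrow> 'v"
  \<comment> \<open>The Gram matrix of \<open>L \<xi>\<close>, that is L^T L in coordinates; the
    vector \<open>r b \<xi>\<close> holds the coordinates of L^T b.\<close>
  define S :: "real^'n \<Rightarrow> real^'v basis_index^'v basis_index" where "S \<xi> = (\<chi> i j. L \<xi> (?e i) \<bullet> L \<xi> (?e j))" for \<xi>
  define r :: "'z \<Rightarrow> real^'n \<Rightarrow> real^'v basis_index" where "r b \<xi> = (\<chi> j. L \<xi> (?e j) \<bullet> b)" for b \<xi>
  define N where "N k b \<xi> = det (\<chi> i. if i = k then r b \<xi> else row i (S \<xi>))" for k b \<xi>
  have inner: "L \<xi> u \<bullet> L \<xi> v = (\<Sum>b\<in>Basis. (L \<xi> u \<bullet> b) * (L \<xi> v \<bullet> b))" for \<xi> u v by (rule euclidean_inner)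
  have smS: "smooth (\<lambda>\<xi>. S \<xi> $ i $ j)" for i j
    unfolding S_def by (simp add: inner) (intro smooth_sum smooth_mult smooth)
  have smD: "smooth (\<lambda>\<xi>. det (S \<xi>))" by (rule smooth_det[OF smS])
  have smN: "smooth (N k b)" for k b
  proof -
    have "smooth (\<lambda>\<xi>. (\<chi> i. if i = k then r b \<xi> else row i (S \<xi>)) $ i $ j)" for i j
      using smS smooth by (cases "i = k") (auto simp: r_def row_def)
    from smooth_det[OF this] show ?thesis unfolding N_def[abs_def] .
  qed
  have repr: "v = (\<Sum>i\<in>UNIV. (v \<bullet> ?e i) *\<^sub>R ?e i)" for v
    using sum_basis_index[of "\<lambda>b. (v \<bullet> b) *\<^sub>R b"] by (simp add: euclidean_representation)
  have Lv: "L \<xi> v = (\<Sum>i\<in>UNIV. (v \<bullet> ?e i) *\<^sub>R L \<xi> (?e i))" for \<xi> v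
    by (subst repr[of v]) (simp add: linear_sum[OF lin] linear_scale[OF lin])
  \<comment> \<open>A null vector of the Gram matrix yields a \<open>v\<close> with |L v|^2 = 0, and
    injectivity makes it vanish.\<close>
  have D0: "det (S \<xi>) \<noteq> 0" if "\<xi> \<noteq> 0" for \<xi>
  proof
    assume "det (S \<xi>) = 0"
    then obtain x where x: "x \<noteq> 0" "S \<xi> *v x = 0"
      using invertible_det_nz[of "S \<xi>"] unfolding invertible_left_inverse matrix_left_invertible_ker by blast
    define v where "v = (\<Sum>i\<in>UNIV. (x $ i) *\<^sub>R ?e i)"
    have LLv: "L \<xi> v = (\<Sum>i\<in>UNIV. (x $ i) *\<^sub>R L \<xi> (?e i))"
      by (simp add: v_def linear_sum[OF lin] linear_scale[OF lin])
    have "L \<xi> (?e i) \<bullet> L \<xi> v = (S \<xi> *v x) $ i" for i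
      by (simp add: LLv inner_sum_right matrix_vector_mult_def S_def mult.commute)
    then have "L \<xi> v \<bullet> L \<xi> v = 0" by (subst LLv) (simp add: inner_sum_left x)
    then have "v = 0" using inj[OF that] by simp
    moreover have "v \<bullet> ?e i = x $ i" for i
    proof -
      have "v \<bullet> ?e i = (\<Sum>j\<in>UNIV. if j = i then x $ j else 0)"
        unfolding v_def inner_sum_left inner_scaleR_left
        by (intro sum.cong refl) (auto simp: inner_Basis Rep_basis_index_inject)
      then show ?thesis by simp
    qed
    ultimately have "x = 0" by (simp add: vec_eq_iff)
    with x show False by simp
  qed
  \<comment> \<open>Cramer's rule for the normal equations L^T L v = L^T (L v). Linearity of the
    determinant in row \<open>k\<close> splits the numerator over the coordinates of
    \<open>L \<xi> v\<close>.\<close>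
  have cramer: "(v \<bullet> ?e k) * det (S \<xi>) = (\<Sum>b\<in>Basis. (L \<xi> v \<bullet> b) * N k b \<xi>)" for k \<xi> v
  proof -
    define x :: "real^'v basis_index" where "x = (\<chi> i. v \<bullet> ?e i)"
    have "(\<Sum>i\<in>UNIV. x $ i *s row i (S \<xi>)) = (\<Sum>b\<in>Basis. (L \<xi> v \<bullet> b) *s r b \<xi>)"
    proof (subst vec_eq_iff, intro allI)
      fix j
      have "(\<Sum>i\<in>UNIV. x $ i *s row i (S \<xi>)) $ j = L \<xi> v \<bullet> L \<xi> (?e j)"
        by (subst Lv[of \<xi> v]) (simp add: x_def row_def S_def inner_sum_left)
      also have "\<dots> = (\<Sum>b\<in>Basis. (L \<xi> v \<bullet> b) *s r b \<xi>) $ j"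
        by (simp add: inner r_def)
      finally show "(\<Sum>i\<in>UNIV. x $ i *s row i (S \<xi>)) $ j = (\<Sum>b\<in>Basis. (L \<xi> v \<bullet> b) *s r b \<xi>) $ j" .
    qed
    then have "x $ k * det (S \<xi>) = det (\<chi> i. if i = k then (\<Sum>b\<in>Basis. (L \<xi> v \<bullet> b) *s r b \<xi>) else row i (S \<xi>))"
      using cramer_lemma_transpose[of k x "S \<xi>"] by (simp only:)
    also have "\<dots> = (\<Sum>b\<in>Basis. det (\<chi> i. if i = k then (L \<xi> v \<bullet> b) *s r b \<xi> else row i (S \<xi>)))"
      by (rule det_linear_row_sum[where a="\<lambda>_ b. (L \<xi> v \<bullet> b) *s r b \<xi>"]) simp
    also have "\<dots> = (\<Sum>b\<in>Basis. (L \<xi> v \<bullet> b) * N k b \<xi>)"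
      unfolding N_def by (intro sum.cong refl det_row_mul)
    finally show ?thesis by (simp add: x_def)
  qed
  \<comment> \<open>The power 1 gives the quotient the shape of \<open>smooth_divide_power\<close>.
    For \<open>a\<close> outside the basis the index \<open>Abs_basis_index a\<close> is
    unspecified, which affects neither smoothness nor support.\<close>
  define m where "m a b \<xi> = \<eta> \<xi> * complex_of_real (N (Abs_basis_index a) b \<xi>) / complex_of_real (det (S \<xi>)) ^ 1" for a b \<xi>
  show ?thesis
  proof (intro exI[of _ m] conjI allI ballI impI)
    show "smooth (m a b)" for a b
      unfolding m_def[abs_def]
      by (rule smooth_divide_power[OF _ _ \<eta>(2)]) (auto intro!: smooth_mult \<eta> smooth_complex_of_real smN smD simp: \<eta> D0)
    show "m a b \<xi> = 0" if "R < norm \<xi>" for a b \<xi> using \<eta>(4)[OF that] by (simp add: m_def)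
    fix \<xi> v and a :: 'v assume a: "a \<in> Basis"
    show "\<eta> \<xi> * complex_of_real (v \<bullet> a) = (\<Sum>b\<in>Basis. m a b \<xi> * complex_of_real (L \<xi> v \<bullet> b))"
    proof (cases "\<xi> = 0")
      case True
      then have "\<eta> \<xi> = 0" using \<eta> by simp
      then show ?thesis by (simp add: m_def)
    next
      case False
      let ?D = "complex_of_real (det (S \<xi>))" and ?k = "Abs_basis_index a"
      have D: "?D \<noteq> 0" using D0[OF False] by simp
      have k: "?e ?k = a" using a by (rule Abs_basis_index_inverse)
      have "(\<Sum>b\<in>Basis. m a b \<xi> * complex_of_real (L \<xi> v \<bullet> b)) = \<eta> \<xi> / ?D * complex_of_real (\<Sum>b\<in>Basis. (L \<xi> v \<bullet> b) * N ?k b \<xi>)"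
        by (simp add: m_def sum_distrib_left ac_simps)
      also have "\<dots> = \<eta> \<xi> * complex_of_real (v \<bullet> a)"
        unfolding cramer[symmetric] k using D by simp
      finally show ?thesis by simp
    qed
  qed
qed

section \<open>Linear maps on the complexification\<close>

definition lift_linear :: "('a::real_vector \<Rightarrow> 'b::real_vector) \<Rightarrow> 'a \<times> 'a \<Rightarrow> 'b \<times> 'b" where
  "lift_linear f u = (f (fst u), f (snd u))"

lemma bounded_linear_lift_linear:
  fixes f :: "'a::euclidean_space \<Rightarrow> 'b::euclidean_space"
  assumes "linear f"
  shows "bounded_linear (lift_linear f)"
proof -
  have f: "bounded_linear f" using assms by (simp add: linear_conv_bounded_linear)
  show ?thesis
    unfolding lift_linear_def[abs_def]
    by (intro bounded_linear_Pair bounded_linear_compose[OF f] bounded_linear_fst bounded_linear_snd)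
qed

lemma lift_linear_cscale: "linear f \<Longrightarrow> lift_linear f (cscale z u) = cscale z (lift_linear f u)"
  by (simp add: lift_linear_def cscale_def linear_diff linear_add linear_scale)

text \<open>The complexified matrix unit that reads the coordinate along \<open>b\<close> and writes
  it along \<open>a\<close>.\<close>

definition entry :: "'b::euclidean_space \<Rightarrow> 'a::euclidean_space \<Rightarrow> 'b \<times> 'b \<Rightarrow> 'a \<times> 'a" where
  "entry b a = lift_linear (\<lambda>w. (w \<bullet> b) *\<^sub>R a)"

lemma linear_entry: "linear (\<lambda>w. (w \<bullet> b) *\<^sub>R a)"
  by (intro linearI) (auto simp: inner_add_left scaleR_add_left)

text \<open>Passes from scalar identities for real vectors to the complexification. As
  \<open>cscale\<close> mixes the two components, the hypothesis is split into its real and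
  imaginary parts, each of which is applied to both components of \<open>u\<close>.\<close>

lemma cscale_eq_sum_entry:
  fixes u :: "'v::euclidean_space \<times> 'v"
  assumes "\<And>v a. a \<in> Basis \<Longrightarrow> z * complex_of_real (v \<bullet> a) = (\<Sum>b\<in>Basis. m a b * complex_of_real (L v \<bullet> b))"
  shows "cscale z u = (\<Sum>a\<in>Basis. \<Sum>b\<in>Basis. entry b a (cscale (m a b) (lift_linear L u)))"
proof -
  obtain p q where u: "u = (p, q)" by (cases u)
  have Re: "Re z * (v \<bullet> a) = (\<Sum>b\<in>Basis. Re (m a b) * (L v \<bullet> b))" and Im: "Im z * (v \<bullet> a) = (\<Sum>b\<in>Basis. Im (m a b) * (L v \<bullet> b))"
    if "a \<in> Basis" for v a
    using arg_cong[OF assms[OF that, of v], of Re] arg_cong[OF assms[OF that, of v], of Im] by auto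
  have "(\<Sum>a\<in>Basis. \<Sum>b\<in>Basis. entry b a (cscale (m a b) (lift_linear L u)))
    = (\<Sum>a\<in>Basis. ((Re z * (p \<bullet> a) - Im z * (q \<bullet> a)) *\<^sub>R a, (Re z * (q \<bullet> a) + Im z * (p \<bullet> a)) *\<^sub>R a))"
  proof (intro sum.cong refl)
    fix a :: 'v assume a: "a \<in> Basis"
    show "(\<Sum>b\<in>Basis. entry b a (cscale (m a b) (lift_linear L u)))
      = ((Re z * (p \<bullet> a) - Im z * (q \<bullet> a)) *\<^sub>R a, (Re z * (q \<bullet> a) + Im z * (p \<bullet> a)) *\<^sub>R a)"
      unfolding Re[OF a] Im[OF a]
      by (simp add: u entry_def lift_linear_def cscale_def inner_diff_left inner_add_left sum_prod
          scaleR_sum_left scaleR_diff_left scaleR_add_left sum_subtractf sum.distrib)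
  qed
  also have "\<dots> = cscale z u"
    by (simp add: u cscale_def sum_prod scaleR_diff_left scaleR_add_left sum_subtractf sum.distrib
        euclidean_representation flip: scaleR_scaleR scaleR_sum_right)
  finally show ?thesis by simp
qed


section \<open>Littlewood--Paley pieces\<close>

lemma power_int_2_conv_powr: "(2::real) powi j = 2 powr real_of_int j"
  by (simp add: powr_real_of_int')

lemma bounded_range_of_bounded_support:
  fixes f :: "'a::euclidean_space \<Rightarrow> 'b::real_normed_vector"
  assumes "continuous_on UNIV f" "\<And>x. R < norm x \<Longrightarrow> f x = 0"
  shows "bounded (range f)"
proof -
  have "bounded (insert 0 (f ` cball 0 R))"
    using assms(1) by (intro bounded_insert[THEN iffD2] compact_imp_bounded compact_continuous_image)
      (auto intro: continuous_on_subset)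
  moreover have "range f \<subseteq> insert 0 (f ` cball 0 R)"
    using assms(2) by (force simp: image_iff not_le[symmetric])
  ultimately show ?thesis by (rule bounded_subset)
qed

lemma integrable_Pair_zero:
  fixes u :: "'b \<Rightarrow> 'a::euclidean_space"
  assumes "integrable M u"
  shows "integrable M (\<lambda>x. (u x, 0 :: 'a))"
  using assms by (intro integrable_bounded_linear[of "\<lambda>v. (v, 0)"]
    bounded_linear_Pair bounded_linear_ident bounded_linear_zero)

text \<open>Up to a normalising factor the Fourier transform of the piece. The factor of
  \<open>inverse_fourier\<close> is absorbed, so that the piece is the bare oscillatory integral of
  its symbol.\<close>

definition lp_symbol :: "(int \<Rightarrow> real^'n::finite \<Rightarrow> complex) \<Rightarrow> int \<Rightarrow> (real^'n \<Rightarrow> 'a) \<Rightarrow> real^'n \<Rightarrow> 'a \<times> 'a::euclidean_space" where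
  "lp_symbol \<phi> j u \<xi> = ((2 * pi) powr (- real CARD('n) / 2)) *\<^sub>R cscale (\<phi> j \<xi>) (fourier (\<lambda>x. (u x, 0)) \<xi>)"

lemma lp_piece_eq:
  "lp_piece \<phi> j u x = (LINT \<xi>|lborel. cscale (cis (x \<bullet> \<xi>)) (lp_symbol \<phi> j u \<xi>))"
  by (simp add: lp_piece_def inverse_fourier_def lp_symbol_def cscale.scaleR_right)

locale dyadic =
  fixes \<phi> :: "int \<Rightarrow> real^'n::finite \<Rightarrow> complex"
  assumes dyadic: "dyadic_decomposition \<phi>"
begin

abbreviation r :: "int \<Rightarrow> real" where "r j \<equiv> 2 powr - real_of_int j"

lemma smooth_\<phi>: "smooth (\<phi> j)"
  using dyadic by (auto simp: dyadic_decomposition_def)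

text \<open>The decomposition provides closed annuli. The set where \<open>\<phi> j\<close> is
  nonzero is open, so any point of it can be moved radially both inwards and outwards, which
  excludes the boundary spheres. Strictness is what lets \<open>cutoff\<close> equal 1 on a closed
  annulus.\<close>

lemma support_\<phi>:
  assumes "\<phi> j \<xi> \<noteq> 0"
  shows "2 powr (real_of_int j - 1) < norm \<xi>" "norm \<xi> < 2 powr (real_of_int j + 1)"
proof -
  have supp: "2 powr (real_of_int j - 1) \<le> norm \<zeta>" "norm \<zeta> \<le> 2 powr (real_of_int j + 1)" if "\<phi> j \<zeta> \<noteq> 0" for \<zeta>
    using dyadic that unfolding dyadic_decomposition_def power_int_2_conv_powr by auto
  have "open {\<zeta>. \<phi> j \<zeta> \<noteq> 0}"
    by (intro open_Collect_neq smooth_continuous[OF smooth_\<phi>] continuous_intros)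
  then obtain e where e: "0 < e" "ball \<xi> e \<subseteq> {\<zeta>. \<phi> j \<zeta> \<noteq> 0}"
    using assms open_contains_ball by blast
  have n: "0 < norm \<xi>" by (rule less_le_trans[OF _ supp(1)[OF assms]]) simp
  define t where "t = min (1/2) (e / (2 * norm \<xi>))"
  have t: "0 < t" "t \<le> 1/2" "t * norm \<xi> < e"
    using e n by (auto simp: t_def min_def field_simps)
  have "\<phi> j ((1 - t) *\<^sub>R \<xi>) \<noteq> 0" "\<phi> j ((1 + t) *\<^sub>R \<xi>) \<noteq> 0"
    using e(2) t by (auto simp: subset_eq dist_norm scaleR_diff_left scaleR_add_left)
  then have "2 powr (real_of_int j - 1) \<le> (1 - t) * norm \<xi>" "(1 + t) * norm \<xi> \<le> 2 powr (real_of_int j + 1)"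
    using supp[of "(1 - t) *\<^sub>R \<xi>"] supp[of "(1 + t) *\<^sub>R \<xi>"] t by auto
  moreover have "(1 - t) * norm \<xi> < norm \<xi>" "norm \<xi> < (1 + t) * norm \<xi>" using t n by (auto simp: algebra_simps)
  ultimately show "2 powr (real_of_int j - 1) < norm \<xi>" "norm \<xi> < 2 powr (real_of_int j + 1)" by linarith+
qed

text \<open>
  The resolution of unity is not assumed to consist of dilates of one function, so the cutoff is
  built once and dilated afterwards.
\<close>

definition cutoff :: "real^'n \<Rightarrow> complex" where
  "cutoff \<xi> = \<phi> (-1) \<xi> + \<phi> 0 \<xi> + \<phi> 1 \<xi>"

lemma smooth_cutoff: "smooth cutoff"
  unfolding cutoff_def[abs_def] by (intro smooth_add smooth_\<phi>)

lemma cutoff_eq_0: "norm \<xi> < 1 / 4 \<Longrightarrow> cutoff \<xi> = 0" "4 < norm \<xi> \<Longrightarrow> cutoff \<xi> = 0"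
proof -
  have "\<phi> j \<xi> = 0" if "j \<in> {-1, 0, 1}" "norm \<xi> < 1 / 4 \<or> 4 < norm \<xi>" for j
  proof (rule ccontr)
    assume "\<phi> j \<xi> \<noteq> 0"
    note * = support_\<phi>[OF this]
    have "2 powr (-2) \<le> 2 powr (real_of_int j - 1)" "2 powr (real_of_int j + 1) \<le> 2 powr 2"
      using that(1) by (intro powr_mono; force)+
    moreover have "2 powr (-2) = 1 / (4::real)" "2 powr 2 = (4::real)"
      by (simp_all add: powr_minus_divide)
    ultimately show False using * that(2) by linarith
  qed
  then show "norm \<xi> < 1 / 4 \<Longrightarrow> cutoff \<xi> = 0" "4 < norm \<xi> \<Longrightarrow> cutoff \<xi> = 0"
    by (auto simp: cutoff_def)
qed

text \<open>On this annulus only the three levels summed in \<open>cutoff\<close> can be nonzero, so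
  they carry the whole resolution of unity.\<close>

lemma cutoff_eq_1:
  assumes "1 / 2 \<le> norm \<xi>" "norm \<xi> \<le> 2"
  shows "cutoff \<xi> = 1"
proof -
  have "\<phi> j \<xi> = 0" if "j \<notin> {-1, 0, 1}" for j
  proof (rule ccontr)
    assume "\<phi> j \<xi> \<noteq> 0"
    note * = support_\<phi>[OF this]
    consider "2 \<le> j" | "j \<le> - 2" using \<open>j \<notin> {-1, 0, 1}\<close> by (auto, arith)
    then show False
    proof cases
      case 1
      then have "2 powr 1 \<le> 2 powr (real_of_int j - 1)" by (intro powr_mono) auto
      then show False using * assms by simp
    next
      case 2
      then have "2 powr (real_of_int j + 1) \<le> 2 powr (-1)" by (intro powr_mono) auto
      then show False using * assms by (simp add: powr_minus)
    qed
  qed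
  then have "((\<lambda>j. \<phi> j \<xi>) has_sum x) UNIV \<longleftrightarrow> ((\<lambda>j. \<phi> j \<xi>) has_sum x) {-1, 0, 1}" for x
    by (intro has_sum_cong_neutral) auto
  moreover have "\<xi> \<noteq> 0" using assms by auto
  then have "((\<lambda>j. \<phi> j \<xi>) has_sum 1) UNIV" using dyadic by (auto simp: dyadic_decomposition_def)
  moreover have "((\<lambda>j. \<phi> j \<xi>) has_sum (\<Sum>j\<in>{-1, 0, 1}. \<phi> j \<xi>)) {-1, 0, 1}" by (rule has_sum_finite) simp
  ultimately have "(\<Sum>j\<in>{-1, 0, 1}. \<phi> j \<xi>) = 1" using has_sum_unique by blast
  then show ?thesis by (simp add: cutoff_def add.assoc)
qed

context
  fixes u :: "real^'n \<Rightarrow> 'a::euclidean_space"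
  assumes u: "integrable lborel u"
begin

lemma fourier_cis: "fourier (\<lambda>x. (u x, 0)) \<xi> =
    ((2 * pi) powr (- real CARD('n) / 2)) *\<^sub>R (LINT x|lborel. cscale (cis (- \<xi> \<bullet> x)) (u x, 0))"
  by (simp add: fourier_def inner_commute)

lemma continuous_fourier: "continuous_on UNIV (fourier (\<lambda>x. (u x, 0::'a)))"
proof -
  have "continuous_on UNIV (\<lambda>\<xi>. LINT x|lborel. cscale (cis (\<xi> \<bullet> x)) (u x, 0::'a))"
    by (rule cscale.continuous_integral_cis[OF integrable_Pair_zero[OF u]])
  then have "continuous_on UNIV (\<lambda>\<xi>. LINT x|lborel. cscale (cis (- \<xi> \<bullet> x)) (u x, 0::'a))"
    by (rule continuous_on_compose2) (auto intro: continuous_intros)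
  then show ?thesis unfolding fourier_cis[abs_def] by (intro continuous_intros)
qed

lemma lp_symbol_eq_0: "2 * 2 powr real_of_int j < norm \<xi> \<Longrightarrow> lp_symbol \<phi> j u \<xi> = 0"
  using support_\<phi>(2)[of j \<xi>] by (cases "\<phi> j \<xi> = 0") (auto simp: lp_symbol_def cscale.zero_left powr_add)

lemma continuous_lp_symbol: "continuous_on UNIV (lp_symbol \<phi> j u)"
  unfolding lp_symbol_def[abs_def]
  by (intro continuous_intros cscale.continuous_on smooth_continuous[OF smooth_\<phi>] continuous_fourier)

lemma integrable_lp_symbol: "integrable lborel (lp_symbol \<phi> j u)"
  by (rule integrable_bounded_support[OF continuous_lp_symbol lp_symbol_eq_0])

lemma bounded_lp_symbol: "bounded (range (lp_symbol \<phi> j u))"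
  by (rule bounded_range_of_bounded_support[OF continuous_lp_symbol lp_symbol_eq_0])

lemma cutoff_lp_symbol: "cscale (cutoff (r j *\<^sub>R \<xi>)) (lp_symbol \<phi> j u \<xi>) = lp_symbol \<phi> j u \<xi>"
proof (cases "\<phi> j \<xi> = 0")
  case True
  then show ?thesis by (simp add: lp_symbol_def cscale.zero_left cscale.zero_right)
next
  case False
  note * = support_\<phi>[OF False]
  have "1 / 2 = r j * 2 powr (real_of_int j - 1)" "2 = r j * 2 powr (real_of_int j + 1)"
    by (simp_all add: powr_minus powr_diff powr_add)
  moreover have "r j * 2 powr (real_of_int j - 1) \<le> r j * norm \<xi>" "r j * norm \<xi> \<le> r j * 2 powr (real_of_int j + 1)"
    using * by (auto intro!: mult_left_mono)
  ultimately have "1 / 2 \<le> r j * norm \<xi>" "r j * norm \<xi> \<le> 2"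
    by linarith+
  then have "1 / 2 \<le> norm (r j *\<^sub>R \<xi>)" "norm (r j *\<^sub>R \<xi>) \<le> 2"
    by simp_all
  then show ?thesis by (simp add: cutoff_eq_1 cscale.h_1)
qed

lemma continuous_lp_piece: "continuous_on UNIV (lp_piece \<phi> j u)"
  unfolding lp_piece_eq[abs_def] by (rule cscale.continuous_integral_cis[OF integrable_lp_symbol])

lemma lp_piece_measurable: "lp_piece \<phi> j u \<in> borel_measurable borel"
  by (rule borel_measurable_continuous_onI[OF continuous_lp_piece])

lemma bounded_lp_piece: "bounded (range (lp_piece \<phi> j u))"
  unfolding bounded_iff lp_piece_eq using cscale.norm_integral_cis_le[OF integrable_lp_symbol] by blast

text \<open>A continuous symbol with bounded support need not have an integrable transform.
  Integrability comes from writing the piece as a convolution of \<open>u\<close> with the kernel of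
  \<open>\<phi> j\<close>.\<close>

lemma fourier_lp_piece:
  "integrable lborel (lp_piece \<phi> j u)"
  "(LINT x|lborel. cscale (cis (- (x \<bullet> \<xi>))) (lp_piece \<phi> j u x))
    = cscale (complex_of_real ((2 * pi) ^ CARD('n))) (lp_symbol \<phi> j u \<xi>)"
proof -
  let ?c = "(2 * pi) powr (- real CARD('n) / 2)"
  \<comment> \<open>Carries both normalising factors, the one of \<open>fourier\<close> and the one
    of \<open>inverse_fourier\<close>.\<close>
  define u' where "u' x = (?c * ?c) *\<^sub>R (u x, 0::'a)" for x
  have u': "integrable lborel u'" unfolding u'_def by (intro integrable_scaleR_right integrable_Pair_zero[OF u])
  have supp: "\<phi> j x = 0" if "2 powr (real_of_int j + 1) < norm x" for x
    using support_\<phi>(2)[of j x] that by force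
  obtain K where K: "continuous_on UNIV K" "\<And>A. integrable lborel (\<lambda>y. cmod (K y) * (1 + norm y) ^ A)"
    "\<And>\<xi>. (LINT y|lborel. cis (- (y \<bullet> \<xi>)) * K y) = \<phi> j \<xi>"
    "\<And>y. (LINT x|lborel. cis (y \<bullet> x) * \<phi> j x) = complex_of_real ((2 * pi) ^ CARD('n)) * K y"
    by (rule schwartz_kernel[OF smooth_\<phi> supp]) blast+
  have iK: "integrable lborel K"
    using K(2)[of 0] K(1) by (subst integrable_norm_iff[symmetric]) (auto intro: borel_measurable_continuous_onI)
  have i\<phi>: "integrable lborel (\<phi> j)"
    by (rule integrable_bounded_support[OF smooth_continuous[OF smooth_\<phi>] supp])
  have sym: "cscale (\<phi> j \<xi>) (LINT y|lborel. cscale (cis (- (y \<bullet> \<xi>))) (u' y)) = lp_symbol \<phi> j u \<xi>" for \<xi>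
    by (simp add: u'_def lp_symbol_def fourier_def cscale.scaleR_right del: scaleR_Pair)
  have piece: "(\<lambda>x. LINT \<xi>|lborel. cscale (cis (x \<bullet> \<xi>)) (lp_symbol \<phi> j u \<xi>)) = lp_piece \<phi> j u"
    by (simp add: fun_eq_iff lp_piece_eq)
  note conv = cscale.integral_convolution[OF u' i\<phi> iK K(4) K(3), unfolded sym]
  show "integrable lborel (lp_piece \<phi> j u)" using conv(1) unfolding piece .
  have "(LINT x|lborel. cscale (cis (- (x \<bullet> \<xi>))) (lp_piece \<phi> j u x))
    = cscale (complex_of_real ((2 * pi) ^ CARD('n)) * \<phi> j \<xi>) (LINT y|lborel. cscale (cis (- (y \<bullet> \<xi>))) (u' y))"
    using conv(2)[of \<xi>] unfolding lp_piece_eq .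
  then show "(LINT x|lborel. cscale (cis (- (x \<bullet> \<xi>))) (lp_piece \<phi> j u x))
    = cscale (complex_of_real ((2 * pi) ^ CARD('n))) (lp_symbol \<phi> j u \<xi>)"
    by (simp add: cscale.h_mult sym)
qed

end

text \<open>A piece of level \<open>j\<close> is reproduced by the kernel of \<open>cutoff\<close>
  at scale \<open>r j\<close>. This kernel is the same for all levels, so \<open>d\<close> depends
  neither on \<open>j\<close> nor on \<open>u\<close>.\<close>

lemma peetre_max_lp_piece:
  "\<exists>d>0. \<forall>(u :: real^'n \<Rightarrow> 'a::euclidean_space) j x. integrable lborel u \<longrightarrow>
    (\<exists>z. \<forall>w\<in>ball z (d * r j). peetre_max A (r j) (lp_piece \<phi> j u) x * (1 + dist x z / r j) ^ A \<le> 2 * norm (lp_piece \<phi> j u w))"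
proof -
  obtain K where K: "continuous_on UNIV K" "\<And>A. integrable lborel (\<lambda>y. cmod (K y) * (1 + norm y) ^ A)"
    "\<And>\<xi>. (LINT y|lborel. cis (- (y \<bullet> \<xi>)) * K y) = cutoff \<xi>"
    "\<And>A e. 0 < e \<Longrightarrow> \<exists>d>0. \<forall>s. norm s < d \<longrightarrow>
      integrable lborel (\<lambda>y. cmod (K y - K (y + s)) * (1 + norm y) ^ A) \<and>
      (LINT y|lborel. cmod (K y - K (y + s)) * (1 + norm y) ^ A) \<le> e"
    by (rule schwartz_kernel[OF smooth_cutoff cutoff_eq_0(2)]) blast+
  have iK: "integrable lborel K"
    using K(2)[of 0] K(1) by (subst integrable_norm_iff[symmetric]) (auto intro: borel_measurable_continuous_onI)
  obtain d where d: "0 < d" "\<And>s. norm s < d \<Longrightarrow>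
      integrable lborel (\<lambda>y. cmod (K y - K (y + s)) * (1 + norm y) ^ A) \<and>
      (LINT y|lborel. cmod (K y - K (y + s)) * (1 + norm y) ^ A) \<le> 1 / 4"
    using K(4)[of "1/4" A] by auto
  show ?thesis
  proof (intro exI[of _ d] conjI allI impI d(1))
    fix u :: "real^'n \<Rightarrow> 'a" and j x assume u: "integrable lborel u"
    show "\<exists>z. \<forall>w\<in>ball z (d * r j). peetre_max A (r j) (lp_piece \<phi> j u) x * (1 + dist x z / r j) ^ A \<le> 2 * norm (lp_piece \<phi> j u w)"
    proof (rule cscale.peetre_max_large_ball[OF K(1,2) d(2)])
      show "lp_piece \<phi> j u x = (LINT y|lborel. cscale (K y) (lp_piece \<phi> j u (x - r j *\<^sub>R y)))" for x
        unfolding lp_piece_eq cscale.integral_multiplier_shift[OF integrable_lp_symbol[OF u] iK, symmetric] K(3)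
          cutoff_lp_symbol[OF u] ..
    qed (use bounded_lp_piece[OF u] lp_piece_measurable[OF u] in auto)
  qed
qed

end

section \<open>Norm estimates for Littlewood-Paley pieces\<close>

lemma borel_measurable_peetre_max:
  fixes f :: "'a::euclidean_space \<Rightarrow> 'c::real_normed_vector"
  assumes cont: "continuous_on UNIV f" and f: "bounded (range f)"
  shows "peetre_max A \<tau> f \<in> borel_measurable borel"
proof (rule borel_measurableI_greater)
  fix t
  have "{x. t < peetre_max A \<tau> f x} = (\<Union>y. {x. t < norm (f (x - \<tau> *\<^sub>R y)) / (1 + norm y) ^ A})"
    unfolding peetre_max_def by (auto simp: less_cSUP_iff[OF _ bdd_above_peetre_max[OF f]])
  moreover have "open {x. t < norm (f (x - \<tau> *\<^sub>R y)) / (1 + norm y) ^ A}" for y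
    by (intro open_Collect_less continuous_intros continuous_on_compose2[OF cont]) (auto simp: add_nonneg_eq_0_iff)
  ultimately have "open {x. t < peetre_max A \<tau> f x}" by auto
  then show "{x \<in> space borel. t < peetre_max A \<tau> f x} \<in> sets borel" by (simp add: borel_open)
qed

context dyadic
begin

lemma TL_norm_eq:
  assumes "0 < q"
  shows "TL_norm \<phi> s p q u = ennreal_rpow (\<integral>\<^sup>+x. ennreal_rpow
    (\<integral>\<^sup>+j. ennreal (2 powr (real_of_int j * s * q) * norm (lp_piece \<phi> j u x) powr q) \<partial>count_space UNIV) (p / q) \<partial>lborel) (1 / p)"
  unfolding TL_norm_def infsum_ennreal_conv_nn_integral ennreal_rpow_rpow by simp

text \<open>The maximal inequality for q-th powers, with \<open>\<theta>\<close> = p/q and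
  \<open>D\<close> = A q: the two conditions on \<open>A\<close> are those on D and on D \<theta>.
  The factor 2 of the large ball property becomes \<open>c\<close> = 2^q.\<close>

lemma peetre_TL_norm:
  assumes p: "0 < p" and q: "0 < q" and A: "real CARD('n) < real A * q" "real CARD('n) < real A * p"
  shows "\<exists>C\<ge>0. \<forall>s (u :: real^'n \<Rightarrow> 'a::euclidean_space). integrable lborel u \<longrightarrow>
    ennreal_rpow (\<integral>\<^sup>+x. ennreal_rpow (\<integral>\<^sup>+j. ennreal (2 powr (real_of_int j * s * q) *
      peetre_max A (r j) (lp_piece \<phi> j u) x powr q) \<partial>count_space UNIV) (p / q) \<partial>lborel) (1 / p)
    \<le> ennreal C * TL_norm \<phi> s p q u"
proof -
  obtain d where d: "0 < d" "\<And>(u :: real^'n \<Rightarrow> 'a) j x. integrable lborel u \<Longrightarrow>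
    \<exists>z. \<forall>w\<in>ball z (d * r j). peetre_max A (r j) (lp_piece \<phi> j u) x * (1 + dist x z / r j) ^ A \<le> 2 * norm (lp_piece \<phi> j u w)"
    using peetre_max_lp_piece[of A, where 'a='a] by blast
  have *: "real DIM(real^'n) < A * q" "real DIM(real^'n) < A * q * (p / q)" "0 < p / q"
    using A p q by auto
  obtain C where C: "0 \<le> C" "\<forall>(a :: int \<Rightarrow> real^'n \<Rightarrow> ennreal) b r.
    (\<forall>j. a j \<in> borel_measurable borel) \<longrightarrow> (\<forall>j. 0 < r j) \<longrightarrow>
    (\<forall>j x. \<exists>z. \<forall>w\<in>ball z (d * r j). b j x \<le> ennreal (2 powr q * (1 + dist x z / r j) powr (- (A * q))) * a j w) \<longrightarrow>
    (\<integral>\<^sup>+x. ennreal_rpow (\<integral>\<^sup>+j. b j x \<partial>count_space UNIV) (p / q) \<partial>lborel) \<le>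
      ennreal C * (\<integral>\<^sup>+x. ennreal_rpow (\<integral>\<^sup>+j. a j x \<partial>count_space UNIV) (p / q) \<partial>lborel)"
    using vector_valued_maximal_inequality[OF d(1) *(3) *(1) *(2), of "2 powr q", where 'i=int] by fastforce
  show ?thesis
  proof (intro exI[of _ "C powr (1 / p)"] conjI allI impI)
    fix s and u :: "real^'n \<Rightarrow> 'a" assume u: "integrable lborel u"
    let ?f = "\<lambda>j. lp_piece \<phi> j u"
    let ?a = "\<lambda>j x. ennreal (2 powr (real_of_int j * s * q) * norm (?f j x) powr q)"
    let ?b = "\<lambda>j x. ennreal (2 powr (real_of_int j * s * q) * peetre_max A (r j) (?f j) x powr q)"
    have "(\<integral>\<^sup>+x. ennreal_rpow (\<integral>\<^sup>+j. ?b j x \<partial>count_space UNIV) (p / q) \<partial>lborel)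
      \<le> ennreal C * (\<integral>\<^sup>+x. ennreal_rpow (\<integral>\<^sup>+j. ?a j x \<partial>count_space UNIV) (p / q) \<partial>lborel)"
    proof (rule C(2)[THEN spec, THEN spec, THEN spec[of _ r], THEN mp, THEN mp, THEN mp]; intro allI)
      show "?a j \<in> borel_measurable borel" for j using lp_piece_measurable[OF u, of j] by measurable
      show "0 < r j" for j by simp
      fix j x
      obtain z where z: "\<And>w. w \<in> ball z (d * r j) \<Longrightarrow> peetre_max A (r j) (?f j) x * (1 + dist x z / r j) ^ A \<le> 2 * norm (?f j w)"
        using d(2)[OF u, of j x] by blast
      define t where "t = 1 + dist x z / r j"
      have t: "0 < t" unfolding t_def by (intro add_pos_nonneg divide_nonneg_nonneg) auto
      have "?b j x \<le> ennreal (2 powr q * t powr (- (A * q))) * ?a j w" if w: "w \<in> ball z (d * r j)" for w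
      proof -
        have "peetre_max A (r j) (?f j) x \<le> 2 * norm (?f j w) / t ^ A"
          using z[OF w] t by (simp add: t_def[symmetric] le_divide_eq)
        then have "peetre_max A (r j) (?f j) x powr q \<le> (2 * norm (?f j w) / t ^ A) powr q"
          using q peetre_max_nonneg[OF bounded_lp_piece[OF u]] by (intro powr_mono2) auto
        also have "\<dots> = 2 powr q * t powr (- (A * q)) * norm (?f j w) powr q"
        proof -
          have "(t ^ A) powr q = t powr (A * q)" using t by (simp add: powr_powr flip: powr_realpow)
          then show ?thesis using t by (simp add: powr_divide powr_mult powr_minus_divide)
        qed
        finally have "2 powr (real_of_int j * s * q) * peetre_max A (r j) (?f j) x powr q
          \<le> 2 powr (real_of_int j * s * q) * (2 powr q * t powr (- (A * q)) * norm (?f j w) powr q)"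
          by (rule mult_left_mono) simp
        also have "\<dots> = (2 powr q * t powr (- (A * q))) * (2 powr (real_of_int j * s * q) * norm (?f j w) powr q)"
          by (simp only: ac_simps)
        finally show ?thesis by (simp add: ennreal_leI flip: ennreal_mult)
      qed
      then show "\<exists>z. \<forall>w\<in>ball z (d * r j). ?b j x \<le> ennreal (2 powr q * (1 + dist x z / r j) powr (- (A * q))) * ?a j w"
        unfolding t_def by blast
    qed
    then have "ennreal_rpow (\<integral>\<^sup>+x. ennreal_rpow (\<integral>\<^sup>+j. ?b j x \<partial>count_space UNIV) (p / q) \<partial>lborel) (1 / p)
      \<le> ennreal_rpow (ennreal C * (\<integral>\<^sup>+x. ennreal_rpow (\<integral>\<^sup>+j. ?a j x \<partial>count_space UNIV) (p / q) \<partial>lborel)) (1 / p)"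
      using p by (intro ennreal_rpow_mono) auto
    then show "ennreal_rpow (\<integral>\<^sup>+x. ennreal_rpow (\<integral>\<^sup>+j. ?b j x \<partial>count_space UNIV) (p / q) \<partial>lborel) (1 / p)
      \<le> ennreal (C powr (1 / p)) * TL_norm \<phi> s p q u"
      using p C(1) by (simp add: TL_norm_eq[OF q] ennreal_rpow_mult ennreal_rpow_ennreal)
  qed simp
qed

text \<open>One \<open>\<kappa>\<close> has to serve all \<open>p\<close>. Up to 2 the estimate with
  constant 1 applies. Above 2 the value at \<open>x\<close> is compared with those on a ball of
  radius d r, since the Peetre function of order 0 is the supremum; this costs 2^p/V, which is at
  most (2 M)^p.\<close>

lemma nikolskii_lp_piece:
  "\<exists>\<kappa>>0. \<forall>p>0. \<forall>(u :: real^'n \<Rightarrow> 'a::euclidean_space) j x. integrable lborel u \<longrightarrow>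
    ennreal (norm (lp_piece \<phi> j u x) powr p) \<le> ennreal (\<kappa> powr p * 2 powr (real_of_int j * real DIM(real^'n))) *
      (\<integral>\<^sup>+y. ennreal (norm (lp_piece \<phi> j u y) powr p) \<partial>lborel)"
proof -
  let ?n = "DIM(real^'n)"
  obtain d where d: "0 < d" "\<And>(u :: real^'n \<Rightarrow> 'a) j x. integrable lborel u \<Longrightarrow>
    \<exists>z. \<forall>w\<in>ball z (d * r j). peetre_max 0 (r j) (lp_piece \<phi> j u) x * (1 + dist x z / r j) ^ 0 \<le> 2 * norm (lp_piece \<phi> j u w)"
    using peetre_max_lp_piece[of 0, where 'a='a] by blast
  define V where "V = unit_ball_vol (real ?n) * d ^ ?n"
  have V: "0 < V" using d by (simp add: V_def)
  \<comment> \<open>At least 1, so that 1/V <= M <= M^p when p > 2, and (2 M)^p >= 1 for small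
    \<open>p\<close>.\<close>
  define M where "M = max 1 (1 / V)"
  have M: "1 \<le> M" "1 / V \<le> M" by (auto simp: M_def)
  have r: "2 powr (real_of_int j * real ?n) * r j ^ ?n = 1" for j
  proof -
    have "r j ^ ?n = 2 powr (- (real_of_int j * real ?n))" by (subst powr_realpow[symmetric]) (auto simp: powr_powr)
    then show ?thesis by (simp add: powr_minus)
  qed
  show ?thesis
  proof (intro exI[of _ "2 * M"] conjI allI impI)
    show "0 < 2 * M" using M by simp
    fix p :: real and u :: "real^'n \<Rightarrow> 'a" and j x assume p: "0 < p" and u: "integrable lborel u"
    let ?f = "lp_piece \<phi> j u"
    let ?I = "\<integral>\<^sup>+y. ennreal (norm (?f y) powr p) \<partial>lborel"
    show "ennreal (norm (?f x) powr p) \<le> ennreal ((2 * M) powr p * 2 powr (real_of_int j * real ?n)) * ?I"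
    proof (cases "p \<le> 2")
      case True
      have "ennreal (norm (?f x) powr p) \<le> ennreal ((2 powr real_of_int j) ^ ?n) * ?I"
      proof (rule cscale.nikolskii_le_2)
        show "integrable lborel ?f" by (rule fourier_lp_piece(1)[OF u])
        show "integrable lborel (lp_symbol \<phi> j u)" by (rule integrable_lp_symbol[OF u])
        show "bounded (range ?f)" by (rule bounded_lp_piece[OF u])
        show "bounded (range (lp_symbol \<phi> j u))" by (rule bounded_lp_symbol[OF u])
        show "?f x = (LINT \<xi>|lborel. cscale (cis (x \<bullet> \<xi>)) (lp_symbol \<phi> j u \<xi>))" for x by (rule lp_piece_eq)
        show "(LINT x|lborel. cscale (cis (- (x \<bullet> \<xi>))) (?f x)) = cscale (complex_of_real ((2 * pi) ^ ?n)) (lp_symbol \<phi> j u \<xi>)" for \<xi>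
          using fourier_lp_piece(2)[OF u] by simp
        show "lp_symbol \<phi> j u \<xi> = 0" if "2 * 2 powr real_of_int j < norm \<xi>" for \<xi> by (rule lp_symbol_eq_0[OF u that])
      qed (use p True in auto)
      also have "(2 powr real_of_int j) ^ ?n = 2 powr (real_of_int j * real ?n)"
        by (subst powr_realpow[symmetric]) (auto simp: powr_powr)
      also have "ennreal (2 powr (real_of_int j * real ?n)) * ?I \<le> ennreal ((2 * M) powr p * 2 powr (real_of_int j * real ?n)) * ?I"
      proof (intro mult_right_mono ennreal_leI)
        have "1 \<le> (2 * M) powr p" using M p by (intro ge_one_powr_ge_zero) auto
        then show "2 powr (real_of_int j * real ?n) \<le> (2 * M) powr p * 2 powr (real_of_int j * real ?n)"
          by (simp add: mult_le_cancel_right1)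
      qed simp
      finally show ?thesis .
    next
      case False
      obtain z where "\<forall>w\<in>ball z (d * r j). peetre_max 0 (r j) ?f x * (1 + dist x z / r j) ^ 0 \<le> 2 * norm (?f w)"
        using d(2)[OF u] by blast
      then have z: "norm (?f x) \<le> 2 * norm (?f w)" if "w \<in> ball z (d * r j)" for w
        using norm_le_peetre_max[OF bounded_lp_piece[OF u], of j x 0 "r j"] that by force
      have "ennreal (norm (?f x) powr p) * emeasure lborel (ball z (d * r j))
        = (\<integral>\<^sup>+w. ennreal (norm (?f x) powr p) * indicator (ball z (d * r j)) w \<partial>lborel)"
        by (simp add: nn_integral_cmult_indicator)
      also have "\<dots> \<le> (\<integral>\<^sup>+w. ennreal (2 powr p) * ennreal (norm (?f w) powr p) \<partial>lborel)"
      proof (intro nn_integral_mono)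
        fix w
        show "ennreal (norm (?f x) powr p) * indicator (ball z (d * r j)) w \<le> ennreal (2 powr p) * ennreal (norm (?f w) powr p)"
        proof (cases "w \<in> ball z (d * r j)")
          case True
          have "norm (?f x) powr p \<le> (2 * norm (?f w)) powr p" using z[OF True] p by (intro powr_mono2) auto
          then show ?thesis using True by (simp add: powr_mult ennreal_leI flip: ennreal_mult)
        qed simp
      qed
      also have "\<dots> = ennreal (2 powr p) * ?I"
        using lp_piece_measurable[OF u] by (intro nn_integral_cmult) simp
      also have "emeasure lborel (ball z (d * r j)) = ennreal (V * r j ^ ?n)"
        using d by (simp add: emeasure_ball V_def power_mult_distrib mult.assoc)
      finally have *: "ennreal (norm (?f x) powr p) * ennreal (V * r j ^ ?n) \<le> ennreal (2 powr p) * ?I" .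
      let ?R = "2 powr (real_of_int j * real ?n)"
      have "ennreal (norm (?f x) powr p) = ennreal (?R / V) * (ennreal (norm (?f x) powr p) * ennreal (V * r j ^ ?n))"
        using V r[of j] by (simp flip: ennreal_mult add: field_simps)
      also have "\<dots> \<le> ennreal (?R / V) * (ennreal (2 powr p) * ?I)"
        using * by (rule mult_left_mono) simp
      also have "\<dots> = ennreal (?R / V * 2 powr p) * ?I"
        using V by (subst ennreal_mult) (auto simp: mult.assoc)
      also have "\<dots> \<le> ennreal ((2 * M) powr p * ?R) * ?I"
      proof (intro mult_right_mono ennreal_leI)
        have "M powr 1 \<le> M powr p" using False M by (intro powr_mono) auto
        then have "1 / V \<le> M powr p" using M by simp
        then have "?R * 2 powr p * (1 / V) \<le> ?R * 2 powr p * M powr p" by (rule mult_left_mono) simp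
        then show "?R / V * 2 powr p \<le> (2 * M) powr p * ?R"
          using M by (simp add: powr_mult ac_simps)
      qed simp
      finally show ?thesis .
    qed
  qed
qed

lemma TL_norm_embedding:
  assumes p\<^sub>1: "0 < p\<^sub>1" and q: "0 < q"
  shows "\<exists>C\<ge>0. \<forall>p\<^sub>2 s\<^sub>2 \<sigma> (u :: real^'n \<Rightarrow> 'a::euclidean_space). 0 < p\<^sub>2 \<longrightarrow> p\<^sub>2 < p\<^sub>1 \<longrightarrow>
    \<sigma> - real CARD('n) / p\<^sub>1 = s\<^sub>2 - real CARD('n) / p\<^sub>2 \<longrightarrow> integrable lborel u \<longrightarrow>
    TL_norm \<phi> \<sigma> p\<^sub>1 q u \<le> ennreal C * TL_norm \<phi> s\<^sub>2 p\<^sub>2 q u"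
proof -
  obtain \<kappa> where \<kappa>: "0 < \<kappa>" "\<And>p (u :: real^'n \<Rightarrow> 'a) j x. 0 < p \<Longrightarrow> integrable lborel u \<Longrightarrow>
    ennreal (norm (lp_piece \<phi> j u x) powr p) \<le> ennreal (\<kappa> powr p * 2 powr (real_of_int j * real DIM(real^'n))) *
      (\<integral>\<^sup>+y. ennreal (norm (lp_piece \<phi> j u y) powr p) \<partial>lborel)"
    using nikolskii_lp_piece[where 'a='a] by blast
  let ?C = "(\<kappa> powr q * 2 powr (DIM(real^'n) * q / p\<^sub>1) / (1 - 2 powr - (DIM(real^'n) * q / p\<^sub>1)) + 1) powr (1 / q)"
  show ?thesis
  proof (intro exI[of _ ?C] conjI allI impI)
    fix p\<^sub>2 s\<^sub>2 \<sigma> :: real and u :: "real^'n \<Rightarrow> 'a"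
    assume *: "0 < p\<^sub>2" "p\<^sub>2 < p\<^sub>1" "\<sigma> - real CARD('n) / p\<^sub>1 = s\<^sub>2 - real CARD('n) / p\<^sub>2" and u: "integrable lborel u"
    show "TL_norm \<phi> \<sigma> p\<^sub>1 q u \<le> ennreal ?C * TL_norm \<phi> s\<^sub>2 p\<^sub>2 q u"
      unfolding TL_norm_eq[OF q]
    proof (rule jawerth_embedding)
      show "(\<lambda>x. norm (lp_piece \<phi> j u x)) \<in> borel_measurable borel" for j
        using lp_piece_measurable[OF u, of j] by measurable
    qed (use * q \<kappa>(1) \<kappa>(2)[OF *(1) u] in auto)
  qed simp
qed

end


section \<open>Fourier transforms of differential operators\<close>

lemma iterated_partial_bounded_linear:
  assumes "bounded_linear L" "smooth f"
  shows "iterated_partial is (\<lambda>x. L (f x)) = (\<lambda>x. L (iterated_partial is f x))"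
proof (induction "is")
  case (Cons i "is")
  show ?case
    unfolding iterated_partial.simps Cons
    by (rule ext, subst partial_derivI[OF bounded_linear.has_derivative[OF assms(1) smooth_has_derivative[OF smooth_iterated_partial[OF assms(2)]]]])
      (simp add: partial_deriv_def)
qed simp

lemma test_functionD:
  fixes P :: "real^'n::finite \<Rightarrow> 'a::real_normed_vector"
  assumes "P \<in> test_functions"
  shows "smooth P" and "\<exists>R. \<forall>x. R < norm x \<longrightarrow> P x = 0"
proof -
  have "bounded {x. P x \<noteq> 0}"
    using assms bounded_closure compact_imp_bounded bounded_subset[OF _ closure_subset]
    by (auto simp: test_functions_def)
  then show "\<exists>R. \<forall>x. R < norm x \<longrightarrow> P x = 0"
    unfolding bounded_iff by (metis (mono_tags, lifting) mem_Collect_eq not_le)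
qed (use assms in \<open>simp add: test_functions_def\<close>)

lemma fourier_linear:
  fixes f :: "'a::euclidean_space \<Rightarrow> 'b::euclidean_space" and u :: "real^'n::finite \<Rightarrow> 'a"
  assumes f: "linear f" and u: "integrable lborel u"
  shows "fourier (\<lambda>x. (f (u x), 0)) \<xi> = lift_linear f (fourier (\<lambda>x. (u x, 0)) \<xi>)"
proof -
  interpret l: bounded_linear "lift_linear f" by (rule bounded_linear_lift_linear[OF f])
  have "integrable lborel (\<lambda>x. (u x, 0::'a))"
    using u by (rule integrable_Pair_zero)
  then have int: "integrable lborel (\<lambda>x. cscale (cis (- (x \<bullet> \<xi>))) (u x, 0::'a))"
    using cscale.integrable_cis[of "\<lambda>x. (u x, 0::'a)" "- \<xi>"] by (simp add: inner_commute)
  have "(f (u x), 0) = lift_linear f (u x, 0)" for x by (simp add: lift_linear_def linear_0[OF f])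
  then have "(LINT x|lborel. cscale (cis (- (x \<bullet> \<xi>))) (f (u x), 0))
     = (LINT x|lborel. lift_linear f (cscale (cis (- (x \<bullet> \<xi>))) (u x, 0)))"
    by (simp add: lift_linear_cscale[OF f])
  also have "\<dots> = lift_linear f (LINT x|lborel. cscale (cis (- (x \<bullet> \<xi>))) (u x, 0))"
    by (rule integral_bounded_linear[OF l.bounded_linear_axioms int])
  finally show ?thesis by (simp add: fourier_def l.scaleR)
qed

lemma fourier_iterated_partial:
  fixes P :: "real^'n::finite \<Rightarrow> 'a::euclidean_space"
  assumes P: "P \<in> test_functions"
  shows "fourier (\<lambda>x. (iterated_partial is P x, 0)) \<xi> = cscale (\<Prod>i\<leftarrow>is. \<i> * complex_of_real (\<xi> $ i)) (fourier (\<lambda>x. (P x, 0)) \<xi>)"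
proof -
  obtain R where R: "\<And>x. R < norm x \<Longrightarrow> P x = 0" using test_functionD(2)[OF P] by blast
  have bl: "bounded_linear (\<lambda>v::'a. (v, 0::'a))"
    by (intro bounded_linear_Pair bounded_linear_ident bounded_linear_zero)
  have sm: "smooth (\<lambda>x. (P x, 0::'a))" by (rule smooth_bounded_linear[OF bl test_functionD(1)[OF P]])
  have "(LINT x|lborel. cscale (cis (- \<xi> \<bullet> x)) (iterated_partial is (\<lambda>x. (P x, 0::'a)) x))
    = cscale (\<Prod>i\<leftarrow>is. - \<i> * complex_of_real ((- \<xi>) $ i)) (LINT x|lborel. cscale (cis (- \<xi> \<bullet> x)) (P x, 0))"
    by (rule cscale.integral_cis_iterated_partial[OF sm, of R]) (simp add: R zero_prod_def)
  then show ?thesis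
    by (simp add: fourier_def iterated_partial_bounded_linear[OF bl test_functionD(1)[OF P]] cscale.scaleR_right inner_commute)
qed

lemma prod_list_eq_prod_count_list: "(\<Prod>i\<leftarrow>is. f i) = (\<Prod>i\<in>UNIV. (f i :: 'a::comm_monoid_mult) ^ count_list is i)" for "is" :: "'i::finite list"
proof (induction "is")
  case (Cons j "is")
  have "(\<Prod>i\<in>UNIV. f i ^ count_list (j # is) i) = (\<Prod>i\<in>UNIV. f i ^ count_list is i * (if i = j then f i else 1))"
    by (intro prod.cong refl) (simp add: power_commutes)
  then show ?case using Cons by (simp add: prod.distrib mult.commute)
qed simp

text \<open>Guarantees that the choice in \<open>mi_deriv\<close> picks a list with the prescribed
  multiplicities.\<close>

lemma ex_list_count: "\<exists>is. \<forall>i. count_list is i = (\<alpha> :: 'n::finite multi_index) i"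
proof -
  have "\<exists>is. \<forall>i. count_list is i = (if i \<in> I then \<alpha> i else 0)" if "finite I" for I
    using that
  proof (induction I)
    case (insert j I)
    then obtain ls where ls: "\<And>i. count_list ls i = (if i \<in> I then \<alpha> i else 0)" by blast
    have rep: "count_list (replicate m j) i = (if i = j then m else 0)" for m i by (induction m) auto
    show ?case
      by (intro exI[of _ "replicate (\<alpha> j) j @ ls"]) (use insert ls rep in auto)
  qed (auto intro: exI[of _ "[]"])
  from this[of UNIV] show ?thesis by simp
qed

text \<open>The multiplier of an iterated derivative is a product over its list and depends on the
  multiplicities alone, so the list chosen in \<open>mi_deriv\<close> leaves no trace.\<close>

lemma fourier_mi_deriv:
  fixes P :: "real^'n::finite \<Rightarrow> 'a::euclidean_space"
  assumes P: "P \<in> test_functions"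
  shows "fourier (\<lambda>x. (mi_deriv \<alpha> P x, 0)) \<xi> = cscale (\<i> ^ mi_order \<alpha> * complex_of_real (monomial \<xi> \<alpha>)) (fourier (\<lambda>x. (P x, 0)) \<xi>)"
proof -
  define ls where "ls = (SOME is. \<forall>i. count_list is i = \<alpha> i)"
  have ls: "count_list ls i = \<alpha> i" for i
    using someI_ex[OF ex_list_count[of \<alpha>]] unfolding ls_def by blast
  have "(\<Prod>i\<leftarrow>ls. \<i> * complex_of_real (\<xi> $ i)) = \<i> ^ mi_order \<alpha> * complex_of_real (monomial \<xi> \<alpha>)"
    unfolding prod_list_eq_prod_count_list ls by (simp add: power_mult_distrib prod.distrib mi_order_def monomial_def power_sum)
  then show ?thesis
    unfolding mi_deriv_def ls_def[symmetric] using fourier_iterated_partial[OF P] by simp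
qed

lemma integrable_mi_deriv:
  fixes P :: "real^'n::finite \<Rightarrow> 'a::euclidean_space"
  assumes P: "P \<in> test_functions"
  shows "integrable lborel (mi_deriv \<alpha> P)"
proof -
  obtain R where R: "\<And>x. R < norm x \<Longrightarrow> P x = 0" using test_functionD(2)[OF P] by blast
  show ?thesis unfolding mi_deriv_def
    by (rule integrable_bounded_support[OF smooth_continuous[OF smooth_iterated_partial[OF test_functionD(1)[OF P]]]
      iterated_partial_bounded_support[of R P, OF R]])
qed

lemma integrable_test_function:
  fixes P :: "real^'n::finite \<Rightarrow> 'a::euclidean_space"
  assumes P: "P \<in> test_functions"
  shows "integrable lborel P"
proof -
  obtain R where R: "\<And>x. R < norm x \<Longrightarrow> P x = 0" using test_functionD(2)[OF P] by blast
  show ?thesis by (rule integrable_bounded_support[OF smooth_continuous[OF test_functionD(1)[OF P]] R])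
qed

section \<open>The operator on the Fourier side\<close>

locale diff_operator =
  fixes k :: nat and B :: "('n::finite) multi_index \<Rightarrow> 'v::euclidean_space \<Rightarrow> 'w::euclidean_space"
  assumes linear_B: "\<And>\<alpha>. mi_order \<alpha> = k \<Longrightarrow> linear (B \<alpha>)"
begin

lemma linear_symbol: "linear (symbol k B \<xi>)"
  unfolding symbol_def[abs_def]
  by (intro linear_compose_sum ballI linear_compose_scale_right linear_B) simp

lemma symbol_scale: "symbol k B (t *\<^sub>R \<xi>) v = t ^ k *\<^sub>R symbol k B \<xi> v"
proof -
  have "monomial (t *\<^sub>R \<xi>) \<alpha> = t ^ k * monomial \<xi> \<alpha>" if "mi_order \<alpha> = k" for \<alpha> :: "'n multi_index"
    using that by (simp add: monomial_def power_mult_distrib prod.distrib mi_order_def flip: power_sum)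
  then show ?thesis unfolding symbol_def scaleR_sum_right by (intro sum.cong) auto
qed

lemma smooth_symbol: "smooth (\<lambda>\<xi>. symbol k B \<xi> v \<bullet> b)"
  unfolding symbol_def inner_sum_left inner_scaleR_left monomial_def
  by (intro smooth_sum smooth_mult smooth_prod smooth_power smooth_component smooth_const)

lemma integrable_diff_op:
  assumes P: "P \<in> test_functions"
  shows "integrable lborel (diff_op k B P)"
  unfolding diff_op_def[abs_def]
proof (rule Bochner_Integration.integrable_sum)
  fix \<alpha> :: "'n multi_index" assume "\<alpha> \<in> {\<alpha>. mi_order \<alpha> = k}"
  then have "bounded_linear (B \<alpha>)" using linear_B by (simp add: linear_conv_bounded_linear)
  then show "integrable lborel (\<lambda>x. B \<alpha> (mi_deriv \<alpha> P x))"
    by (rule integrable_bounded_linear[OF _ integrable_mi_deriv[OF P]])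
qed

lemma fourier_diff_op:
  assumes P: "P \<in> test_functions"
  shows "fourier (\<lambda>x. (diff_op k B P x, 0)) \<xi> = cscale (\<i> ^ k) (lift_linear (symbol k B \<xi>) (fourier (\<lambda>x. (P x, 0)) \<xi>))"
proof -
  let ?I = "{\<alpha> :: 'n multi_index. mi_order \<alpha> = k}" and ?F = "fourier (\<lambda>x. (P x, 0)) \<xi>"
  let ?c = "(2 * pi) powr (- real CARD('n) / 2)"
  have int: "integrable lborel (\<lambda>x. cscale (cis (- (x \<bullet> \<xi>))) (B \<alpha> (mi_deriv \<alpha> P x), 0::'w))" if "\<alpha> \<in> ?I" for \<alpha>
  proof -
    have "integrable lborel (\<lambda>x. B \<alpha> (mi_deriv \<alpha> P x))"
      using that linear_B by (intro integrable_bounded_linear[OF _ integrable_mi_deriv[OF P]]) (auto simp: linear_conv_bounded_linear)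
    then have "integrable lborel (\<lambda>x. (B \<alpha> (mi_deriv \<alpha> P x), 0::'w))"
      by (rule integrable_Pair_zero)
    then show ?thesis
      using cscale.integrable_cis[of "\<lambda>x. (B \<alpha> (mi_deriv \<alpha> P x), 0::'w)" "- \<xi>"] by (simp add: inner_commute)
  qed
  have "(diff_op k B P x, 0::'w) = (\<Sum>\<alpha>\<in>?I. (B \<alpha> (mi_deriv \<alpha> P x), 0))" for x
    by (simp add: diff_op_def sum_prod)
  then have "fourier (\<lambda>x. (diff_op k B P x, 0)) \<xi> = ?c *\<^sub>R (LINT x|lborel. (\<Sum>\<alpha>\<in>?I. cscale (cis (- (x \<bullet> \<xi>))) (B \<alpha> (mi_deriv \<alpha> P x), 0)))"
    by (simp add: fourier_def cscale.sum_right)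
  also have "\<dots> = (\<Sum>\<alpha>\<in>?I. fourier (\<lambda>x. (B \<alpha> (mi_deriv \<alpha> P x), 0)) \<xi>)"
    by (subst Bochner_Integration.integral_sum[OF int]) (auto simp: fourier_def scaleR_sum_right)
  also have "\<dots> = (\<Sum>\<alpha>\<in>?I. lift_linear (B \<alpha>) (cscale (\<i> ^ k * complex_of_real (monomial \<xi> \<alpha>)) ?F))"
    by (intro sum.cong refl) (simp add: fourier_linear[OF linear_B integrable_mi_deriv[OF P]] fourier_mi_deriv[OF P])
  also have "\<dots> = (\<Sum>\<alpha>\<in>?I. cscale (\<i> ^ k) (monomial \<xi> \<alpha> *\<^sub>R lift_linear (B \<alpha>) ?F))"
  proof (intro sum.cong refl)
    fix \<alpha> :: "'n multi_index" assume "\<alpha> \<in> ?I"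
    then have l: "linear (B \<alpha>)" using linear_B by simp
    have "cscale (complex_of_real t) w = t *\<^sub>R w" for t and w :: "'w \<times> 'w"
      by (cases w) (simp add: cscale_def)
    then show "lift_linear (B \<alpha>) (cscale (\<i> ^ k * complex_of_real (monomial \<xi> \<alpha>)) ?F) = cscale (\<i> ^ k) (monomial \<xi> \<alpha> *\<^sub>R lift_linear (B \<alpha>) ?F)"
      by (simp add: lift_linear_cscale[OF l] cscale.h_mult)
  qed
  also have "\<dots> = cscale (\<i> ^ k) (lift_linear (symbol k B \<xi>) ?F)"
    by (simp add: cscale.sum_right[symmetric] lift_linear_def symbol_def sum_prod)
  finally show ?thesis .
qed

end

section \<open>Bounding a piece by the data\<close>

locale elliptic_pair = dyadic \<phi> + diff_operator k B
  for \<phi> :: "int \<Rightarrow> real^'n::finite \<Rightarrow> complex" and k :: nat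
    and B :: "'n multi_index \<Rightarrow> 'v::euclidean_space \<Rightarrow> 'w::euclidean_space" +
  fixes A :: "'v \<Rightarrow> 'u::euclidean_space"
  assumes linear_A: "linear A"
    and injective: "\<And>\<xi> v. \<xi> \<noteq> 0 \<Longrightarrow> A v = 0 \<Longrightarrow> symbol k B \<xi> v = 0 \<Longrightarrow> v = 0"
begin

lemma lp_symbol_A:
  assumes "P \<in> test_functions"
  shows "lp_symbol \<phi> j (\<lambda>x. A (P x)) \<xi> = lift_linear A (lp_symbol \<phi> j P \<xi>)"
  using bounded_linear_lift_linear[OF linear_A]
  by (simp add: lp_symbol_def fourier_linear[OF linear_A integrable_test_function[OF assms]] lift_linear_cscale[OF linear_A]
    bounded_linear.linear linear_scale)

lemma lp_symbol_B:
  assumes "P \<in> test_functions"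
  shows "lift_linear (symbol k B \<xi>) (lp_symbol \<phi> j P \<xi>) = cscale ((- \<i>) ^ k) (lp_symbol \<phi> j (diff_op k B P) \<xi>)"
proof -
  \<comment> \<open>Undoes the factor \<i>^k that \<open>k\<close> derivatives produce on the
    Fourier side.\<close>
  have "(- \<i>) ^ k * \<i> ^ k = 1" by (simp flip: power_mult_distrib)
  then have c: "cscale ((- \<i>) ^ k) (cscale z (cscale (\<i> ^ k) w)) = cscale z w" for z and w :: "'w \<times> 'w"
    by (simp add: cscale.h_mult[symmetric] mult.left_commute[of _ z] flip: mult.assoc) (simp add: mult.commute mult.left_commute)
  show ?thesis
    using bounded_linear_lift_linear[OF linear_symbol]
    by (simp add: lp_symbol_def fourier_diff_op[OF assms] lift_linear_cscale[OF linear_symbol]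
      bounded_linear.linear linear_scale cscale.scaleR_right c)
qed

lemma norm_lift_entry_le:
  assumes "linear f" "\<And>w. norm (f w) \<le> norm w" "a \<in> Basis" "b \<in> Basis"
  shows "norm (entry b a (lift_linear f w)) \<le> norm w"
proof -
  have le: "norm ((f w \<bullet> b) *\<^sub>R a) \<le> norm w" for w
    using order_trans[OF Basis_le_norm[OF assms(4)] assms(2)] assms(3) by simp
  have "(norm ((f (fst w) \<bullet> b) *\<^sub>R a))\<^sup>2 + (norm ((f (snd w) \<bullet> b) *\<^sub>R a))\<^sup>2 \<le> (norm (fst w))\<^sup>2 + (norm (snd w))\<^sup>2"
    by (intro add_mono power_mono le) auto
  then show ?thesis
    unfolding entry_def lift_linear_def norm_prod_def fst_conv snd_conv by (intro real_sqrt_le_mono)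
qed

text \<open>The left inverse is evaluated at the rescaled frequency
  \<open>r j *\<^sub>R \<xi>\<close>, where \<open>cutoff\<close> is 1 on the support of the symbol.
  By homogeneity the second component of \<open>L\<close> at that frequency is (r j)^k times the
  symbol of the operator at \<xi>, which is the origin of the factor in the claim. Finitely many
  fixed kernels, one for each matrix entry, give a constant independent of \<open>j\<close>.\<close>

lemma norm_lp_piece_le:
  "\<exists>C\<ge>0. \<forall>(P :: real^'n \<Rightarrow> 'v) \<in> test_functions. \<forall>j x. norm (lp_piece \<phi> j P x) \<le>
    C * (peetre_max N (r j) (lp_piece \<phi> j (\<lambda>x. A (P x))) x + r j ^ k * peetre_max N (r j) (lp_piece \<phi> j (diff_op k B P)) x)"
proof -
  define L where "L \<xi> v = (A v, symbol k B \<xi> v)" for \<xi> v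
  have "\<exists>m :: 'v \<Rightarrow> 'u \<times> 'w \<Rightarrow> real^'n \<Rightarrow> complex.
    (\<forall>a b. smooth (m a b) \<and> (\<forall>\<xi>. 4 < norm \<xi> \<longrightarrow> m a b \<xi> = 0)) \<and>
    (\<forall>\<xi> v. \<forall>a\<in>Basis. cutoff \<xi> * complex_of_real (v \<bullet> a) = (\<Sum>b\<in>Basis. m a b \<xi> * complex_of_real (L \<xi> v \<bullet> b)))"
  proof (rule smooth_left_inverse)
    show "linear (L \<xi>)" for \<xi>
      using linear_A linear_symbol[of \<xi>] by (simp add: L_def linear_iff)
    show "smooth (\<lambda>\<xi>. L \<xi> v \<bullet> b)" for v b
      unfolding L_def inner_prod_def fst_conv snd_conv by (intro smooth_add smooth_const smooth_symbol)
    show "v = 0" if "\<xi> \<noteq> 0" "L \<xi> v = 0" for \<xi> v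
      using injective[OF that(1)] that(2) by (simp add: L_def zero_prod_def)
    show "smooth cutoff" by (rule smooth_cutoff)
    show "0 < (1/4 :: real)" by simp
  qed (use cutoff_eq_0 in auto)
  then obtain m :: "'v \<Rightarrow> 'u \<times> 'w \<Rightarrow> real^'n \<Rightarrow> complex" where
    smooth_m: "\<And>a b. smooth (m a b)" and supp_m: "\<And>a b \<xi>. 4 < norm \<xi> \<Longrightarrow> m a b \<xi> = 0" and
    m: "\<And>\<xi> v a. a \<in> Basis \<Longrightarrow> cutoff \<xi> * complex_of_real (v \<bullet> a) = (\<Sum>b\<in>Basis. m a b \<xi> * complex_of_real (L \<xi> v \<bullet> b))"
    by blast
  \<comment> \<open>Bundles the facts about a kernel into one predicate, so that kernels can be
    chosen for all entries \<open>a\<close>, \<open>b\<close> at once.\<close>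
  define Q where "Q a b K \<longleftrightarrow> continuous_on UNIV K \<and> (\<forall>A. integrable lborel (\<lambda>y. cmod (K y) * (1 + norm y) ^ A)) \<and>
    (\<forall>\<xi>. (LINT y|lborel. cis (- (y \<bullet> \<xi>)) * K y) = m a b \<xi>)" for a b and K :: "real^'n \<Rightarrow> complex"
  have "\<exists>K. Q a b K" for a b
    unfolding Q_def by (rule schwartz_kernel[OF smooth_m[of a b] supp_m[of _ a b]]) blast+
  then have Q: "Q a b (SOME K. Q a b K)" for a b by (rule someI_ex)
  define K where "K a b = (SOME K. Q a b K)" for a b
  have "Q a b (K a b)" for a b unfolding K_def by (rule Q)
  then have K: "continuous_on UNIV (K a b)" "integrable lborel (\<lambda>y. cmod (K a b y) * (1 + norm y) ^ A)"
    "(LINT y|lborel. cis (- (y \<bullet> \<xi>)) * K a b y) = m a b \<xi>" for a b A \<xi>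
    unfolding Q_def by blast+
  have measK: "K a b \<in> borel_measurable borel" for a b using K(1) by (rule borel_measurable_continuous_onI)
  have iK: "integrable lborel (K a b)" for a b
    using K(2)[of a b 0] measK by (subst integrable_norm_iff[symmetric]) auto
  define c where "c a b = (LINT y|lborel. cmod (K a b y) * (1 + norm y) ^ N)" for a b
  have c0: "0 \<le> c a b" for a b unfolding c_def by (intro Bochner_Integration.integral_nonneg) simp
  define T :: "'v \<Rightarrow> 'u \<times> 'w \<Rightarrow> int \<Rightarrow> (real^'n \<Rightarrow> complex)" where "T a b j \<xi> = m a b (r j *\<^sub>R \<xi>)" for a b j \<xi>
  have contT: "continuous_on UNIV (T a b j)" for a b j
    unfolding T_def[abs_def] by (rule continuous_on_compose2[OF smooth_continuous[OF smooth_m]]) (auto intro: continuous_intros)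
  \<comment> \<open>Stated for an arbitrary target space, since it is applied to the pieces of both
    data functions.\<close>
  have mult: "integrable lborel (\<lambda>\<xi>. cscale (cis (x \<bullet> \<xi>)) (cscale (T a b j \<xi>) (lp_symbol \<phi> j u \<xi>)))" (is ?i)
    "norm (LINT \<xi>|lborel. cscale (cis (x \<bullet> \<xi>)) (cscale (T a b j \<xi>) (lp_symbol \<phi> j u \<xi>))) \<le> c a b * peetre_max N (r j) (lp_piece \<phi> j u) x" (is ?n)
    if u: "integrable lborel u" for a b j x and u :: "real^'n \<Rightarrow> 'z::euclidean_space"
  proof -
    have "integrable lborel (\<lambda>\<xi>. cscale (T a b j \<xi>) (lp_symbol \<phi> j u \<xi>))"
      by (rule integrable_bounded_support[where R="2 * 2 powr real_of_int j", OF cscale.continuous_on[OF contT continuous_lp_symbol[OF u]]])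
        (simp add: lp_symbol_eq_0[OF u] cscale.zero_right)
    then show ?i by (rule cscale.integrable_cis)
    have "(LINT \<xi>|lborel. cscale (cis (x \<bullet> \<xi>)) (cscale (T a b j \<xi>) (lp_symbol \<phi> j u \<xi>)))
      = (LINT y|lborel. cscale (K a b y) (lp_piece \<phi> j u (x - r j *\<^sub>R y)))"
      unfolding T_def K(3)[symmetric] lp_piece_eq by (rule cscale.integral_multiplier_shift[OF integrable_lp_symbol[OF u] iK])
    also have "norm \<dots> \<le> c a b * peetre_max N (r j) (lp_piece \<phi> j u) x"
      unfolding c_def
      by (rule cscale.norm_integral_shift_le(1)[OF measK lp_piece_measurable[OF u] bounded_lp_piece[OF u] K(2)])
    finally show ?n .
  qed
  \<comment> \<open>The injections of the two factors: the components of \<open>L\<close> are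
    handled as separate summands, as they lead to pieces of different functions.\<close>
  let ?i1 = "\<lambda>u::'u. (u, 0::'w)" and ?i2 = "\<lambda>w::'w. (0::'u, w)"
  have i: "linear ?i1" "linear ?i2" by (auto simp: linear_iff)
  define E1 where "E1 a b w = entry b a (lift_linear ?i1 w)" for a :: 'v and b w
  define E2 where "E2 a b w = entry b a (lift_linear ?i2 w)" for a :: 'v and b w
  have E: "bounded_linear (E1 a b)" "bounded_linear (E2 a b)"
    "cscale z (E1 a b w1) = E1 a b (cscale z w1)" "cscale z (E2 a b w2) = E2 a b (cscale z w2)" for a b z w1 w2
    unfolding E1_def[abs_def] E2_def[abs_def] entry_def
    by (auto intro!: bounded_linear_compose[OF bounded_linear_lift_linear bounded_linear_lift_linear] linear_entry i
      simp: lift_linear_cscale linear_entry i)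
  have nE: "norm (E1 a b w1) \<le> norm w1" "norm (E2 a b w2) \<le> norm w2" if "a \<in> Basis" "b \<in> Basis" for a b w1 w2
    unfolding E1_def E2_def using that i by (auto intro!: norm_lift_entry_le)
  let ?C = "\<Sum>a\<in>Basis. \<Sum>b\<in>Basis. c a b"
  show ?thesis
  proof (intro exI[of _ ?C] conjI ballI allI)
    show "0 \<le> ?C" using c0 by (intro sum_nonneg) auto
    fix P :: "real^'n \<Rightarrow> 'v" and j x assume P: "P \<in> test_functions"
    let ?AP = "\<lambda>x. A (P x)" and ?BP = "diff_op k B P"
    have iA: "integrable lborel ?AP"
      using linear_A by (intro integrable_bounded_linear[OF _ integrable_test_function[OF P]]) (simp add: linear_conv_bounded_linear)
    have iB: "integrable lborel ?BP" by (rule integrable_diff_op[OF P])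
    define X where "X a b \<xi> = cscale (cis (x \<bullet> \<xi>)) (cscale (T a b j \<xi>) (lp_symbol \<phi> j ?AP \<xi>))" for a b \<xi>
    define Y where "Y a b \<xi> = cscale (cis (x \<bullet> \<xi>)) (cscale (T a b j \<xi>) (lp_symbol \<phi> j ?BP \<xi>))" for a b \<xi>
    have iX: "integrable lborel (X a b)" and iY: "integrable lborel (Y a b)" for a b
      unfolding X_def[abs_def] Y_def[abs_def] by (intro mult iA iB)+
    define F2 where "F2 a b w = E2 a b (r j ^ k *\<^sub>R cscale ((- \<i>) ^ k) w)" for a b w
    have F2: "bounded_linear (F2 a b)" for a b
      unfolding F2_def[abs_def]
      by (intro bounded_linear_compose[OF E(2)] bounded_linear_const_scaleR cscale.bounded_linear_right)
    have sym: "cscale (cis (x \<bullet> \<xi>)) (lp_symbol \<phi> j P \<xi>) = (\<Sum>a\<in>Basis. \<Sum>b\<in>Basis. E1 a b (X a b \<xi>) + F2 a b (Y a b \<xi>))" for \<xi>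
    proof -
      let ?g = "lp_symbol \<phi> j P \<xi>"
      have "lift_linear (L (r j *\<^sub>R \<xi>)) ?g = lift_linear ?i1 (lift_linear A ?g) + lift_linear ?i2 (r j ^ k *\<^sub>R lift_linear (symbol k B \<xi>) ?g)"
        by (simp add: lift_linear_def L_def symbol_scale)
      then have Lg: "lift_linear (L (r j *\<^sub>R \<xi>)) ?g = lift_linear ?i1 (lp_symbol \<phi> j ?AP \<xi>) +
          lift_linear ?i2 (r j ^ k *\<^sub>R cscale ((- \<i>) ^ k) (lp_symbol \<phi> j ?BP \<xi>))"
        by (simp add: lp_symbol_A[OF P] lp_symbol_B[OF P])
      have comm: "cscale z (r j ^ k *\<^sub>R cscale ((- \<i>) ^ k) w) = r j ^ k *\<^sub>R cscale ((- \<i>) ^ k) (cscale z w)" for z and w :: "'w \<times> 'w"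
        by (simp add: cscale.scaleR_right mult.commute flip: cscale.h_mult)
      have ent: "entry b a (u + v) = entry b a u + entry b a v" for a :: 'v and b u and v :: "('u \<times> 'w) \<times> ('u \<times> 'w)"
        by (simp add: entry_def lift_linear_def inner_add_left scaleR_add_left)
      have "?g = cscale (cutoff (r j *\<^sub>R \<xi>)) ?g" by (rule cutoff_lp_symbol[OF integrable_test_function[OF P], symmetric])
      also have "\<dots> = (\<Sum>a\<in>Basis. \<Sum>b\<in>Basis. entry b a (cscale (T a b j \<xi>) (lift_linear (L (r j *\<^sub>R \<xi>)) ?g)))"
        unfolding T_def by (rule cscale_eq_sum_entry) (rule m)
      also have "\<dots> = (\<Sum>a\<in>Basis. \<Sum>b\<in>Basis. E1 a b (cscale (T a b j \<xi>) (lp_symbol \<phi> j ?AP \<xi>)) + F2 a b (cscale (T a b j \<xi>) (lp_symbol \<phi> j ?BP \<xi>)))"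
        unfolding Lg F2_def comm[symmetric] E1_def E2_def
        by (simp add: cscale.add_right ent lift_linear_cscale[OF i(1)] lift_linear_cscale[OF i(2)])
      finally have "?g = (\<Sum>a\<in>Basis. \<Sum>b\<in>Basis. E1 a b (cscale (T a b j \<xi>) (lp_symbol \<phi> j ?AP \<xi>)) + F2 a b (cscale (T a b j \<xi>) (lp_symbol \<phi> j ?BP \<xi>)))" .
      then have "cscale (cis (x \<bullet> \<xi>)) ?g = cscale (cis (x \<bullet> \<xi>)) (\<Sum>a\<in>Basis. \<Sum>b\<in>Basis. E1 a b (cscale (T a b j \<xi>) (lp_symbol \<phi> j ?AP \<xi>)) + F2 a b (cscale (T a b j \<xi>) (lp_symbol \<phi> j ?BP \<xi>)))"
        by (rule arg_cong)
      also have "\<dots> = (\<Sum>a\<in>Basis. \<Sum>b\<in>Basis. E1 a b (X a b \<xi>) + F2 a b (Y a b \<xi>))"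
        by (simp only: cscale.sum_right cscale.add_right F2_def E(3,4) comm X_def Y_def)
      finally show ?thesis .
    qed
    have iEX: "integrable lborel (\<lambda>\<xi>. E1 a b (X a b \<xi>))" and iFY: "integrable lborel (\<lambda>\<xi>. F2 a b (Y a b \<xi>))" for a b
      using integrable_bounded_linear[OF E(1) iX] integrable_bounded_linear[OF F2 iY] by auto
    have "lp_piece \<phi> j P x = (\<Sum>a\<in>Basis. \<Sum>b\<in>Basis. E1 a b (LINT \<xi>|lborel. X a b \<xi>) + F2 a b (LINT \<xi>|lborel. Y a b \<xi>))"
      unfolding lp_piece_eq sym using iEX iFY
      by (simp add: Bochner_Integration.integral_sum integral_bounded_linear[OF E(1) iX] integral_bounded_linear[OF F2 iY])
    also have "norm \<dots> \<le> (\<Sum>a\<in>Basis. \<Sum>b\<in>Basis. c a b * (peetre_max N (r j) (lp_piece \<phi> j ?AP) x + r j ^ k * peetre_max N (r j) (lp_piece \<phi> j ?BP) x))"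
    proof (intro sum_norm_le)
      fix a b assume ab: "a \<in> (Basis :: 'v set)" "b \<in> (Basis :: ('u \<times> 'w) set)"
      have "norm (E1 a b (LINT \<xi>|lborel. X a b \<xi>)) \<le> c a b * peetre_max N (r j) (lp_piece \<phi> j ?AP) x"
        using nE(1)[OF ab] mult(2)[OF iA] unfolding X_def by (rule order_trans)
      moreover have "norm (F2 a b (LINT \<xi>|lborel. Y a b \<xi>)) \<le> r j ^ k * (c a b * peetre_max N (r j) (lp_piece \<phi> j ?BP) x)"
      proof -
        have "norm (F2 a b (LINT \<xi>|lborel. Y a b \<xi>)) \<le> norm (r j ^ k *\<^sub>R cscale ((- \<i>) ^ k) (LINT \<xi>|lborel. Y a b \<xi>))"
          unfolding F2_def by (rule nE(2)[OF ab])
        also have "\<dots> = r j ^ k * norm (LINT \<xi>|lborel. Y a b \<xi>)"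
          by (simp add: norm_cscale norm_power)
        also have "\<dots> \<le> r j ^ k * (c a b * peetre_max N (r j) (lp_piece \<phi> j ?BP) x)"
          using mult(2)[OF iB] unfolding Y_def by (intro mult_left_mono) auto
        finally show ?thesis .
      qed
      ultimately show "norm (E1 a b (LINT \<xi>|lborel. X a b \<xi>) + F2 a b (LINT \<xi>|lborel. Y a b \<xi>))
        \<le> c a b * (peetre_max N (r j) (lp_piece \<phi> j ?AP) x + r j ^ k * peetre_max N (r j) (lp_piece \<phi> j ?BP) x)"
        by (intro norm_triangle_le) (simp add: algebra_simps)
    qed
    finally show "norm (lp_piece \<phi> j P x) \<le> ?C * (peetre_max N (r j) (lp_piece \<phi> j ?AP) x + r j ^ k * peetre_max N (r j) (lp_piece \<phi> j ?BP) x)"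
      by (simp add: sum_distrib_right)
  qed
qed

end


section \<open>The a priori estimate\<close>

lemma ennreal_rpow_add_le_2:
  assumes "0 < t"
  shows "ennreal_rpow (x + y) t \<le> ennreal (2 powr t) * (ennreal_rpow x t + ennreal_rpow y t)"
proof -
  have "x + y \<le> 2 * max x y" unfolding mult_2 by (intro add_mono) auto
  then have "ennreal_rpow (x + y) t \<le> ennreal_rpow (2 * max x y) t"
    using assms by (rule ennreal_rpow_mono)
  also have "\<dots> = ennreal (2 powr t) * ennreal_rpow (max x y) t"
    using ennreal_rpow_ennreal[of 2 t] by (simp add: ennreal_rpow_mult[OF assms])
  also have "\<dots> \<le> ennreal (2 powr t) * (ennreal_rpow x t + ennreal_rpow y t)"
    by (intro mult_left_mono) (auto simp: max_def add_increasing add_increasing2)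
  finally show ?thesis .
qed

text \<open>Below exponent 1 there is no triangle inequality, so at each power a sum is replaced by
  twice the maximum, which gives one form of the constant for all \<open>p\<close> and
  \<open>q\<close>. The weight 2^(-j k) is absorbed by lowering the smoothness of the second term to
  \<open>s - k\<close>.\<close>

lemma TL_quasi_triangle:
  fixes f g h :: "int \<Rightarrow> 'a::euclidean_space \<Rightarrow> real" and C s k p q :: real
  assumes p: "0 < p" and q: "0 < q" and "0 \<le> C"
    and [measurable]: "\<And>j. g j \<in> borel_measurable borel" "\<And>j. h j \<in> borel_measurable borel"
    and nonneg: "\<And>j x. 0 \<le> f j x" "\<And>j x. 0 \<le> g j x" "\<And>j x. 0 \<le> h j x"
    and le: "\<And>j x. f j x \<le> C * (g j x + 2 powr (- (real_of_int j * k)) * h j x)"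
  defines "\<Phi> \<equiv> \<lambda>s u. ennreal_rpow (\<integral>\<^sup>+x. ennreal_rpow
    (\<integral>\<^sup>+j. ennreal (2 powr (real_of_int j * s * q) * u j x powr q) \<partial>count_space (UNIV :: int set)) (p / q) \<partial>lborel) (1 / p)"
  shows "\<Phi> s f \<le> ennreal (2 powr (1 / p) * 2 powr (1 / q) * 2 * C) * (\<Phi> s g + \<Phi> (s - k) h)"
proof -
  let ?t = "p / q"
  have t: "0 < ?t" using p q by simp
  define S where "S s u x = (\<integral>\<^sup>+j. ennreal (2 powr (real_of_int j * s * q) * u j x powr q) \<partial>count_space (UNIV :: int set))" for s and u :: "int \<Rightarrow> 'a \<Rightarrow> real" and x
  have [measurable]: "S s g \<in> borel_measurable borel" "S (s - k) h \<in> borel_measurable borel" for s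
    unfolding S_def by measurable
  define c where "c = (2 * C) powr q"
  have S: "S s f x \<le> ennreal c * (S s g x + S (s - k) h x)" for x
  proof -
    have "S s f x \<le> (\<integral>\<^sup>+j. ennreal c * (ennreal (2 powr (real_of_int j * s * q) * g j x powr q)
        + ennreal (2 powr (real_of_int j * (s - k) * q) * h j x powr q)) \<partial>count_space UNIV)"
      unfolding S_def
    proof (intro nn_integral_mono)
      fix j :: int
      let ?h = "2 powr (- (real_of_int j * k)) * h j x" and ?m = "max (g j x) (2 powr (- (real_of_int j * k)) * h j x)"
      have "C * (g j x + ?h) \<le> C * (2 * ?m)" using \<open>0 \<le> C\<close> by (intro mult_left_mono) auto
      then have "f j x powr q \<le> (2 * C * ?m) powr q"
        using le[of j x] nonneg[where j=j and x=x] q by (intro powr_mono2) auto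
      also have "\<dots> = c * ?m powr q" using \<open>0 \<le> C\<close> nonneg by (simp add: c_def powr_mult le_max_iff_disj)
      also have "\<dots> \<le> c * (g j x powr q + ?h powr q)" by (intro mult_left_mono) (auto simp: max_def c_def)
      also have "?h powr q = 2 powr (- (real_of_int j * k * q)) * h j x powr q"
        using nonneg by (simp add: powr_mult powr_powr)
      finally have "2 powr (real_of_int j * s * q) * f j x powr q \<le>
          2 powr (real_of_int j * s * q) * (c * (g j x powr q + 2 powr (- (real_of_int j * k * q)) * h j x powr q))"
        by (rule mult_left_mono) simp
      also have "\<dots> = c * (2 powr (real_of_int j * s * q) * g j x powr q +
          (2 powr (real_of_int j * s * q) * 2 powr (- (real_of_int j * k * q))) * h j x powr q)"
        by (simp only: distrib_left ac_simps)
      also have "2 powr (real_of_int j * s * q) * 2 powr (- (real_of_int j * k * q)) = 2 powr (real_of_int j * (s - k) * q)"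
        by (simp add: algebra_simps flip: powr_add)
      finally have "ennreal (2 powr (real_of_int j * s * q) * f j x powr q) \<le>
          ennreal (c * (2 powr (real_of_int j * s * q) * g j x powr q + 2 powr (real_of_int j * (s - k) * q) * h j x powr q))"
        by (rule ennreal_leI)
      then show "ennreal (2 powr (real_of_int j * s * q) * f j x powr q) \<le>
          ennreal c * (ennreal (2 powr (real_of_int j * s * q) * g j x powr q) + ennreal (2 powr (real_of_int j * (s - k) * q) * h j x powr q))"
        by (simp add: ennreal_mult c_def)
    qed
    also have "\<dots> = ennreal c * (S s g x + S (s - k) h x)"
      unfolding S_def by (simp add: nn_integral_cmult nn_integral_add)
    finally show ?thesis .
  qed
  let ?I = "\<lambda>s u. \<integral>\<^sup>+x. ennreal_rpow (S s u x) ?t \<partial>lborel"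
  have "?I s f \<le> (\<integral>\<^sup>+x. ennreal (c powr ?t * 2 powr ?t) * (ennreal_rpow (S s g x) ?t + ennreal_rpow (S (s - k) h x) ?t) \<partial>lborel)"
  proof (intro nn_integral_mono)
    fix x
    have "ennreal_rpow (S s f x) ?t \<le> ennreal_rpow (ennreal c * (S s g x + S (s - k) h x)) ?t"
      by (rule ennreal_rpow_mono[OF S t])
    also have "\<dots> = ennreal (c powr ?t) * ennreal_rpow (S s g x + S (s - k) h x) ?t"
      by (simp add: ennreal_rpow_mult[OF t] ennreal_rpow_ennreal c_def)
    also have "\<dots> \<le> ennreal (c powr ?t) * (ennreal (2 powr ?t) * (ennreal_rpow (S s g x) ?t + ennreal_rpow (S (s - k) h x) ?t))"
      by (intro mult_left_mono ennreal_rpow_add_le_2[OF t]) simp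
    finally show "ennreal_rpow (S s f x) ?t \<le> ennreal (c powr ?t * 2 powr ?t) * (ennreal_rpow (S s g x) ?t + ennreal_rpow (S (s - k) h x) ?t)"
      by (simp add: ennreal_mult mult.assoc)
  qed
  also have "\<dots> = ennreal (c powr ?t * 2 powr ?t) * (?I s g + ?I (s - k) h)"
    by (simp add: nn_integral_cmult nn_integral_add)
  finally have "ennreal_rpow (?I s f) (1 / p) \<le> ennreal_rpow (ennreal (c powr ?t * 2 powr ?t) * (?I s g + ?I (s - k) h)) (1 / p)"
    using p by (intro ennreal_rpow_mono) auto
  also have "\<dots> = ennreal ((c powr ?t * 2 powr ?t) powr (1 / p)) * ennreal_rpow (?I s g + ?I (s - k) h) (1 / p)"
    using p by (simp add: ennreal_rpow_mult ennreal_rpow_ennreal)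
  also have "\<dots> \<le> ennreal ((c powr ?t * 2 powr ?t) powr (1 / p)) * (ennreal (2 powr (1 / p)) *
      (ennreal_rpow (?I s g) (1 / p) + ennreal_rpow (?I (s - k) h) (1 / p)))"
    using p by (intro mult_left_mono ennreal_rpow_add_le_2) auto
  also have "\<dots> = ennreal ((c powr ?t * 2 powr ?t) powr (1 / p) * 2 powr (1 / p)) * (\<Phi> s g + \<Phi> (s - k) h)"
    unfolding \<Phi>_def S_def by (simp add: ennreal_mult mult.assoc)
  also have "(c powr ?t * 2 powr ?t) powr (1 / p) * 2 powr (1 / p) = 2 powr (1 / p) * 2 powr (1 / q) * 2 * C"
    using p q \<open>0 \<le> C\<close> by (simp add: c_def powr_mult powr_powr)
  finally show ?thesis unfolding \<Phi>_def S_def .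
qed

text \<open>All constants are fixed before \<open>s\<^sub>1\<close>, \<open>s\<^sub>2\<close> and
  \<open>p\<^sub>2\<close> appear: besides the dimension, the order \<open>N\<close> of the Peetre
  functions depends on \<open>p\<^sub>1\<close> and \<open>q\<close> alone, and the embedding, used
  at smoothness \<open>s\<^sub>1 - k\<close>, is uniform in the other parameters.\<close>

lemma (in elliptic_pair) TL_norm_le:
  assumes p\<^sub>1: "0 < p\<^sub>1" and q: "0 < q"
  shows "\<exists>c>0. \<forall>s\<^sub>1 s\<^sub>2 p\<^sub>2. 0 < p\<^sub>2 \<longrightarrow> p\<^sub>2 < p\<^sub>1 \<longrightarrow>
    s\<^sub>1 - real CARD('n) / p\<^sub>1 = s\<^sub>2 + real k - real CARD('n) / p\<^sub>2 \<longrightarrow>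
    (\<forall>P \<in> test_functions. TL_norm \<phi> s\<^sub>1 p\<^sub>1 q P \<le>
      ennreal c * (TL_norm \<phi> s\<^sub>1 p\<^sub>1 q (\<lambda>x. A (P x)) + TL_norm \<phi> s\<^sub>2 p\<^sub>2 q (diff_op k B P)))"
proof -
  obtain N :: nat where "max (real CARD('n) / q) (real CARD('n) / p\<^sub>1) < real N"
    using reals_Archimedean2 by blast
  then have N: "real CARD('n) < real N * q" "real CARD('n) < real N * p\<^sub>1"
    using p\<^sub>1 q by (auto simp: divide_less_eq)
  obtain C1 where C1: "0 \<le> C1" "\<And>P j x. (P :: real^'n \<Rightarrow> 'v) \<in> test_functions \<Longrightarrow> norm (lp_piece \<phi> j P x) \<le>
    C1 * (peetre_max N (r j) (lp_piece \<phi> j (\<lambda>x. A (P x))) x + r j ^ k * peetre_max N (r j) (lp_piece \<phi> j (diff_op k B P)) x)"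
    using norm_lp_piece_le[of N] by blast
  let ?\<Phi> = "\<lambda>s u. ennreal_rpow (\<integral>\<^sup>+x. ennreal_rpow (\<integral>\<^sup>+j. ennreal (2 powr (real_of_int j * s * q) *
      peetre_max N (r j) (lp_piece \<phi> j u) x powr q) \<partial>count_space UNIV) (p\<^sub>1 / q) \<partial>lborel) (1 / p\<^sub>1)"
  obtain C2 where C2: "0 \<le> C2" "\<And>s u. integrable lborel (u :: real^'n \<Rightarrow> 'u) \<Longrightarrow>
      ?\<Phi> s u \<le> ennreal C2 * TL_norm \<phi> s p\<^sub>1 q u"
    using peetre_TL_norm[OF p\<^sub>1 q N, where 'a='u] by blast
  obtain C3 where C3: "0 \<le> C3" "\<And>s u. integrable lborel (u :: real^'n \<Rightarrow> 'w) \<Longrightarrow>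
      ?\<Phi> s u \<le> ennreal C3 * TL_norm \<phi> s p\<^sub>1 q u"
    using peetre_TL_norm[OF p\<^sub>1 q N, where 'a='w] by blast
  obtain C4 where C4: "0 \<le> C4" "\<And>p\<^sub>2 s\<^sub>2 \<sigma> (u :: real^'n \<Rightarrow> 'w). 0 < p\<^sub>2 \<Longrightarrow> p\<^sub>2 < p\<^sub>1 \<Longrightarrow>
    \<sigma> - real CARD('n) / p\<^sub>1 = s\<^sub>2 - real CARD('n) / p\<^sub>2 \<Longrightarrow> integrable lborel u \<Longrightarrow>
    TL_norm \<phi> \<sigma> p\<^sub>1 q u \<le> ennreal C4 * TL_norm \<phi> s\<^sub>2 p\<^sub>2 q u"
    using TL_norm_embedding[OF p\<^sub>1 q, where 'a='w] by blast
  define C where "C = 2 powr (1 / p\<^sub>1) * 2 powr (1 / q) * 2 * C1"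
  \<comment> \<open>The summand 1 ensures that the constant is positive.\<close>
  define c where "c = C * (C2 + C3 * C4) + 1"
  have C0: "0 \<le> C" using C1 by (simp add: C_def)
  have c0: "0 < c" unfolding c_def using C0 C2(1) C3(1) C4(1) by (intro add_nonneg_pos) auto
  show ?thesis
  proof (intro exI[of _ c] conjI c0 allI impI ballI)
    fix s\<^sub>1 s\<^sub>2 p\<^sub>2 :: real and P :: "real^'n \<Rightarrow> 'v"
    assume p\<^sub>2: "0 < p\<^sub>2" "p\<^sub>2 < p\<^sub>1" and s: "s\<^sub>1 - real CARD('n) / p\<^sub>1 = s\<^sub>2 + real k - real CARD('n) / p\<^sub>2"
      and P: "P \<in> test_functions"
    let ?AP = "\<lambda>x. A (P x)" and ?BP = "diff_op k B P"
    have iA: "integrable lborel ?AP"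
      using linear_A by (intro integrable_bounded_linear[OF _ integrable_test_function[OF P]]) (simp add: linear_conv_bounded_linear)
    have iB: "integrable lborel ?BP" by (rule integrable_diff_op[OF P])
    have rk: "r j ^ k = 2 powr (- (real_of_int j * real k))" for j
      by (subst powr_realpow[symmetric]) (auto simp: powr_powr)
    have "TL_norm \<phi> s\<^sub>1 p\<^sub>1 q P \<le> ennreal C * (?\<Phi> s\<^sub>1 ?AP + ?\<Phi> (s\<^sub>1 - real k) ?BP)"
      unfolding TL_norm_eq[OF q] C_def
    proof (rule TL_quasi_triangle[OF p\<^sub>1 q C1(1)])
      show "peetre_max N (r j) (lp_piece \<phi> j ?AP) \<in> borel_measurable borel" for j
        by (rule borel_measurable_peetre_max[OF continuous_lp_piece[OF iA] bounded_lp_piece[OF iA]])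
      show "peetre_max N (r j) (lp_piece \<phi> j ?BP) \<in> borel_measurable borel" for j
        by (rule borel_measurable_peetre_max[OF continuous_lp_piece[OF iB] bounded_lp_piece[OF iB]])
      show "norm (lp_piece \<phi> j P x) \<le> C1 * (peetre_max N (r j) (lp_piece \<phi> j ?AP) x +
          2 powr (- (real_of_int j * real k)) * peetre_max N (r j) (lp_piece \<phi> j ?BP) x)" for j x
        using C1(2)[OF P] unfolding rk .
    qed (auto intro: peetre_max_nonneg[OF bounded_lp_piece[OF iA]] peetre_max_nonneg[OF bounded_lp_piece[OF iB]])
    also have "\<dots> \<le> ennreal C * (ennreal C2 * TL_norm \<phi> s\<^sub>1 p\<^sub>1 q ?AP + ennreal C3 * (ennreal C4 * TL_norm \<phi> s\<^sub>2 p\<^sub>2 q ?BP))"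
    proof (intro mult_left_mono add_mono C2(2)[OF iA])
      have "TL_norm \<phi> (s\<^sub>1 - real k) p\<^sub>1 q ?BP \<le> ennreal C4 * TL_norm \<phi> s\<^sub>2 p\<^sub>2 q ?BP"
        using s by (intro C4(2)[OF p\<^sub>2 _ iB]) simp
      then show "?\<Phi> (s\<^sub>1 - real k) ?BP \<le> ennreal C3 * (ennreal C4 * TL_norm \<phi> s\<^sub>2 p\<^sub>2 q ?BP)"
        by (intro order_trans[OF C3(2)[OF iB]] mult_left_mono) auto
    qed simp
    also have "\<dots> = ennreal (C * C2) * TL_norm \<phi> s\<^sub>1 p\<^sub>1 q ?AP + ennreal (C * (C3 * C4)) * TL_norm \<phi> s\<^sub>2 p\<^sub>2 q ?BP"
      using C0 C2(1) C3(1) C4(1) by (simp add: ennreal_mult distrib_left mult.assoc)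
    also have "\<dots> \<le> ennreal c * TL_norm \<phi> s\<^sub>1 p\<^sub>1 q ?AP + ennreal c * TL_norm \<phi> s\<^sub>2 p\<^sub>2 q ?BP"
    proof (intro add_mono mult_right_mono ennreal_leI)
      have "0 \<le> C * C2" "0 \<le> C * (C3 * C4)" using C0 C2(1) C3(1) C4(1) by auto
      then show "C * C2 \<le> c" "C * (C3 * C4) \<le> c" by (auto simp: c_def distrib_left)
    qed auto
    finally show "TL_norm \<phi> s\<^sub>1 p\<^sub>1 q P \<le> ennreal c * (TL_norm \<phi> s\<^sub>1 p\<^sub>1 q ?AP + TL_norm \<phi> s\<^sub>2 p\<^sub>2 q ?BP)"
      by (simp add: distrib_left)
  qed
qed

text \<open>The order of the quantifiers expresses the dependence of the constant:
  \<open>s\<^sub>1\<close> and \<open>p\<^sub>2\<close> come after \<open>c\<close>. The resolution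
  \<open>\<phi>\<close> is fixed before it, since the quasi-norms are formed with it.\<close>

theorem theorem3p8:
  fixes k :: nat
    and A :: "'v::euclidean_space \<Rightarrow> 'u::euclidean_space"
    and B :: "('n::finite) multi_index \<Rightarrow> 'v \<Rightarrow> 'w::euclidean_space"
    and \<phi> :: "int \<Rightarrow> real ^ 'n \<Rightarrow> complex"
    and s\<^sub>2 p\<^sub>1 q :: real
  assumes "linear A"
    and "\<And>\<alpha>. mi_order \<alpha> = k \<Longrightarrow> linear (B \<alpha>)"
    and "(\<Union>\<xi>\<in>UNIV - {0}. ker A \<inter> ker (symbol k B \<xi>)) = {0}"
    and "dyadic_decomposition \<phi>"
    and "0 < q"
  shows "\<exists>c::real. c > 0 \<and>
    (\<forall>s\<^sub>1 p\<^sub>2 :: real.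
      0 < p\<^sub>2 \<and> p\<^sub>2 < p\<^sub>1 \<and> s\<^sub>1 < s\<^sub>2 \<and> s\<^sub>1 - s\<^sub>2 \<le> real k \<and>
      s\<^sub>1 - real CARD('n) / p\<^sub>1 = s\<^sub>2 + real k - real CARD('n) / p\<^sub>2 \<longrightarrow>
      (\<forall>P \<in> (test_functions :: (real ^ 'n \<Rightarrow> 'v) set).
        TL_norm \<phi> s\<^sub>1 p\<^sub>1 q P \<le>
          ennreal c * (TL_norm \<phi> s\<^sub>1 p\<^sub>1 q (\<lambda>x. A (P x)) + TL_norm \<phi> s\<^sub>2 p\<^sub>2 q (diff_op k B P))))"
proof -
  interpret elliptic_pair \<phi> k B A
  proof (intro elliptic_pair.intro dyadic.intro diff_operator.intro elliptic_pair_axioms.intro)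
    fix \<xi> :: "real^'n" and v assume "\<xi> \<noteq> 0" "A v = 0" "symbol k B \<xi> v = 0"
    then have "v \<in> (\<Union>\<xi>\<in>UNIV - {0}. ker A \<inter> ker (symbol k B \<xi>))" by (auto simp: ker_def)
    then have "v \<in> {0}" unfolding assms(3) .
    then show "v = 0" by simp
  qed (use assms in auto)
  show ?thesis
  proof (cases "0 < p\<^sub>1")
    case True
    from TL_norm_le[OF this \<open>0 < q\<close>] show ?thesis by blast
  \<comment> \<open>In the remaining case \<open>p\<^sub>1\<close> is not positive, no
    \<open>p\<^sub>2\<close> is admissible, and any positive constant will do.\<close>
  qed (auto intro: exI[of _ 1])
qed

end
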